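(* There exists a biharmonic map $u=\Upsilon(\psi)\in C^\infty(B^5(0,1);S^5)$ such that $\psi(0)=0$ and $\psi(r)\to\infty$ as $r\nearrow 1$.
   Context: $B^5(0,1)\subset\mathbb{R}^5$ is the open unit ball and $S^5=\{y\in\mathbb{R}^6:|y|=1\}$. For a continuous real-valued function $\psi$ on $[0,1)$ with $\psi(0)=0$, the map $\Upsilon(\psi)$ is defined by $\Upsilon(\psi)(x)=\left(\frac{x}{|x|}\sin\psi(|x|),\cos\psi(|x|)\right)\in\mathbb{R}^5\times\mathbb{R}$ for $x\neq0$ and $\Upsilon(\psi)(0)=(0,\dots,0,1)$. A smooth map $u:B^5(0,1)\to S^5\subset\mathbb{R}^6$ is (extrinsically) biharmonic if it satisfies the Euler–Lagrange equation of $E_2[u]=\int|\Delta u|^2\,dx$ for $S^5$-valued maps, namely $\Delta^2u(x)\perp T_{u(x)}S^5$ for all $x\in B^5(0,1)$. *)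

theory Defs
  imports "HOL-Analysis.Analysis"
begin

definition partial_deriv ::
    "'a::euclidean_space \<Rightarrow> ('a \<Rightarrow> 'b::real_normed_vector) \<Rightarrow> 'a \<Rightarrow> 'b" where
  "partial_deriv b f x = frechet_derivative f (at x) b"

(* The definitions below are meant for open S, where derivatives at points of S
   depend only on the values of f on S. *)

primrec C_diff_on ::
    "nat \<Rightarrow> 'a::euclidean_space set \<Rightarrow> ('a \<Rightarrow> 'b::real_normed_vector) \<Rightarrow> bool" where
  "C_diff_on 0 S f \<longleftrightarrow> continuous_on S f"
| "C_diff_on (Suc k) S f \<longleftrightarrow>
     (\<forall>x\<in>S. f differentiable (at x)) \<and> (\<forall>b\<in>Basis. C_diff_on k S (partial_deriv b f))"

definition smooth_on ::
    "'a::euclidean_space set \<Rightarrow> ('a \<Rightarrow> 'b::real_normed_vector) \<Rightarrow> bool" where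
  "smooth_on S f \<longleftrightarrow> (\<forall>k. C_diff_on k S f)"

definition laplacian ::
    "('a::euclidean_space \<Rightarrow> 'b::real_normed_vector) \<Rightarrow> 'a \<Rightarrow> 'b" where
  "laplacian f x = (\<Sum>b\<in>Basis. partial_deriv b (partial_deriv b f) x)"

(* Velocities at p of curves in M. *)
definition tangent_space :: "'b::real_normed_vector set \<Rightarrow> 'b \<Rightarrow> 'b set" where
  "tangent_space M p =
     {v. \<exists>\<gamma>::real \<Rightarrow> 'b. range \<gamma> \<subseteq> M \<and> \<gamma> 0 = p \<and> (\<gamma> has_vector_derivative v) (at 0)}"

lemma tangent_space_sphere:
  fixes y :: "'b::real_inner"
  assumes "norm y = 1"
  shows "tangent_space (sphere 0 1) y = {v. v \<bullet> y = 0}"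
proof (intro equalityI subsetI)
  fix v assume "v \<in> tangent_space (sphere 0 1) y"
  then obtain \<gamma> :: "real \<Rightarrow> 'b" where g: "range \<gamma> \<subseteq> sphere 0 1" "\<gamma> 0 = y"
      "(\<gamma> has_vector_derivative v) (at 0)"
    by (auto simp: tangent_space_def)
  have "((\<lambda>t. \<gamma> t \<bullet> \<gamma> t) has_vector_derivative (\<gamma> 0 \<bullet> v + v \<bullet> \<gamma> 0)) (at 0)"
    by (rule bounded_bilinear.has_vector_derivative[OF bounded_bilinear_inner g(3) g(3)])
  moreover have "\<gamma> t \<bullet> \<gamma> t = 1" for t
  proof -
    have "\<gamma> t \<in> sphere 0 1" using g(1) by blast
    then show ?thesis by (simp add: dot_square_norm)
  qed
  ultimately have "((\<lambda>t. 1::real) has_vector_derivative (\<gamma> 0 \<bullet> v + v \<bullet> \<gamma> 0)) (at 0)"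
    by simp
  then have "\<gamma> 0 \<bullet> v + v \<bullet> \<gamma> 0 = 0"
    using vector_derivative_unique_at has_vector_derivative_const by blast
  then show "v \<in> {v. v \<bullet> y = 0}" using g(2) by (simp add: inner_commute)
next
  fix v assume v: "v \<in> {v. v \<bullet> y = 0}"
  define \<gamma> where "\<gamma> t = cos (norm v * t) *\<^sub>R y + sin (norm v * t) *\<^sub>R (v /\<^sub>R norm v)" for t
  show "v \<in> tangent_space (sphere 0 1) y"
  proof (cases "v = 0")
    case True
    then show ?thesis using assms
      by (auto simp: tangent_space_def intro!: exI[of _ "\<lambda>_. y"])
  next
    case False
    have "norm (\<gamma> t) = 1" for t
    proof -
      have "\<gamma> t \<bullet> \<gamma> t = (cos (norm v * t))\<^sup>2 * (y \<bullet> y) + (sin (norm v * t))\<^sup>2 * ((v \<bullet> v) / (norm v)\<^sup>2)"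
        using v by (simp add: \<gamma>_def inner_add_left inner_add_right inner_commute
            power2_eq_square field_simps)
      also have "\<dots> = 1" using False assms by (simp add: dot_square_norm)
      finally show ?thesis by (simp add: norm_eq_1)
    qed
    moreover have "(\<gamma> has_vector_derivative v) (at 0)"
      unfolding \<gamma>_def using False
      by (auto intro!: derivative_eq_intros simp: has_vector_derivative_def)
    moreover have "\<gamma> 0 = y" by (simp add: \<gamma>_def)
    ultimately show ?thesis by (auto simp: tangent_space_def intro!: exI[of _ \<gamma>])
  qed
qed

(* Extrinsically biharmonic maps into the unit sphere of 'b: the Euler-Lagrange
   equation of the integral of |laplacian u|^2 among sphere-valued maps. *)
definition biharmonic_sphere_map_on ::
    "'a::euclidean_space set \<Rightarrow> ('a \<Rightarrow> 'b::euclidean_space) \<Rightarrow> bool" where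
  "biharmonic_sphere_map_on S u \<longleftrightarrow>
     smooth_on S u \<and> u ` S \<subseteq> sphere 0 1 \<and>
     (\<forall>x\<in>S. \<forall>v\<in>tangent_space (sphere 0 1) (u x). orthogonal (laplacian (laplacian u) x) v)"

(* R^6 is represented as (real^5) \<times> real, whose library norm and inner product are
   the Euclidean ones; sphere 0 1 in this type is S^5. *)
definition Upsilon :: "(real \<Rightarrow> real) \<Rightarrow> real^5 \<Rightarrow> (real^5) \<times> real" where
  "Upsilon \<psi> x =
     (if x = 0 then (0, 1)
      else (sin (\<psi> (norm x)) *\<^sub>R (x /\<^sub>R norm x), cos (\<psi> (norm x))))"

end

theory Submission
  imports Defs
begin

text \<open>In the variable \<open>t = ln r\<close>, with \<open>D = d/dt\<close>, \<open>v(t) = \<psi>(e\<^sup>t)\<close>, \<open>w = Dv\<close> and \<open>z = w + Dw\<close>, the equation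
  becomes \<open>(D - 1)(D - 3)(D + 2)(D + 4) v = N(v, w, z)\<close> with \<open>N\<close> of third order at the origin. The first-order
  factors are integrated one after the other: \<open>H = (D - 1)v\<close>, \<open>J = (D - 3)v\<close>, \<open>G = (D - 1)(D - 3)v\<close>,
  \<open>E = (D + 2)G\<close>. On the cone \<open>H > J > 0\<close>, \<open>G > 0\<close>, \<open>E > 0\<close> one has \<open>w \<ge> 2v\<close> and \<open>z \<ge> 3w\<close>, which
  forces \<open>N > 0\<close>; hence the cone is invariant. There \<open>D\<^sup>2w\<close> is comparable to \<open>w\<^sup>3\<close>, so \<open>w\<close> blows up in finite
  time, and \<open>Dw \<le> M w\<^sup>2\<close> bounds the whole state by a function of \<open>v\<close>, so that \<open>v \<rightarrow> \<infinity>\<close>. The solution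
  entering the cone from \<open>t = -\<infinity>\<close> is \<open>v \<sim> b e\<^sup>3\<^sup>t\<close>, a convergent power series in \<open>e\<^sup>3\<^sup>t\<close>, which makes the
  map smooth at the origin. Scaling moves the blow-up radius to 1.\<close>

section \<open>Calculus of smooth maps\<close>

text \<open>The roots 1, 3, -2, -4 are the exponents k for which \<open>r^k x/|x|\<close> is
  biharmonic in dimension 5. The zero-order term of the tangential equation is 12 sin (2v);
  replacing it by 24 v plus a cubic remainder is what produces these integer roots and leaves N
  without linear terms. Only r and r^3 are regular at the origin. A leading term a r with a > 0
  makes J negative near the origin, while D - 3 annihilates the leading term b r^3, so that J, G and
  E are of order r^9 with signs given by the leading coefficient of N, which is positive. The size
  of b is only a translation in t; it is taken small so that the bounds on the coefficients close. A
  fourth-order equation has no comparison principle of its own, but each first-order factor has one.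
  Blow-up of w alone would not make v unbounded, since w could be integrable up to the blow-up time.
  The bound on Dw, read as d(ln w)/dv <= M, excludes this: bounded v would keep w bounded.\<close>

lemma partial_deriv_eqI:
  "(f has_derivative f') (at x) \<Longrightarrow> partial_deriv b f x = f' b"
  unfolding partial_deriv_def using frechet_derivative_at by metis

text \<open>On an open set the derivative at a point depends only on the values nearby, so equality
  passes to all partial derivatives. This allows a map to be replaced by a convenient formula valid
  on the set only.\<close>

lemma C_diff_on_cong_imp:
  fixes S :: "'a::euclidean_space set" and f g :: "'a \<Rightarrow> 'b::real_normed_vector"
  assumes "open S" "C_diff_on k S f" "\<And>x. x \<in> S \<Longrightarrow> f x = g x"
  shows "C_diff_on k S g"
  using assms(2,3)
proof (induction k arbitrary: f g)
  case 0
  then show ?case by (simp cong: continuous_on_cong)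
next
  case (Suc k)
  have d: "(g has_derivative frechet_derivative f (at x)) (at x)" if "x \<in> S" for x
  proof -
    have "(f has_derivative frechet_derivative f (at x)) (at x)"
      using Suc.prems(1) that frechet_derivative_works by auto
    then show ?thesis
      by (rule has_derivative_transform_within_open[OF _ assms(1) that]) (use Suc.prems(2) in auto)
  qed
  have "partial_deriv b f x = partial_deriv b g x" if "x \<in> S" for x b
    using partial_deriv_eqI[OF d[OF that]] by (simp add: partial_deriv_def)
  then show ?case
    using Suc.IH Suc.prems d by (fastforce simp: differentiable_def)
qed

text \<open>\<open>partial_deriv\<close> is defined by choice through
  \<open>frechet_derivative\<close>; with this rule a closed formula for the derivative on the set
  can be used instead.\<close>

lemma C_diff_on_SucI:
  fixes S :: "'a::euclidean_space set" and f :: "'a \<Rightarrow> 'b::real_normed_vector"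
  assumes "open S" "\<And>x. x \<in> S \<Longrightarrow> (f has_derivative f' x) (at x)"
    and "\<And>b. b \<in> Basis \<Longrightarrow> C_diff_on k S (\<lambda>x. f' x b)"
  shows "C_diff_on (Suc k) S f"
proof -
  have "C_diff_on k S (partial_deriv b f)" if "b \<in> Basis" for b
    by (rule C_diff_on_cong_imp[OF assms(1) assms(3)[OF that]])
       (simp add: partial_deriv_eqI[OF assms(2)])
  then show ?thesis using assms(2) by (auto simp: differentiable_def)
qed

lemma C_diff_on_Suc_has_derivative:
  assumes "C_diff_on (Suc k) S f" "x \<in> S"
  shows "(f has_derivative (\<lambda>h. frechet_derivative f (at x) h)) (at x)"
  using assms frechet_derivative_works by auto

lemma C_diff_on_SucD:
  fixes S :: "'a::euclidean_space set" and f :: "'a \<Rightarrow> 'b::real_normed_vector"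
  shows "C_diff_on (Suc k) S f \<Longrightarrow> C_diff_on k S f"
proof (induction k arbitrary: f)
  case 0
  then show ?case
    by (auto intro!: continuous_at_imp_continuous_on differentiable_imp_continuous_within)
next
  case (Suc k)
  then show ?case by (metis C_diff_on.simps(2))
qed

lemma C_diff_on_subset:
  fixes S T :: "'a::euclidean_space set" and f :: "'a \<Rightarrow> 'b::real_normed_vector"
  shows "C_diff_on k T f \<Longrightarrow> S \<subseteq> T \<Longrightarrow> C_diff_on k S f"
  by (induction k arbitrary: f) (auto intro: continuous_on_subset)

text \<open>Needed because the radial profiles have two formulas, a series near the origin and a
  differential equation away from it, each smooth on its own open interval.\<close>

lemma C_diff_on_local:
  fixes S :: "'a::euclidean_space set" and f :: "'a \<Rightarrow> 'b::real_normed_vector"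
  assumes "\<And>x. x \<in> S \<Longrightarrow> \<exists>U. open U \<and> x \<in> U \<and> C_diff_on k U f"
  shows "C_diff_on k S f"
  using assms
proof (induction k arbitrary: f)
  case 0
  show ?case unfolding C_diff_on.simps(1)
  proof (rule continuous_at_imp_continuous_on, rule ballI)
    fix x assume "x \<in> S"
    then obtain U where "open U" "x \<in> U" "continuous_on U f" using 0 by force
    then show "isCont f x" by (simp add: continuous_on_eq_continuous_at)
  qed
next
  case (Suc k)
  have "f differentiable (at x)" if "x \<in> S" for x
    using Suc.prems[OF that] by auto
  moreover have "C_diff_on k S (partial_deriv b f)" if "b \<in> Basis" for b
    by (rule Suc.IH) (use Suc.prems that in fastforce)
  ultimately show ?case by auto
qed

lemma C_diff_on_const:
  fixes S :: "'a::euclidean_space set" and c :: "'b::real_normed_vector"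
  assumes "open S" shows "C_diff_on k S (\<lambda>x. c)"
proof (induction k arbitrary: c)
  case (Suc k)
  show ?case by (rule C_diff_on_SucI[OF assms, of _ "\<lambda>_ _. 0"]) (auto intro: Suc)
qed simp

lemma C_diff_on_bounded_linear:
  fixes S :: "'a::euclidean_space set" and f :: "'a \<Rightarrow> 'b::real_normed_vector"
  assumes "open S" "bounded_linear f" shows "C_diff_on k S f"
proof (cases k)
  case 0
  then show ?thesis using assms(2) by (simp add: linear_continuous_on)
next
  case (Suc k)
  show ?thesis unfolding Suc
    by (rule C_diff_on_SucI[OF assms(1), of _ "\<lambda>_. f"])
       (auto intro: bounded_linear_imp_has_derivative assms C_diff_on_const)
qed

lemma C_diff_on_compose_linear:
  fixes S :: "'a::euclidean_space set" and f :: "'a \<Rightarrow> 'b::real_normed_vector"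
    and g :: "'b \<Rightarrow> 'c::real_normed_vector"
  assumes S: "open S" and g: "bounded_linear g"
  shows "C_diff_on k S f \<Longrightarrow> C_diff_on k S (\<lambda>x. g (f x))"
proof (induction k arbitrary: f)
  case 0
  then show ?case using g by (simp add: bounded_linear.continuous_on)
next
  case (Suc k)
  show ?case
    apply (rule C_diff_on_SucI[OF S])
     apply (rule bounded_linear.has_derivative[OF g])
     apply (erule C_diff_on_Suc_has_derivative[OF Suc.prems])
    using Suc by (auto simp: partial_deriv_def[abs_def])
qed

lemma C_diff_on_add:
  fixes S :: "'a::euclidean_space set" and f g :: "'a \<Rightarrow> 'b::real_normed_vector"
  assumes S: "open S"
  shows "C_diff_on k S f \<Longrightarrow> C_diff_on k S g \<Longrightarrow> C_diff_on k S (\<lambda>x. f x + g x)"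
proof (induction k arbitrary: f g)
  case (Suc k)
  show ?case
    apply (rule C_diff_on_SucI[OF S])
     apply (rule has_derivative_add)
      apply (erule C_diff_on_Suc_has_derivative[OF Suc.prems(1)])
     apply (erule C_diff_on_Suc_has_derivative[OF Suc.prems(2)])
    using Suc by (auto simp: partial_deriv_def[abs_def])
qed (auto intro: continuous_intros)

lemma C_diff_on_scaleR:
  fixes S :: "'a::euclidean_space set" and f :: "'a \<Rightarrow> real" and g :: "'a \<Rightarrow> 'b::real_normed_vector"
  assumes S: "open S"
  shows "C_diff_on k S f \<Longrightarrow> C_diff_on k S g \<Longrightarrow> C_diff_on k S (\<lambda>x. f x *\<^sub>R g x)"
proof (induction k arbitrary: f g)
  case (Suc k)
  show ?case
  proof (rule C_diff_on_SucI[OF S])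
    show "((\<lambda>x. f x *\<^sub>R g x) has_derivative
       (\<lambda>h. f x *\<^sub>R frechet_derivative g (at x) h + frechet_derivative f (at x) h *\<^sub>R g x)) (at x)"
      if "x \<in> S" for x
      by (rule has_derivative_scaleR[OF C_diff_on_Suc_has_derivative[OF Suc.prems(1) that]
            C_diff_on_Suc_has_derivative[OF Suc.prems(2) that]])
    show "C_diff_on k S (\<lambda>x. f x *\<^sub>R frechet_derivative g (at x) b + frechet_derivative f (at x) b *\<^sub>R g x)"
      if "b \<in> Basis" for b
      using Suc.prems that C_diff_on_SucD[OF Suc.prems(1)] C_diff_on_SucD[OF Suc.prems(2)]
      by (intro C_diff_on_add[OF S] Suc.IH) (auto simp: partial_deriv_def[abs_def])
  qed
qed (auto intro: continuous_intros)

lemma C_diff_on_mult: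
  fixes S :: "'a::euclidean_space set" and f g :: "'a \<Rightarrow> real"
  assumes "open S" "C_diff_on k S f" "C_diff_on k S g"
  shows "C_diff_on k S (\<lambda>x. f x * g x)"
  using C_diff_on_scaleR[OF assms] by simp

lemma C_diff_on_minus:
  fixes S :: "'a::euclidean_space set" and f :: "'a \<Rightarrow> 'b::real_normed_vector"
  assumes "open S" "C_diff_on k S f"
  shows "C_diff_on k S (\<lambda>x. - f x)"
  by (rule C_diff_on_compose_linear[OF assms(1) _ assms(2)])
    (simp add: bounded_linear_minus bounded_linear_ident)

lemma C_diff_on_diff:
  fixes S :: "'a::euclidean_space set" and f g :: "'a \<Rightarrow> 'b::real_normed_vector"
  assumes "open S" "C_diff_on k S f" "C_diff_on k S g"
  shows "C_diff_on k S (\<lambda>x. f x - g x)"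
  using C_diff_on_add[OF assms(1,2) C_diff_on_minus[OF assms(1,3)]] by simp

lemma C_diff_on_power:
  fixes S :: "'a::euclidean_space set" and f :: "'a \<Rightarrow> real"
  assumes "open S" "C_diff_on k S f"
  shows "C_diff_on k S (\<lambda>x. f x ^ n)"
  by (induction n) (auto intro: C_diff_on_const C_diff_on_mult assms)

lemma C_diff_on_Pair:
  fixes S :: "'a::euclidean_space set" and f :: "'a \<Rightarrow> 'b::real_normed_vector"
    and g :: "'a \<Rightarrow> 'c::real_normed_vector"
  assumes S: "open S" "C_diff_on k S f" "C_diff_on k S g"
  shows "C_diff_on k S (\<lambda>x. (f x, g x))"
proof -
  have "C_diff_on k S (\<lambda>x. (f x, 0::'c) + (0::'b, g x))"
    by (intro C_diff_on_add C_diff_on_compose_linear[OF S(1) _ S(2)] C_diff_on_compose_linear[OF S(1) _ S(3)] S(1)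
        bounded_linear_Pair bounded_linear_ident bounded_linear_zero)
  then show ?thesis by simp
qed

section \<open>Functions of one real variable, compositions and power series\<close>

lemma C_diff_on_real_SucI:
  fixes S :: "real set" and f :: "real \<Rightarrow> 'b::real_normed_vector"
  assumes "open S" "\<And>x. x \<in> S \<Longrightarrow> (f has_vector_derivative f' x) (at x)" "C_diff_on k S f'"
  shows "C_diff_on (Suc k) S f"
  by (rule C_diff_on_SucI[OF assms(1), of _ "\<lambda>x h. h *\<^sub>R f' x"])
     (use assms in \<open>auto simp: has_vector_derivative_def\<close>)

lemma C_diff_on_real_has_vector_derivative:
  fixes S :: "real set" and f :: "real \<Rightarrow> 'b::real_normed_vector"
  assumes "C_diff_on (Suc k) S f" "x \<in> S"
  shows "(f has_vector_derivative partial_deriv 1 f x) (at x)"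
proof -
  have d: "(f has_derivative frechet_derivative f (at x)) (at x)"
    using C_diff_on_Suc_has_derivative[OF assms] .
  have "frechet_derivative f (at x) h = h *\<^sub>R frechet_derivative f (at x) 1" for h
    using linear_cmul[OF has_derivative_linear[OF d], of h 1] by simp
  then have "frechet_derivative f (at x) = (\<lambda>h. h *\<^sub>R frechet_derivative f (at x) 1)" by blast
  then show ?thesis using d unfolding has_vector_derivative_def partial_deriv_def by simp
qed

text \<open>The chain rule gives a partial derivative of \<open>f\<close> times the derivative of
  \<open>g\<close> at \<open>f x\<close>, which is again a composition, so the induction generalises
  over \<open>g\<close> and keeps \<open>f\<close> fixed.\<close>

lemma C_diff_on_compose_real:
  fixes S :: "'a::euclidean_space set" and f :: "'a \<Rightarrow> real" and g :: "real \<Rightarrow> 'b::real_normed_vector"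
  assumes S: "open S" and fS: "\<And>x. x \<in> S \<Longrightarrow> f x \<in> I"
  shows "C_diff_on k I g \<Longrightarrow> C_diff_on k S f \<Longrightarrow> C_diff_on k S (\<lambda>x. g (f x))"
proof (induction k arbitrary: g)
  case 0
  then show ?case by (auto intro!: continuous_on_compose2[of I g S f] fS)
next
  case (Suc k)
  show ?case
  proof (rule C_diff_on_SucI[OF S])
    show "((\<lambda>x. g (f x)) has_derivative (\<lambda>h. frechet_derivative f (at x) h *\<^sub>R partial_deriv 1 g (f x))) (at x)"
      if "x \<in> S" for x
      using has_derivative_compose[OF C_diff_on_Suc_has_derivative[OF Suc.prems(2) that],
        of g "\<lambda>h. h *\<^sub>R partial_deriv 1 g (f x)"]
        C_diff_on_real_has_vector_derivative[OF Suc.prems(1) fS[OF that]]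
      by (simp add: has_vector_derivative_def)
    show "C_diff_on k S (\<lambda>x. frechet_derivative f (at x) b *\<^sub>R partial_deriv 1 g (f x))"
      if "b \<in> Basis" for b
      using Suc.prems that C_diff_on_SucD[OF Suc.prems(2)]
      by (intro C_diff_on_scaleR[OF S] Suc.IH) (auto simp: partial_deriv_def[abs_def])
  qed
qed

lemma C_diff_on_inverse: "C_diff_on k {0<..} (inverse :: real \<Rightarrow> real)"
proof (induction k)
  case 0
  then show ?case by (auto intro!: continuous_intros)
next
  case (Suc k)
  show ?case
    by (rule C_diff_on_real_SucI[where f' = "\<lambda>x. - (inverse x * inverse x)"])
       (auto intro!: C_diff_on_minus C_diff_on_mult Suc DERIV_inverse'[OF DERIV_ident, simplified]
          simp flip: has_real_derivative_iff_has_vector_derivative )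
qed

lemma C_diff_on_ln: "C_diff_on k {0<..} (ln :: real \<Rightarrow> real)"
proof (cases k)
  case 0
  then show ?thesis by (auto intro!: continuous_intros)
next
  case (Suc k)
  show ?thesis unfolding Suc
    by (rule C_diff_on_real_SucI[OF _ _ C_diff_on_inverse])
       (auto simp flip: has_real_derivative_iff_has_vector_derivative intro!: derivative_eq_intros simp: field_simps)
qed

lemma C_diff_on_exp: "C_diff_on k UNIV (exp :: real \<Rightarrow> real)"
proof (induction k)
  case 0
  then show ?case by (auto intro!: continuous_intros)
next
  case (Suc k)
  show ?case
    by (rule C_diff_on_real_SucI[OF _ _ Suc])
       (auto simp flip: has_real_derivative_iff_has_vector_derivative intro!: derivative_eq_intros)
qed

lemma C_diff_on_sin_cos: "C_diff_on k UNIV (sin :: real \<Rightarrow> real) \<and> C_diff_on k UNIV (cos :: real \<Rightarrow> real)"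
proof (induction k)
  case 0
  then show ?case by (auto intro!: continuous_intros)
next
  case (Suc k)
  have "C_diff_on k UNIV (\<lambda>x::real. - sin x)" using Suc by (intro C_diff_on_minus) auto
  then have "C_diff_on (Suc k) UNIV (cos :: real \<Rightarrow> real)"
    by (intro C_diff_on_real_SucI[of _ cos "\<lambda>x. - sin x"])
       (auto simp flip: has_real_derivative_iff_has_vector_derivative intro!: derivative_eq_intros)
  moreover have "C_diff_on (Suc k) UNIV (sin :: real \<Rightarrow> real)"
    using Suc by (intro C_diff_on_real_SucI[of _ sin cos])
       (auto simp flip: has_real_derivative_iff_has_vector_derivative intro!: derivative_eq_intros)
  ultimately show ?case by blast
qed

text \<open>Termwise differentiation replaces \<open>c\<close> by \<open>diffs c\<close> and keeps
  convergence on the open interval, hence the induction over arbitrary coefficients.\<close>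

lemma C_diff_on_powser:
  fixes c :: "nat \<Rightarrow> real"
  shows "(\<And>x. \<bar>x\<bar> < R \<Longrightarrow> summable (\<lambda>n. c n * x ^ n)) \<Longrightarrow> C_diff_on k {-R<..<R} (\<lambda>x. \<Sum>n. c n * x ^ n)"
proof (induction k arbitrary: c)
  case 0
  have "isCont (\<lambda>x. \<Sum>n. c n * x ^ n) x" if "x \<in> {-R<..<R}" for x
  proof -
    have "\<bar>x\<bar> < R" using that by auto
    then obtain K where "\<bar>x\<bar> < K" "K < R" using dense by blast
    then show ?thesis by (intro isCont_powser[of c K]) (auto intro: 0)
  qed
  then show ?case by (simp add: continuous_at_imp_continuous_on)
next
  case (Suc k)
  have a: "((\<lambda>x. \<Sum>n. c n * x ^ n) has_real_derivative (\<Sum>n. diffs c n * x ^ n)) (at x)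
      \<and> summable (\<lambda>n. diffs c n * x ^ n)" if "\<bar>x\<bar> < R" for x
  proof -
    have "\<bar>x\<bar> < R" using that by auto
    then obtain K where "\<bar>x\<bar> < K" "K < R" using dense by blast
    then show ?thesis
      using termdiffs_strong[of c K x] termdiff_converges[of x K c] Suc.prems by auto
  qed
  show ?case
    by (rule C_diff_on_real_SucI[of _ _ "\<lambda>x. \<Sum>n. diffs c n * x ^ n"])
       (use a in \<open>auto simp flip: has_real_derivative_iff_has_vector_derivative intro!: Suc.IH\<close>)
qed

section \<open>Radial maps\<close>

text \<open>The Laplacian in the variable s = |x|^2. In dimension n it acts on a scalar profile with
  a = 2n, and on a profile multiplied by x with a = 2n + 4.\<close>

definition radial_lap :: "real \<Rightarrow> (real \<Rightarrow> real) \<Rightarrow> real \<Rightarrow> real" where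
  "radial_lap a P s = 4 * s * partial_deriv 1 (partial_deriv 1 P) s + a * partial_deriv 1 P s"

lemma partial_deriv_real_eqI:
  "(f has_real_derivative d) (at x) \<Longrightarrow> partial_deriv 1 f x = d"
  by (simp add: partial_deriv_eqI[OF has_field_derivative_imp_has_derivative])

lemma smooth_on_has_real_derivative:
  "smooth_on I (f :: real \<Rightarrow> real) \<Longrightarrow> x \<in> I \<Longrightarrow> (f has_real_derivative partial_deriv 1 f x) (at x)"
  using C_diff_on_real_has_vector_derivative[of 0 I f x]
  by (auto simp: smooth_on_def has_real_derivative_iff_has_vector_derivative)

lemma smooth_on_partial_deriv:
  "smooth_on S f \<Longrightarrow> b \<in> Basis \<Longrightarrow> smooth_on S (partial_deriv b f)"
  unfolding smooth_on_def by (metis C_diff_on.simps(2))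

lemma smooth_on_radial_lap:
  assumes "open I" "smooth_on I P"
  shows "smooth_on I (radial_lap a P)"
proof -
  have "smooth_on I (partial_deriv 1 P)" "smooth_on I (partial_deriv 1 (partial_deriv 1 P))"
    using assms(2) by (auto intro!: smooth_on_partial_deriv)
  then show ?thesis
    unfolding smooth_on_def radial_lap_def[abs_def]
    by (auto intro!: C_diff_on_add C_diff_on_mult C_diff_on_const
        C_diff_on_bounded_linear[of _ "\<lambda>x. x"] assms(1) bounded_linear_ident)
qed

text \<open>Profiles are functions of |x|^2 and not of |x|, so that smooth profiles give maps that
  are smooth at the origin as well.\<close>

definition radial_map :: "(real \<Rightarrow> real) \<Rightarrow> (real \<Rightarrow> real) \<Rightarrow> 'a::euclidean_space \<Rightarrow> 'a \<times> real" where
  "radial_map P Q x = (P (x \<bullet> x) *\<^sub>R x, Q (x \<bullet> x))"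

lemma smooth_on_radial_map:
  fixes S :: "'a::euclidean_space set"
  assumes S: "open S" and I: "\<And>x. x \<in> S \<Longrightarrow> x \<bullet> x \<in> I"
    and P: "smooth_on I P" and Q: "smooth_on I Q"
  shows "smooth_on S (radial_map P Q)"
  unfolding smooth_on_def
proof
  fix k
  have "C_diff_on k S (\<lambda>x. \<Sum>b\<in>B. (x \<bullet> b) * (x \<bullet> b))" if "finite B" for B :: "'a set"
    using that
  proof (induction B)
    case (insert b B)
    have "C_diff_on k S (\<lambda>x. x \<bullet> b)"
      by (intro C_diff_on_bounded_linear S bounded_linear_inner_left)
    then show ?case using insert by (simp add: C_diff_on_add C_diff_on_mult S)
  qed (simp add: C_diff_on_const S)
  then have "C_diff_on k S (\<lambda>x. x \<bullet> x)"
    by (subst euclidean_inner) (auto )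
  then have "C_diff_on k S (\<lambda>x. P (x \<bullet> x))" "C_diff_on k S (\<lambda>x. Q (x \<bullet> x))"
    using P Q unfolding smooth_on_def by (auto intro!: C_diff_on_compose_real[OF S I])
  then show "C_diff_on k S (radial_map P Q)"
    unfolding radial_map_def[abs_def]
    by (simp add: C_diff_on_Pair C_diff_on_scaleR S C_diff_on_bounded_linear bounded_linear_ident)
qed

lemma partial_deriv_cong_open:
  assumes "open S" "x \<in> S" "\<And>y. y \<in> S \<Longrightarrow> f y = g y" "(f has_derivative f') (at x)"
  shows "partial_deriv b g x = f' b"
  by (rule partial_deriv_eqI, rule has_derivative_transform_within_open[OF assms(4,1,2,3)])

text \<open>The extra 4 in the vector component is the cross term of the product rule: twice the
  gradient of P(|x|^2) paired with the derivative of x gives 4 P'(|x|^2) x.\<close>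

lemma laplacian_radial_map:
  fixes S :: "'a::euclidean_space set"
  assumes S: "open S" and I: "\<And>x. x \<in> S \<Longrightarrow> x \<bullet> x \<in> I"
    and P: "smooth_on I P" and Q: "smooth_on I Q" and x: "x \<in> S"
  shows "laplacian (radial_map P Q) x =
    radial_map (radial_lap (2 * DIM('a) + 4) P) (radial_lap (2 * DIM('a)) Q) x"
proof -
  define P1 where "P1 = partial_deriv 1 P"
  define P2 where "P2 = partial_deriv 1 P1"
  define Q1 where "Q1 = partial_deriv 1 Q"
  define Q2 where "Q2 = partial_deriv 1 Q1"
  have D: "(P has_real_derivative P1 s) (at s)" "(P1 has_real_derivative P2 s) (at s)"
    "(Q has_real_derivative Q1 s) (at s)" "(Q1 has_real_derivative Q2 s) (at s)" if "s \<in> I" for s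
    unfolding P1_def P2_def Q1_def Q2_def
    by (intro smooth_on_has_real_derivative[OF _ that] smooth_on_partial_deriv P Q; simp)+
  have sq: "((\<lambda>x. F (x \<bullet> x)) has_derivative (\<lambda>h. 2 * (y \<bullet> h) * F' (y \<bullet> y))) (at y)"
    if "\<And>s. s \<in> I \<Longrightarrow> (F has_real_derivative F' s) (at s)" "y \<in> S" for F F' :: "real \<Rightarrow> real" and y :: 'a
  proof -
    have "((\<lambda>x::'a. x \<bullet> x) has_derivative (\<lambda>h. 2 * (y \<bullet> h))) (at y)"
      by (auto intro!: derivative_eq_intros simp: inner_commute)
    from has_derivative_compose[OF this that(1)[OF I[OF that(2)], unfolded has_field_derivative_def]]
    show ?thesis by (simp add: mult.commute)
  qed
  have 1: "partial_deriv b (radial_map P Q) y =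
      ((2 * (y \<bullet> b) * P1 (y \<bullet> y)) *\<^sub>R y + P (y \<bullet> y) *\<^sub>R b, 2 * (y \<bullet> b) * Q1 (y \<bullet> y))"
    if y: "y \<in> S" for y b
    unfolding radial_map_def[abs_def]
    by (rule partial_deriv_eqI[THEN trans], rule has_derivative_Pair,
        rule has_derivative_scaleR[OF sq[OF D(1) y] has_derivative_ident], assumption,
        rule sq[OF D(3) y])
       (auto simp: algebra_simps)
  have 2: "partial_deriv b (partial_deriv b (radial_map P Q)) x =
      ((2 * P1 (x \<bullet> x) + 4 * (x \<bullet> b)\<^sup>2 * P2 (x \<bullet> x)) *\<^sub>R x + (4 * P1 (x \<bullet> x)) *\<^sub>R ((x \<bullet> b) *\<^sub>R b),
       2 * Q1 (x \<bullet> x) + 4 * (x \<bullet> b)\<^sup>2 * Q2 (x \<bullet> x))"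
    if b: "b \<in> Basis" for b
  proof -
    have i: "((\<lambda>y. 2 * (y \<bullet> b)) has_derivative (\<lambda>h. 2 * (h \<bullet> b))) (at x)"
      by (auto intro!: derivative_eq_intros)
    have "((\<lambda>y. ((2 * (y \<bullet> b) * P1 (y \<bullet> y)) *\<^sub>R y + P (y \<bullet> y) *\<^sub>R b, 2 * (y \<bullet> b) * Q1 (y \<bullet> y)))
      has_derivative (\<lambda>h. ((2 * (x \<bullet> b) * P1 (x \<bullet> x)) *\<^sub>R h +
        (2 * (x \<bullet> b) * (2 * (x \<bullet> h) * P2 (x \<bullet> x)) + 2 * (h \<bullet> b) * P1 (x \<bullet> x)) *\<^sub>R x +
        (2 * (x \<bullet> h) * P1 (x \<bullet> x)) *\<^sub>R b,
         2 * (x \<bullet> b) * (2 * (x \<bullet> h) * Q2 (x \<bullet> x)) + 2 * (h \<bullet> b) * Q1 (x \<bullet> x)))) (at x)"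
      by (intro has_derivative_Pair has_derivative_add has_derivative_scaleR has_derivative_mult
        sq[OF D(2) x] sq[OF D(4) x] i has_derivative_ident
        has_derivative_scaleR_left sq[OF D(1) x])
    from partial_deriv_cong_open[OF S x 1[symmetric] this, where b=b] b show ?thesis
      apply (simp add: algebra_simps power2_eq_square)
      apply (simp flip: scaleR_left_distrib)
      done
  qed
  have s: "(\<Sum>b\<in>Basis. (x \<bullet> b)\<^sup>2) = x \<bullet> x" by (simp add: euclidean_inner[of x x] power2_eq_square)
  have r: "(\<Sum>b\<in>Basis. (x \<bullet> b * c) *\<^sub>R b) = c *\<^sub>R x" for c
    using scaleR_sum_right[of c "\<lambda>b. (x \<bullet> b) *\<^sub>R b" Basis]
    by (simp add: euclidean_representation mult.commute)
  have "laplacian (radial_map P Q) x = (\<Sum>b\<in>Basis.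
      ((2 * P1 (x \<bullet> x) + 4 * (x \<bullet> b)\<^sup>2 * P2 (x \<bullet> x)) *\<^sub>R x + (4 * P1 (x \<bullet> x)) *\<^sub>R ((x \<bullet> b) *\<^sub>R b),
       2 * Q1 (x \<bullet> x) + 4 * (x \<bullet> b)\<^sup>2 * Q2 (x \<bullet> x)))"
    unfolding laplacian_def by (rule sum.cong[OF refl 2])
  then show ?thesis
    unfolding radial_map_def radial_lap_def P1_def[symmetric] P2_def[symmetric]
      Q1_def[symmetric] Q2_def[symmetric]
    apply (simp add: sum_prod)
    apply (simp add: sum.distrib flip: scaleR_sum_right scaleR_sum_left)
    apply (simp add: euclidean_representation sum.distrib s flip: sum_distrib_left sum_distrib_right)
    apply (simp add: algebra_simps r)
    done
qed

lemma laplacian_cong_open: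
  fixes S :: "'a::euclidean_space set"
  assumes S: "open S" and eq: "\<And>y. y \<in> S \<Longrightarrow> f y = g y" and x: "x \<in> S"
    and g: "smooth_on S g"
  shows "laplacian f x = laplacian g x"
proof -
  have d: "(h has_derivative frechet_derivative h (at y)) (at y)" if "smooth_on S h" "y \<in> S" for h y
    using that C_diff_on_Suc_has_derivative[of 0 S h y] by (simp add: smooth_on_def)
  have "partial_deriv b f y = partial_deriv b g y" if "y \<in> S" for b y
    using partial_deriv_cong_open[OF S that eq[symmetric] d[OF g that]]
    by (simp add: partial_deriv_def)
  then have "partial_deriv b (partial_deriv b f) x = partial_deriv b (partial_deriv b g) x" if "b \<in> Basis" for b
    using partial_deriv_cong_open[OF S x _ d[OF smooth_on_partial_deriv[OF g that] x]]
    by (metis partial_deriv_def)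
  then show ?thesis by (simp add: laplacian_def)
qed

text \<open>For t = ln s / 2 + T one has s d/ds = D/2, so that 4 s d^2/ds^2 becomes (D^2 - 2
  D)/s.\<close>

lemma radial_lap_ln:
  assumes J: "\<And>s. s \<in> J \<Longrightarrow> s > 0" "open J" and s: "s \<in> J"
   and P: "\<And>s. s \<in> J \<Longrightarrow> P s = p (ln s / 2 + T)"
   and p: "\<And>s. s \<in> J \<Longrightarrow> (p has_real_derivative p1 (ln s / 2 + T)) (at (ln s / 2 + T))"
    "\<And>s. s \<in> J \<Longrightarrow> (p1 has_real_derivative p2 (ln s / 2 + T)) (at (ln s / 2 + T))"
  shows "radial_lap a P s = (p2 (ln s / 2 + T) + (a / 2 - 2) * p1 (ln s / 2 + T)) / s"
proof -
  have d: "((\<lambda>s. f (ln s / 2 + T)) has_real_derivative f' / (2 * s)) (at s)"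
    if "(f has_real_derivative f') (at (ln s / 2 + T))" "s > 0" for f f' s
  proof -
    have "((\<lambda>s. ln s / 2 + T) has_real_derivative 1 / (2 * s)) (at s)"
      using that(2) by (auto intro!: derivative_eq_intros)
    from DERIV_chain2[OF that(1) this] show ?thesis by simp
  qed
  have 1: "partial_deriv 1 P s = p1 (ln s / 2 + T) / (2 * s)" if "s \<in> J" for s
    by (rule partial_deriv_real_eqI,
        rule has_field_derivative_transform_within_open[OF d[OF p(1)[OF that] J(1)[OF that]] J(2) that])
       (simp add: P)
  have "((\<lambda>s. p1 (ln s / 2 + T) / (2 * s)) has_real_derivative
      (p2 (ln s / 2 + T) - 2 * p1 (ln s / 2 + T)) / (4 * s\<^sup>2)) (at s)"
    using J(1)[OF s]
    by - (rule DERIV_cong[OF DERIV_divide[OF d[OF p(2)[OF s] J(1)[OF s]]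
          DERIV_cmult[OF DERIV_ident]]], auto simp: field_simps power2_eq_square)
  then have "(partial_deriv 1 P has_real_derivative
      (p2 (ln s / 2 + T) - 2 * p1 (ln s / 2 + T)) / (4 * s\<^sup>2)) (at s)"
    by (rule has_field_derivative_transform_within_open[OF _ J(2) s]) (simp add: 1)
  then have 2: "partial_deriv 1 (partial_deriv 1 P) s = (p2 (ln s / 2 + T) - 2 * p1 (ln s / 2 + T)) / (4 * s\<^sup>2)"
    by (rule partial_deriv_real_eqI)
  show ?thesis
    unfolding radial_lap_def 1[OF s] 2 using J(1)[OF s] by (simp add: field_simps power2_eq_square)
qed

section \<open>Maximal solutions of differential equations\<close>

text \<open>Picard iteration in a weighted norm: for y = exp (m t) phi with m > L the integral
  operator contracts bounded continuous phi with factor L/m, so a single fixed point gives the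
  solution for all t >= 0.\<close>

lemma ode_solution_lipschitz:
  fixes F :: "'a::euclidean_space \<Rightarrow> 'a"
  assumes L: "L-lipschitz_on UNIV F"
  shows "\<exists>y. y 0 = y0 \<and> (\<forall>t\<ge>0. (y has_vector_derivative F (y t)) (at t within {0..}))"
proof -
  have contF: "continuous_on S F" for S
    using L lipschitz_on_continuous_on continuous_on_subset by blast
  define m where "m = 2 * L + 1"
  have L0: "L \<ge> 0" and m: "m > 0" "L / m < 1"
    using lipschitz_on_nonneg[OF L] by (auto simp: m_def)
  define I where "I \<phi> t = integral {0..t} (\<lambda>s. F (exp (m * s) *\<^sub>R apply_bcontfun \<phi> s))" for \<phi> :: "real \<Rightarrow>\<^sub>C 'a" and t
  \<comment> \<open>\<open>bcontfun\<close> consists of functions on the whole line;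
    \<open>max 0 t\<close> extends the operator by its value at 0 to negative times.\<close>
  define P where "P \<phi> t = exp (- m * max 0 t) *\<^sub>R (y0 + I \<phi> (max 0 t))" for \<phi> t
  have cont_int: "continuous_on {0..t} (\<lambda>s. F (exp (m * s) *\<^sub>R apply_bcontfun \<phi> s))" for \<phi> t
    by (rule continuous_on_compose2[OF contF[of UNIV]]) (auto intro!: continuous_intros)
  have exp_int: "((\<lambda>s. exp (m * s)) has_integral (exp (m * t) / m - 1 / m)) {0..t}" if "t \<ge> 0" for t
  proof -
    have "((\<lambda>s. exp (m * s) / m) has_vector_derivative exp (m * s)) (at s within {0..t})" for s
      using m unfolding has_real_derivative_iff_has_vector_derivative[symmetric]
      by (auto intro!: derivative_eq_intros)
    from fundamental_theorem_of_calculus[OF that this] show ?thesis by simp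
  qed
  have bound: "norm (integral {0..t} f) \<le> K / m * exp (m * t)"
    if "t \<ge> 0" "K \<ge> 0" "continuous_on {0..t} f" "\<And>s. s \<in> {0..t} \<Longrightarrow> norm (f s) \<le> K * exp (m * s)"
    for f :: "real \<Rightarrow> 'a" and t K
  proof -
    have "norm (integral {0..t} f) \<le> integral {0..t} (\<lambda>s. K * exp (m * s))"
      by (rule integral_norm_bound_integral)
         (use that in \<open>auto intro!: integrable_continuous_interval continuous_intros\<close>)
    also have "\<dots> = K * (exp (m * t) / m - 1 / m)"
      using integral_unique[OF has_integral_mult_right[OF exp_int[OF that(1)]]] .
    also have "\<dots> \<le> K / m * exp (m * t)"
      using that(2) m by (simp add: field_simps)
    finally show ?thesis .
  qed
  have Icont: "continuous_on {0..t} (I \<phi>)" for \<phi> t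
    unfolding I_def using indefinite_integral_continuous_1[OF integrable_continuous_interval[OF cont_int]] .
  have Icont': "continuous_on {0..} (I \<phi>)" for \<phi>
  proof (rule continuous_on_eq_continuous_within[THEN iffD2, rule_format])
    fix t :: real assume t: "t \<in> {0..}"
    have "continuous (at t within {0..t+1}) (I \<phi>)"
      using Icont[of "t+1" \<phi>] t by (simp add: continuous_on_eq_continuous_within)
    moreover have "at t within {0..t+1} = at t within {0..}"
      by (rule at_within_nhd[of _ "{..<t+1}"]) auto
    ultimately show "continuous (at t within {0..}) (I \<phi>)" by simp
  qed
  have Pcont: "continuous_on UNIV (P \<phi>)" for \<phi>
    unfolding P_def
    by (intro continuous_intros continuous_on_compose2[OF Icont'[of \<phi>]]) auto
  have Pb: "norm (P \<phi> t) \<le> norm y0 + (norm (F 0) + L * norm \<phi>) / m" for \<phi> t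
  proof -
    define u where "u = max 0 t"
    have u: "u \<ge> 0" by (simp add: u_def)
    have "norm (I \<phi> u) \<le> (norm (F 0) + L * norm \<phi>) / m * exp (m * u)"
      unfolding I_def
    proof (rule bound[OF u _ cont_int])
      fix s assume s: "s \<in> {0..u}"
      have "norm (F (exp (m * s) *\<^sub>R apply_bcontfun \<phi> s)) \<le> norm (F 0) + L * norm (exp (m * s) *\<^sub>R apply_bcontfun \<phi> s)"
        using lipschitz_on_normD[OF L, of "exp (m * s) *\<^sub>R apply_bcontfun \<phi> s" 0]
          norm_triangle_ineq2[of "F (exp (m * s) *\<^sub>R apply_bcontfun \<phi> s)" "F 0"] by simp
      also have "\<dots> \<le> exp (m * s) * norm (F 0) + L * (exp (m * s) * norm \<phi>)"
        using norm_bounded[of \<phi> s] s m L0 by (intro add_mono) (auto intro!: mult_left_mono simp: mult_le_cancel_right1)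
      finally show "norm (F (exp (m * s) *\<^sub>R apply_bcontfun \<phi> s)) \<le> (norm (F 0) + L * norm \<phi>) * exp (m * s)"
        by (simp add: algebra_simps)
    qed (use L0 in auto)
    then have "exp (- m * u) * norm (I \<phi> u) \<le> (norm (F 0) + L * norm \<phi>) / m"
      using mult_left_mono[of "norm (I \<phi> u)" _ "exp (- m * u)"] by (simp add: exp_minus field_simps)
    moreover have "exp (- m * u) * norm y0 \<le> norm y0"
      using u m by (intro mult_left_le_one_le) auto
    moreover have "norm (P \<phi> t) \<le> exp (- m * u) * norm y0 + exp (- m * u) * norm (I \<phi> u)"
      unfolding P_def u_def[symmetric] using norm_triangle_ineq[of y0 "I \<phi> u"]
      by (simp flip: distrib_left)
    ultimately show ?thesis by linarith
  qed
  define T where "T \<phi> = Bcontfun (P \<phi>)" for \<phi>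
  have T: "apply_bcontfun (T \<phi>) = P \<phi>" for \<phi>
    unfolding T_def using bcontfun_normI[OF Pcont Pb] by (simp add: Bcontfun_inverse)
  have "\<exists>!\<phi>. T \<phi> = \<phi>"
  proof (rule banach_fix_type[OF _ m(2)])
    show "0 \<le> L / m" using L0 m by simp
    show "\<forall>\<phi> \<psi>. dist (T \<phi>) (T \<psi>) \<le> L / m * dist \<phi> \<psi>"
    proof (intro allI dist_bound)
      fix \<phi> \<psi> :: "real \<Rightarrow>\<^sub>C 'a" and t :: real
      define u where "u = max 0 t"
      have u: "u \<ge> 0" by (simp add: u_def)
      have "I \<phi> u - I \<psi> u = integral {0..u} (\<lambda>s. F (exp (m * s) *\<^sub>R apply_bcontfun \<phi> s) - F (exp (m * s) *\<^sub>R apply_bcontfun \<psi> s))"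
        unfolding I_def by (intro integral_diff[symmetric] integrable_continuous_interval cont_int)
      also have "norm \<dots> \<le> (L * dist \<phi> \<psi>) / m * exp (m * u)"
      proof (rule bound[OF u])
        fix s assume s: "s \<in> {0..u}"
        have "norm (F (exp (m * s) *\<^sub>R apply_bcontfun \<phi> s) - F (exp (m * s) *\<^sub>R apply_bcontfun \<psi> s))
          \<le> L * norm (exp (m * s) *\<^sub>R apply_bcontfun \<phi> s - exp (m * s) *\<^sub>R apply_bcontfun \<psi> s)"
          by (rule lipschitz_on_normD[OF L]) auto
        also have "\<dots> = L * (exp (m * s) * dist (apply_bcontfun \<phi> s) (apply_bcontfun \<psi> s))"
          by (simp add: dist_norm flip: scaleR_diff_right)
        also have "\<dots> \<le> L * (exp (m * s) * dist \<phi> \<psi>)"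
          using dist_bounded[of \<phi> s \<psi>] L0 by (intro mult_left_mono) auto
        finally show "norm (F (exp (m * s) *\<^sub>R apply_bcontfun \<phi> s) - F (exp (m * s) *\<^sub>R apply_bcontfun \<psi> s))
           \<le> L * dist \<phi> \<psi> * exp (m * s)" by (simp add: algebra_simps)
      qed (use L0 in \<open>auto intro!: continuous_on_diff cont_int\<close>)
      finally have "exp (- m * u) * norm (I \<phi> u - I \<psi> u) \<le> L / m * dist \<phi> \<psi>"
        using mult_left_mono[of "norm (I \<phi> u - I \<psi> u)" _ "exp (- m * u)"] by (simp add: exp_minus field_simps)
      then show "dist (apply_bcontfun (T \<phi>) t) (apply_bcontfun (T \<psi>) t) \<le> L / m * dist \<phi> \<psi>"
        unfolding T P_def u_def[symmetric] dist_norm by (simp flip: scaleR_diff_right)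
    qed
  qed
  then obtain \<phi> where \<phi>: "T \<phi> = \<phi>" by blast
  define y where "y t = exp (m * t) *\<^sub>R apply_bcontfun \<phi> t" for t
  have y: "y t = y0 + integral {0..t} (\<lambda>s. F (y s))" if "t \<ge> 0" for t
  proof -
    have "apply_bcontfun \<phi> t = P \<phi> t" using T[of \<phi>] \<phi> by simp
    then show ?thesis unfolding y_def using that by (simp add: P_def I_def exp_minus)
  qed
  have "(y has_vector_derivative F (y t)) (at t within {0..})" if "t \<ge> 0" for t
  proof -
    have "((\<lambda>t. y0 + integral {0..t} (\<lambda>s. F (y s))) has_vector_derivative 0 + F (y t)) (at t within {0..t+1})"
      unfolding y_def
      by (intro has_vector_derivative_add has_vector_derivative_const integral_has_vector_derivative[OF cont_int])
         (use that in auto)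
    then have "(y has_vector_derivative F (y t)) (at t within {0..t+1})"
      using that by (auto intro: has_vector_derivative_transform[rotated 2] simp: y)
    moreover have "at t within {0..t+1} = at t within {0..}"
      by (rule at_within_nhd[of _ "{..<t+1}"]) (use that in auto)
    ultimately show ?thesis by simp
  qed
  moreover have "y 0 = y0" using y[of 0] by simp
  ultimately show ?thesis by blast
qed

text \<open>Gronwall: exp (-2 L t) |y - z|^2 does not increase and starts at 0.\<close>

lemma ode_unique_on:
  fixes F :: "'a::euclidean_space \<Rightarrow> 'a"
  assumes L: "L-lipschitz_on A F"
    and y: "\<And>t. t \<in> {0..T} \<Longrightarrow> (y has_vector_derivative F (y t)) (at t within {0..})" "\<And>t. t \<in> {0..T} \<Longrightarrow> y t \<in> A"
    and z: "\<And>t. t \<in> {0..T} \<Longrightarrow> (z has_vector_derivative F (z t)) (at t within {0..})" "\<And>t. t \<in> {0..T} \<Longrightarrow> z t \<in> A"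
    and "y 0 = z 0" "t \<in> {0..T}"
  shows "y t = z t"
proof -
  define d where "d t = (y t - z t) \<bullet> (y t - z t)" for t
  define g where "g t = exp (- (2 * L) * t) * d t" for t
  have gd: "(g has_real_derivative exp (- (2 * L) * s) * (2 * ((y s - z s) \<bullet> (F (y s) - F (z s))) - 2 * L * d s)) (at s within {0..T})"
    if "s \<in> {0..T}" for s
  proof -
    have yd: "((\<lambda>t. y t - z t) has_vector_derivative F (y s) - F (z s)) (at s within {0..T})"
      by (intro has_vector_derivative_diff has_vector_derivative_within_subset[OF y(1)]
           has_vector_derivative_within_subset[OF z(1)]) (use that in auto)
    have "(d has_real_derivative 2 * ((y s - z s) \<bullet> (F (y s) - F (z s)))) (at s within {0..T})"
      unfolding has_real_derivative_iff_has_vector_derivative d_def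
      using bounded_bilinear.has_vector_derivative[OF bounded_bilinear_inner yd yd]
      by (simp add: inner_commute)
    moreover have "((\<lambda>t. exp (- (2 * L) * t)) has_real_derivative - (2 * L) * exp (- (2 * L) * s)) (at s within {0..T})"
      by (auto intro!: derivative_eq_intros)
    ultimately show ?thesis unfolding g_def
      by (rule DERIV_cong[OF DERIV_mult[rotated]]) (simp add: algebra_simps)
  qed
  have "g t \<le> g 0"
  proof (rule DERIV_nonpos_imp_decreasing_open[of 0 t g])
    show "continuous_on {0..t} g"
      using DERIV_continuous_on[OF gd] assms(7) by (auto intro: continuous_on_subset)
    fix s assume s: "0 < s" "s < t"
    then have s': "s \<in> {0..T}" using assms(7) by auto
    have "at s within {0..T} = at s" using s assms(7) by (intro at_within_interior) auto
    moreover have "2 * ((y s - z s) \<bullet> (F (y s) - F (z s))) \<le> 2 * L * d s"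
    proof -
      have "(y s - z s) \<bullet> (F (y s) - F (z s)) \<le> norm (y s - z s) * norm (F (y s) - F (z s))"
        by (rule norm_cauchy_schwarz)
      also have "\<dots> \<le> norm (y s - z s) * (L * norm (y s - z s))"
        using lipschitz_on_normD[OF L y(2)[OF s'] z(2)[OF s']] by (intro mult_left_mono) auto
      also have "\<dots> = L * d s" by (simp add: d_def dot_square_norm power2_eq_square)
      finally show ?thesis by simp
    qed
    ultimately show "\<exists>D. (g has_real_derivative D) (at s) \<and> D \<le> 0"
      using gd[OF s'] by (intro exI conjI, simp) (simp add: mult_nonneg_nonpos)
  qed (use assms in auto)
  also have "g 0 = 0" using assms by (simp add: g_def d_def)
  finally have "(y t - z t) \<bullet> (y t - z t) \<le> 0" by (simp add: g_def mult_le_0_iff flip: d_def)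
  then have "(y t - z t) \<bullet> (y t - z t) = 0" using inner_ge_zero antisym by blast
  then show ?thesis by simp
qed

text \<open>The solution is assembled from solutions of the equations whose vector field is frozen outside
  \<open>cball 0 n\<close>; these are globally Lipschitz.\<close>

lemma ode_maximal_solution:
  fixes F :: "'a::euclidean_space \<Rightarrow> 'a"
  assumes lip: "\<And>M. \<exists>L. L-lipschitz_on (cball 0 M) F"
  obtains y where "y 0 = y0" "\<And>t. t \<ge> 0 \<Longrightarrow> (y has_vector_derivative F (y t)) (at t within {0..})"
  | y T where "T > 0" "y 0 = y0" "\<And>t. t \<in> {0..<T} \<Longrightarrow> (y has_vector_derivative F (y t)) (at t within {0..})"
     "\<And>M. \<exists>t\<in>{0..<T}. norm (y t) > M"
proof -
  define Fn where "Fn n x = F (closest_point (cball 0 (real n)) x)" for n x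
  have "\<exists>y. y 0 = y0 \<and> (\<forall>t\<ge>0. (y has_vector_derivative Fn n (y t)) (at t within {0..}))" for n
  proof -
    obtain L where L: "L-lipschitz_on (cball 0 (real n)) F" using lip by blast
    have "L-lipschitz_on UNIV (Fn n)"
    proof (rule lipschitz_onI)
      fix x z :: 'a
      have "dist (Fn n x) (Fn n z) \<le> L * dist (closest_point (cball 0 (real n)) x) (closest_point (cball 0 (real n)) z)"
        unfolding Fn_def by (rule lipschitz_onD[OF L]) (rule closest_point_in_set; simp)+
      also have "\<dots> \<le> L * dist x z"
        using lipschitz_on_nonneg[OF L] by (intro mult_left_mono closest_point_lipschitz) auto
      finally show "dist (Fn n x) (Fn n z) \<le> L * dist x z" .
    qed (rule lipschitz_on_nonneg[OF L])
    then show ?thesis by (rule ode_solution_lipschitz)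
  qed
  then obtain Y where Y0: "\<And>n. Y n 0 = y0"
    and Yd: "\<And>n t. t \<ge> 0 \<Longrightarrow> (Y n has_vector_derivative Fn n (Y n t)) (at t within {0..})"
    by metis
  have Ycont: "continuous_on {0..} (Y n)" for n
    using Yd[of _ n] by (auto simp: continuous_on_eq_continuous_within intro: has_vector_derivative_continuous)
  \<comment> \<open>As long as the n-th frozen solution stays inside the ball of radius n it solves
    the original equation. The strict inequality lets a good time be prolonged a little.\<close>
  define good where "good n t \<longleftrightarrow> t \<ge> 0 \<and> (\<forall>s\<in>{0..t}. norm (Y n s) < real n)" for n t
  have good_mono: "good n s" if "good n t" "0 \<le> s" "s \<le> t" for n s t using that by (auto simp: good_def)
  have Fn_eq: "Fn n x = F x" if "norm x \<le> real n" for n x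
    unfolding Fn_def using closest_point_self[of x "cball 0 (real n)"] that by simp
  have eq: "Y n t = Y m t" if "good n t" "good m t" for n m t
  proof -
    obtain L where L: "L-lipschitz_on (cball 0 (real (max n m))) F" using lip by blast
    have n: "norm (Y n s) \<le> real n" and m: "norm (Y m s) \<le> real m" if "s \<in> {0..t}" for s
      using \<open>good n t\<close> \<open>good m t\<close> that by (auto simp: good_def intro: less_imp_le)
    have nm: "Y n s \<in> cball 0 (real (max n m))" "Y m s \<in> cball 0 (real (max n m))" if "s \<in> {0..t}" for s
      using n[OF that] m[OF that] by (auto simp: max_def)
    show ?thesis
    proof (rule ode_unique_on[OF L _ nm(1) _ nm(2)])
      fix s assume s: "s \<in> {0..t}"
      show "(Y n has_vector_derivative F (Y n s)) (at s within {0..})"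
        using Yd[of s n] s Fn_eq[OF n[OF s]] by simp
      show "(Y m has_vector_derivative F (Y m s)) (at s within {0..})"
        using Yd[of s m] s Fn_eq[OF m[OF s]] by simp
    qed (use Y0 that in \<open>auto simp: good_def\<close>)
  qed
  have open_good: "\<exists>e>0. good n (t + e)" if "good n t" for n t
  proof -
    have "((\<lambda>s. norm (Y n s)) \<longlongrightarrow> norm (Y n t)) (at t within {0..})"
      using Ycont[of n] that by (intro tendsto_norm) (auto simp: continuous_on_def good_def)
    moreover have "norm (Y n t) < real n" using that by (auto simp: good_def)
    ultimately have "eventually (\<lambda>s. norm (Y n s) < real n) (at t within {0..})"
      by (rule order_tendstoD)
    then obtain d where d: "d > 0" "\<And>s. s \<ge> 0 \<Longrightarrow> s \<noteq> t \<Longrightarrow> dist s t < d \<Longrightarrow> norm (Y n s) < real n"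
      by (auto simp: eventually_at)
    have "good n (t + d / 2)"
      unfolding good_def
    proof (intro conjI ballI)
      fix s assume "s \<in> {0..t + d / 2}"
      then show "norm (Y n s) < real n"
        using d(2)[of s] that d(1) by (cases "s \<le> t") (auto simp: good_def dist_real_def)
    qed (use that d(1) in \<open>auto simp: good_def\<close>)
    then show ?thesis using d(1) by (intro exI[of _ "d/2"]) auto
  qed
  define G where "G = {t. \<exists>n. good n t}"
  define N where "N t = (SOME n. good n t)" for t
  define y where "y t = Y (N t) t" for t
  have yY: "y t = Y n t" if "good n t" for t n
    unfolding y_def using someI[of "\<lambda>n. good n t", OF that] that by (intro eq) (auto simp: N_def)
  have g0: "good n 0" if "norm y0 < real n" for n using that Y0 by (auto simp: good_def)
  obtain n0 where n0: "norm y0 < real n0" using reals_Archimedean2 by blast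
  have y0: "y 0 = y0" using yY[OF g0[OF n0]] Y0 by simp
  have yd: "(y has_vector_derivative F (y t)) (at t within {0..})" if "t \<in> G" for t
  proof -
    obtain n where n: "good n t" using \<open>t \<in> G\<close> by (auto simp: G_def)
    obtain e where e: "e > 0" "good n (t + e)" using open_good[OF n] by blast
    have t: "t \<ge> 0" using n by (simp add: good_def)
    have "(Y n has_vector_derivative F (y t)) (at t within {0..})"
      using Yd[OF t, of n] Fn_eq[of "Y n t" n] n yY[OF n] by (auto simp: good_def less_imp_le)
    then show ?thesis
      by (rule has_vector_derivative_transform_within[OF _ e(1)])
         (use t e in \<open>auto simp: dist_real_def intro!: yY[symmetric] good_mono[OF e(2)]\<close>)
  qed
  note thesis1 = that(1) and thesis2 = that(2)
  show ?thesis
  proof (cases "G = {0..}")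
    case True
    have "(y has_vector_derivative F (y t)) (at t within {0..})" if "t \<ge> 0" for t
      using yd[of t] that True by simp
    with y0 show ?thesis by (rule thesis1)
  next
    case False
    have G0: "0 \<in> G" using g0[OF n0] by (auto simp: G_def)
    have "G \<subseteq> {0..}" unfolding G_def good_def by blast
    then obtain b where b: "b \<ge> 0" "b \<notin> G" using False by force
    have Gmono: "s \<in> G" if "t \<in> G" "0 \<le> s" "s \<le> t" for s t
      using that good_mono unfolding G_def by blast
    have Gb: "t < b" if "t \<in> G" for t
      using Gmono[OF that b(1)] b(2) by linarith
    define T where "T = Sup G"
    have bdd: "bdd_above G" using Gb by (auto intro!: bdd_aboveI[of _ b] less_imp_le)
    have Gsub: "t \<in> G" if "t \<in> {0..<T}" for t
    proof -
      have "t < Sup G" using that by (simp add: T_def)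
      then obtain u where "u \<in> G" "t < u" using less_cSup_iff[OF _ bdd, of t] G0 by blast
      then show ?thesis using that by (intro Gmono[of u t]) simp_all
    qed
    have TG: "t < T" if "t \<in> G" for t
    proof -
      obtain n where "good n t" using \<open>t \<in> G\<close> unfolding G_def by blast
      then obtain e where "e > 0" "good n (t + e)" using open_good by blast
      then have "t + e \<in> G" unfolding G_def by blast
      then have "t + e \<le> T" unfolding T_def by (rule cSup_upper[OF _ bdd])
      then show ?thesis using \<open>e > 0\<close> by simp
    qed
    \<comment> \<open>If y stayed below M, take n > M: up to a first time at which the n-th solution
      reaches norm n it agrees with y, so continuity gives norm at most M < n there. Hence it never
      reaches norm n before T, and T itself would be good, although T is a supremum that is not
      attained.\<close>
    have unb: "\<exists>t\<in>{0..<T}. norm (y t) > M" for M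
    proof (rule ccontr)
      assume "\<not> ?thesis"
      then have M: "\<And>t. t \<in> {0..<T} \<Longrightarrow> norm (y t) \<le> M" by (meson not_le)
      obtain n where n: "max M (norm y0) < real n" using reals_Archimedean2 by blast
      have T0: "T > 0" using TG[OF G0] .
      have good_n: "good n t" if t: "t \<in> {0..<T}" for t
      proof -
        define S where "S = {s \<in> {0..t}. norm (Y n s) \<ge> real n}"
        have "S = {}"
        proof (rule ccontr)
          assume ne: "S \<noteq> {}"
          have "closed ({0..t} \<inter> (\<lambda>s. norm (Y n s)) -` {real n..})"
            using t by (intro continuous_closed_preimage continuous_on_norm continuous_on_subset[OF Ycont]) auto
          moreover have "S = {0..t} \<inter> (\<lambda>s. norm (Y n s)) -` {real n..}" by (auto simp: S_def)
          ultimately have "closed S" by simp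
          moreover have "bounded S" by (rule bounded_subset[of "{0..t}"]) (auto simp: S_def)
          ultimately have cpt: "compact S" by (simp add: compact_eq_bounded_closed)
          obtain s where s: "s \<in> S" "\<And>r. r \<in> S \<Longrightarrow> s \<le> r" using compact_attains_inf[OF cpt ne] by blast
          have s0: "s > 0"
            using s(1) Y0 n by (cases "s = 0") (auto simp: S_def)
          have "norm (Y n r) \<le> M" if "r \<in> {0..<s}" for r
          proof -
            have "good n r"
              unfolding good_def
            proof (intro conjI ballI)
              fix q assume "q \<in> {0..r}"
              then have "q \<notin> S" using s(2)[of q] that by auto
              then show "norm (Y n q) < real n"
                using \<open>q \<in> {0..r}\<close> that s(1) by (auto simp: S_def not_le)
            qed (use that in auto)
            then show ?thesis using M[of r] yY[of n r] that s(1) t by (auto simp: S_def)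
          qed
          moreover have "((\<lambda>s. norm (Y n s)) \<longlongrightarrow> norm (Y n s)) (at_left s)"
          proof -
            have "(Y n \<longlongrightarrow> Y n s) (at s within {0..})"
              using Ycont[of n] s0 by (auto simp: continuous_on_def)
            moreover have "at s within {0..} = at s" using s0 by (intro at_within_interior) auto
            ultimately show ?thesis by (intro tendsto_norm) (auto simp: filterlim_at_split)
          qed
          ultimately have "norm (Y n s) \<le> M"
            using s0 by (intro tendsto_upperbound[of _ _ "at_left s"])
              (auto simp: eventually_at_left intro!: exI[of _ 0])
          then show False using s(1) n by (auto simp: S_def)
        qed
        then have "norm (Y n s) < real n" if "s \<in> {0..t}" for s
          using that unfolding S_def by fastforce
        then show ?thesis using t by (simp add: good_def)
      qed
      have lim: "norm (Y n t) \<le> M" if "t \<in> {0..<T}" for t using M[OF that] yY[OF good_n[OF that]] by simp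
      have "((\<lambda>s. norm (Y n s)) \<longlongrightarrow> norm (Y n T)) (at_left T)"
      proof -
        have "(Y n \<longlongrightarrow> Y n T) (at T within {0..})"
          using Ycont[of n] T0 by (auto simp: continuous_on_def)
        moreover have "at T within {0..} = at T" using T0 by (intro at_within_interior) auto
        ultimately show ?thesis by (intro tendsto_norm) (auto simp: filterlim_at_split)
      qed
      then have "norm (Y n T) \<le> M"
        using T0 lim by (intro tendsto_upperbound[of _ _ "at_left T"])
          (auto simp: eventually_at_left intro!: exI[of _ 0])
      then have "good n T"
        unfolding good_def
      proof (intro conjI ballI)
        fix s assume "s \<in> {0..T}"
        then have "norm (Y n s) \<le> M" using lim[of s] \<open>norm (Y n T) \<le> M\<close> by (cases "s = T") auto
        then show "norm (Y n s) < real n" using n by linarith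
      qed (use T0 in simp)
      then show False using TG[of T] by (auto simp: G_def)
    qed
    show ?thesis
      by (rule thesis2[OF TG[OF G0] y0 yd[OF Gsub] unb])
  qed
qed

section \<open>The invariant cone\<close>

text \<open>The summand 24 v is moved here from the linear operator: it turns -12 sin (2v), which
  has a linear part, into a term of third order.\<close>

definition bih_rhs :: "real \<Rightarrow> real \<Rightarrow> real \<Rightarrow> real" where
  "bih_rhs v w z = 6 * w\<^sup>2 * z - 4 * w ^ 3 - 8 * (sin v)\<^sup>2 * z - 4 * sin (2 * v) * w\<^sup>2 + 12 * (2 * v - sin (2 * v))"

text \<open>H and J come from the factors D - 1 and D - 3 applied to the same v, hence H - J = 2v;
  this recovers v and its derivatives from the four unknowns.\<close>

definition bih_field :: "real \<times> real \<times> real \<times> real \<Rightarrow> real \<times> real \<times> real \<times> real" where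
  "bih_field = (\<lambda>(H, J, G, E). (3 * H + G, J + G, - 2 * G + E,
     - 4 * E + bih_rhs ((H - J) / 2) ((3 * H - J) / 2) (6 * H - J + G)))"

definition bih_cone :: "(real \<times> real \<times> real \<times> real) set" where
  "bih_cone = {(H, J, G, E). J < H \<and> 0 < J \<and> 0 < G \<and> 0 < E}"

section \<open>Lipschitz bounds for the vector field on balls\<close>

lemma sin_lipschitz: "1-lipschitz_on UNIV (sin :: real \<Rightarrow> real)"
proof (rule lipschitz_onI)
  fix x y :: real
  have "norm (sin x - sin y) \<le> 1 * norm (x - y)"
    by (rule field_differentiable_bound[of UNIV sin cos])
       (auto intro: derivative_eq_intros)
  then show "dist (sin x) (sin y) \<le> 1 * dist x y" by (simp add: dist_norm)
qed simp

lemma lipschitz_on_cball_mult: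
  fixes f g :: "'a::real_normed_vector \<Rightarrow> real"
  assumes "\<exists>L. L-lipschitz_on (cball 0 M) f" "\<exists>L. L-lipschitz_on (cball 0 M) g"
  shows "\<exists>L. L-lipschitz_on (cball 0 M) (\<lambda>x. f x * g x)"
proof -
  obtain L K where L: "L-lipschitz_on (cball 0 M) f" and K: "K-lipschitz_on (cball 0 M) g"
    using assms by blast
  note LK = lipschitz_on_nonneg[OF L] lipschitz_on_nonneg[OF K]
  have b: "\<bar>h x\<bar> \<le> \<bar>h 0\<bar> + C * M" if "C-lipschitz_on (cball 0 M) h" "x \<in> cball 0 M" for h :: "'a \<Rightarrow> real" and C x
  proof -
    have "\<bar>h x - h 0\<bar> \<le> C * norm x"
      using lipschitz_on_normD[OF that(1), of x 0] that(2) norm_ge_zero[of x] by (simp del: norm_ge_zero)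
    also have "\<dots> \<le> C * M" using that lipschitz_on_nonneg[OF that(1)] by (intro mult_left_mono) auto
    finally show ?thesis by linarith
  qed
  \<comment> \<open>The absolute value of M keeps the constant nonnegative also when the ball is
    empty.\<close>
  have "((\<bar>f 0\<bar> + L * \<bar>M\<bar>) * K + L * (\<bar>g 0\<bar> + K * \<bar>M\<bar>))-lipschitz_on (cball 0 M) (\<lambda>x. f x * g x)"
  proof (rule lipschitz_onI)
    fix x y :: 'a assume xy: "x \<in> cball 0 M" "y \<in> cball 0 M"
    then have M: "M \<ge> 0" using norm_ge_zero[of x] by (simp del: norm_ge_zero)
    have "f x * g x - f y * g y = f x * (g x - g y) + (f x - f y) * g y" by (simp add: algebra_simps)
    also have "\<bar>\<dots>\<bar> \<le> \<bar>f x\<bar> * \<bar>g x - g y\<bar> + \<bar>f x - f y\<bar> * \<bar>g y\<bar>"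
      by (metis abs_mult abs_triangle_ineq)
    also have "\<dots> \<le> (\<bar>f 0\<bar> + L * M) * (K * dist x y) + (L * dist x y) * (\<bar>g 0\<bar> + K * M)"
      using b[OF L xy(1)] b[OF K xy(2)] lipschitz_onD[OF L xy] lipschitz_onD[OF K xy] LK M
      by (intro add_mono mult_mono) (auto simp: dist_real_def)
    finally show "dist (f x * g x) (f y * g y) \<le> ((\<bar>f 0\<bar> + L * \<bar>M\<bar>) * K + L * (\<bar>g 0\<bar> + K * \<bar>M\<bar>)) * dist x y"
      using M by (simp add: dist_real_def algebra_simps)
  qed (use LK in auto)
  then show ?thesis by blast
qed

lemma bih_field_lipschitz: "\<exists>L. L-lipschitz_on (cball 0 M) bih_field"
proof -
  have lin: "\<exists>L. L-lipschitz_on (cball 0 M) f" if "bounded_linear f"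
    for f :: "real \<times> real \<times> real \<times> real \<Rightarrow> real"
    by (metis bounded_linear.lipschitz_boundE lipschitz_on_subset subset_UNIV that)
  have add: "\<exists>L. L-lipschitz_on (cball 0 M) (\<lambda>x. f x + g x)"
    if "\<exists>L. L-lipschitz_on (cball 0 M) f" "\<exists>L. L-lipschitz_on (cball 0 M) g"
    for f g :: "real \<times> real \<times> real \<times> real \<Rightarrow> real"
    using that lipschitz_on_add by blast
  have diff: "\<exists>L. L-lipschitz_on (cball 0 M) (\<lambda>x. f x - g x)"
    if "\<exists>L. L-lipschitz_on (cball 0 M) f" "\<exists>L. L-lipschitz_on (cball 0 M) g"
    for f g :: "real \<times> real \<times> real \<times> real \<Rightarrow> real"
    using that lipschitz_on_diff by blast
  have const: "\<exists>L. L-lipschitz_on (cball 0 M) (\<lambda>x::real \<times> real \<times> real \<times> real. c)" for c :: real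
    using lipschitz_on_constant by blast
  have sin: "\<exists>L. L-lipschitz_on (cball 0 M) (\<lambda>x. sin (f x))"
    if "\<exists>L. L-lipschitz_on (cball 0 M) f" for f :: "real \<times> real \<times> real \<times> real \<Rightarrow> real"
    using that lipschitz_on_compose2[OF _ lipschitz_on_subset[OF sin_lipschitz subset_UNIV]] by blast
  have coords: "\<exists>L. L-lipschitz_on (cball 0 M) (\<lambda>x::real \<times> real \<times> real \<times> real. fst x)"
    "\<exists>L. L-lipschitz_on (cball 0 M) (\<lambda>x::real \<times> real \<times> real \<times> real. fst (snd x))"
    "\<exists>L. L-lipschitz_on (cball 0 M) (\<lambda>x::real \<times> real \<times> real \<times> real. fst (snd (snd x)))"
    "\<exists>L. L-lipschitz_on (cball 0 M) (\<lambda>x::real \<times> real \<times> real \<times> real. snd (snd (snd x)))"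
    by (intro lin bounded_linear_intros)+
  have pair: "\<exists>L. L-lipschitz_on (cball 0 M) (\<lambda>x. (f x, g x))"
    if "\<exists>L. L-lipschitz_on (cball 0 M) f" "\<exists>L. L-lipschitz_on (cball 0 M) g"
    for f :: "real \<times> real \<times> real \<times> real \<Rightarrow> 'x::real_normed_vector"
      and g :: "real \<times> real \<times> real \<times> real \<Rightarrow> 'y::real_normed_vector"
    using that lipschitz_on_Pair by blast
  have half: "\<exists>L. L-lipschitz_on (cball 0 M) (\<lambda>x. f x / 2)"
    if "\<exists>L. L-lipschitz_on (cball 0 M) f" for f :: "real \<times> real \<times> real \<times> real \<Rightarrow> real"
    using lipschitz_on_cball_mult[OF that const[of "1 / 2"]] by simp
  show ?thesis
    unfolding bih_field_def bih_rhs_def case_prod_unfold power2_eq_square power3_eq_cube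
    by (intro pair add diff half lipschitz_on_cball_mult const sin coords)
qed

text \<open>A linear combination of fixed products, so that linear arithmetic can treat these
  products as atoms.\<close>

lemma bih_rhs_expand:
  "bih_rhs v w z = 6 * (w\<^sup>2 * z) - 4 * w ^ 3 - 8 * ((sin v)\<^sup>2 * z) - 4 * (sin (2 * v) * w\<^sup>2)
    + 24 * v - 12 * sin (2 * v)"
  by (simp add: bih_rhs_def algebra_simps)

text \<open>From 6 w^2 z one loses 4/3 to 4 w^3 (since 3w <= z), 2 to the term with (sin v)^2 (since
  |sin v| <= w/2) and 4/3 to the term with sin (2v) w^2; the last term is nonnegative. What remains
  is 4/3.\<close>

lemma bih_rhs_lower:
  assumes "0 < v" "2 * v \<le> w" "3 * w \<le> z"
  shows "4 / 3 * (w\<^sup>2 * z) \<le> bih_rhs v w z"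
proof -
  have "\<bar>sin v\<bar> \<le> \<bar>w / 2\<bar>" using abs_sin_x_le_abs_x[of v] assms by linarith
  then have "(sin v)\<^sup>2 \<le> (w / 2)\<^sup>2" by (rule abs_le_square_iff[THEN iffD1])
  then have "(sin v)\<^sup>2 * z \<le> (w / 2)\<^sup>2 * z" using assms by (intro mult_right_mono) auto
  then have 1: "(sin v)\<^sup>2 * z \<le> w\<^sup>2 * z / 4" by (simp add: power_divide)
  have 2: "w ^ 3 \<le> w\<^sup>2 * z / 3"
    using mult_left_mono[OF assms(3), of "w\<^sup>2"] by (simp add: power2_eq_square power3_eq_cube algebra_simps)
  have s: "sin (2 * v) \<le> 2 * v" using assms by (intro sin_x_le_x) auto
  then have "sin (2 * v) * w\<^sup>2 \<le> w * w\<^sup>2" using assms by (intro mult_right_mono) auto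
  then have 3: "sin (2 * v) * w\<^sup>2 \<le> w ^ 3" by (simp add: power2_eq_square power3_eq_cube)
  show ?thesis unfolding bih_rhs_expand using 1 2 3 s by argo
qed

text \<open>-4 w^3 compensates the term with sin (2v) w^2, and 24 v - 12 sin (2v) <= 48 v <= 24
  w.\<close>

lemma bih_rhs_upper:
  assumes "0 < v" "2 * v \<le> w" "0 \<le> z"
  shows "bih_rhs v w z \<le> 6 * (w\<^sup>2 * z) + 24 * w"
proof -
  have s: "- sin (2 * v) \<le> 2 * v" using abs_sin_x_le_abs_x[of "2 * v"] assms by linarith
  then have "- sin (2 * v) * w\<^sup>2 \<le> w * w\<^sup>2" using assms by (intro mult_right_mono) auto
  then have 1: "- (sin (2 * v) * w\<^sup>2) \<le> w ^ 3" by (simp add: power2_eq_square power3_eq_cube)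
  have 2: "0 \<le> (sin v)\<^sup>2 * z" using assms by simp
  show ?thesis unfolding bih_rhs_expand using 1 2 s assms by argo
qed

text \<open>The comparison principle behind every estimate below, for inequalities f' + a f >= 0
  with A a primitive of a. Derivatives are taken within the half-line because solutions start at
  time 0.\<close>

lemma integrating_factor_mono:
  fixes f A :: "real \<Rightarrow> real"
  assumes "0 \<le> t" and f: "\<And>s. s \<in> {0..t} \<Longrightarrow> (f has_real_derivative f' s) (at s within {0..})"
    and A: "\<And>s. s \<in> {0..t} \<Longrightarrow> (A has_real_derivative a s) (at s within {0..})"
    and nonneg: "\<And>s. 0 < s \<Longrightarrow> s < t \<Longrightarrow> 0 \<le> f' s + a s * f s"
  shows "f 0 * exp (A 0) \<le> f t * exp (A t)"
proof -
  have d: "((\<lambda>s. f s * exp (A s)) has_real_derivative (f' s + a s * f s) * exp (A s)) (at s within {0..})"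
    if "s \<in> {0..t}" for s
    by (rule DERIV_cong, rule DERIV_mult[OF f[OF that] DERIV_chain2[OF DERIV_exp A[OF that]]])
       (simp add: algebra_simps)
  show ?thesis
  proof (rule DERIV_nonneg_imp_increasing_open[of 0 t "\<lambda>s. f s * exp (A s)"])
    show "continuous_on {0..t} (\<lambda>s. f s * exp (A s))"
      by (rule DERIV_continuous_on[where D = "\<lambda>s. (f' s + a s * f s) * exp (A s)"])
         (rule has_field_derivative_subset[OF d], auto)
    fix s assume s: "0 < s" "s < t"
    then have "at s within {0..} = at s" by (intro at_within_interior) auto
    then show "\<exists>D. ((\<lambda>s. f s * exp (A s)) has_real_derivative D) (at s) \<and> 0 \<le> D"
      using d[of s] s nonneg[OF s] by (intro exI[of _ "(f' s + a s * f s) * exp (A s)"]) simp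
  qed (fact assms(1))
qed

text \<open>While E >= 0, the linear equations for G, J and H - J, with sources E, G and 2 J, keep
  these positive one after the other. Before a first zero of E this makes the nonlinearity
  nonnegative, so exp (4 t) E does not decrease from its positive initial value and cannot reach
  0.\<close>

lemma bih_cone_invariant:
  fixes H J G E :: "real \<Rightarrow> real"
  assumes H: "\<And>t. t \<in> {0..b} \<Longrightarrow> (H has_real_derivative 3 * H t + G t) (at t within {0..})"
    and J: "\<And>t. t \<in> {0..b} \<Longrightarrow> (J has_real_derivative J t + G t) (at t within {0..})"
    and G: "\<And>t. t \<in> {0..b} \<Longrightarrow> (G has_real_derivative - 2 * G t + E t) (at t within {0..})"
    and E: "\<And>t. t \<in> {0..b} \<Longrightarrow> (E has_real_derivative - 4 * E t +
        bih_rhs ((H t - J t) / 2) ((3 * H t - J t) / 2) (6 * H t - J t + G t)) (at t within {0..})"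
    and 0: "J 0 < H 0" "0 < J 0" "0 < G 0" "0 < E 0"
    and t: "t \<in> {0..b}"
  shows "J t < H t \<and> 0 < J t \<and> 0 < G t \<and> 0 < E t"
proof -
  have *: "J \<tau> < H \<tau> \<and> 0 < J \<tau> \<and> 0 < G \<tau>" if pos: "\<And>s. 0 < s \<Longrightarrow> s < \<tau> \<Longrightarrow> 0 \<le> E s" and \<tau>: "\<tau> \<in> {0..b}" for \<tau>
  proof -
    have exp_pos: "0 < y" if "0 < x" "x * exp p \<le> y * exp q" for x y p q :: real
      using that by (metis exp_gt_zero less_le_trans mult_pos_pos zero_less_mult_pos2)
    have A: "((\<lambda>s. c * s) has_real_derivative c) (at s within {0..})" for c s :: real
      by (auto intro!: derivative_eq_intros)
    have G1: "0 < G s" if "s \<in> {0..\<tau>}" for s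
      by (rule exp_pos[OF 0(3) integrating_factor_mono[OF _ G A[of 2]]]) (use pos \<tau> that in auto)
    have J1: "0 < J s" if "s \<in> {0..\<tau>}" for s
      by (rule exp_pos[OF 0(2) integrating_factor_mono[OF _ J A[of "-1"]]])
         (use G1 \<tau> that in \<open>auto simp: less_imp_le\<close>)
    have HJ: "((\<lambda>s. H s - J s) has_real_derivative 3 * H t - J t) (at t within {0..})" if "t \<in> {0..b}" for t
      by (rule DERIV_cong[OF DERIV_diff[OF H[OF that] J[OF that]]]) simp
    have "0 < H s - J s" if "s \<in> {0..\<tau>}" for s
      by (rule exp_pos[OF _ integrating_factor_mono[OF _ HJ A[of "-3"]]])
         (use J1 \<tau> that 0 in \<open>auto simp: less_imp_le\<close>)
    then show ?thesis using G1[of \<tau>] J1[of \<tau>] \<tau> by fastforce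
  qed
  have Epos: "0 < E s" if "s \<in> {0..b}" for s
  proof (rule ccontr)
    assume "\<not> 0 < E s"
    define S where "S = {0..b} \<inter> E -` {..0}"
    have "continuous_on {0..b} E"
      by (rule DERIV_continuous_on, rule has_field_derivative_subset[OF E]) auto
    then have "closed S" unfolding S_def by (intro continuous_closed_preimage) auto
    moreover have "bounded S" by (rule bounded_subset[of "{0..b}"]) (auto simp: S_def)
    ultimately have "compact S" by (simp add: compact_eq_bounded_closed)
    have "E s \<le> 0" using \<open>\<not> 0 < E s\<close> by linarith
    then have "s \<in> S" unfolding S_def using that by (intro IntI vimageI2) simp_all
    then have Sne: "S \<noteq> {}" by blast
    obtain \<tau> where \<tau>: "\<tau> \<in> S" "\<And>r. r \<in> S \<Longrightarrow> \<tau> \<le> r" using compact_attains_inf[OF \<open>compact S\<close> Sne] by blast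
    have \<tau>b: "\<tau> \<in> {0..b}" using \<tau>(1) by (simp add: S_def)
    have pos: "0 < E r" if "0 \<le> r" "r < \<tau>" for r
    proof (rule ccontr)
      assume "\<not> 0 < E r"
      then have "r \<in> S" using that \<tau>b by (simp add: S_def)
      then show False using \<tau>(2)[of r] that by simp
    qed
    have "E 0 * exp (4 * 0) \<le> E \<tau> * exp (4 * \<tau>)"
    proof (rule integrating_factor_mono[OF _ E])
      fix r assume r: "0 < r" "r < \<tau>"
      have "J r < H r \<and> 0 < J r \<and> 0 < G r" using r \<tau>b by (intro *) (auto intro!: less_imp_le pos)
      then have "4 / 3 * (((3 * H r - J r) / 2)\<^sup>2 * (6 * H r - J r + G r)) \<le>
         bih_rhs ((H r - J r) / 2) ((3 * H r - J r) / 2) (6 * H r - J r + G r)"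
        by (intro bih_rhs_lower) auto
      moreover have "0 \<le> 4 / 3 * (((3 * H r - J r) / 2)\<^sup>2 * (6 * H r - J r + G r))"
        using \<open>J r < H r \<and> 0 < J r \<and> 0 < G r\<close> by auto
      ultimately show "0 \<le> - 4 * E r + bih_rhs ((H r - J r) / 2) ((3 * H r - J r) / 2) (6 * H r - J r + G r) + 4 * E r"
        by linarith
    qed (use \<tau>b in \<open>auto intro!: derivative_eq_intros\<close>)
    then have "0 < E \<tau> * exp (4 * \<tau>)" using 0(4) by simp
    then show False using \<tau>(1) by (simp add: S_def zero_less_mult_iff)
  qed
  have "J t < H t \<and> 0 < J t \<and> 0 < G t" using t by (intro *) (auto intro!: less_imp_le Epos)
  then show ?thesis using Epos[OF t] by blast
qed

section \<open>A priori bounds and blow-up\<close>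

text \<open>All constants are built from the initial values alone and thus serve every interval of
  existence. A lower bound E >= c w^3 makes w blow up and limits the life span; an upper bound E <=
  K w^3 leads to w' <= M w^2, so that w grows at most exponentially in v. \<open>\<Phi>\<close>
  collects the resulting bound, and its monotonicity later turns large states into large v.\<close>

lemma bih_estimates:
  fixes H0 J0 G0 E0 :: real
  assumes 0: "J0 < H0" "0 < J0" "0 < G0" "0 < E0"
  obtains B \<Phi> where "mono \<Phi>"
    "\<And>b H J G E.
      (\<And>t. t \<in> {0..b} \<Longrightarrow> (H has_real_derivative 3 * H t + G t) (at t within {0..})) \<Longrightarrow>
      (\<And>t. t \<in> {0..b} \<Longrightarrow> (J has_real_derivative J t + G t) (at t within {0..})) \<Longrightarrow>
      (\<And>t. t \<in> {0..b} \<Longrightarrow> (G has_real_derivative - 2 * G t + E t) (at t within {0..})) \<Longrightarrow>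
      (\<And>t. t \<in> {0..b} \<Longrightarrow> (E has_real_derivative - 4 * E t +
        bih_rhs ((H t - J t) / 2) ((3 * H t - J t) / 2) (6 * H t - J t + G t)) (at t within {0..})) \<Longrightarrow>
      H 0 = H0 \<Longrightarrow> J 0 = J0 \<Longrightarrow> G 0 = G0 \<Longrightarrow> E 0 = E0 \<Longrightarrow> 0 \<le> b \<Longrightarrow>
      b \<le> B \<and> norm (H b, J b, G b, E b) \<le> \<Phi> ((H b - J b) / 2)"
proof -
  define w0 where "w0 = (3 * H0 - J0) / 2"
  define v0 where "v0 = (H0 - J0) / 2"
  define d0 where "d0 = (9 * H0 - J0) / 2 + G0"
  have w0: "w0 > 0" and d0: "d0 > 0" using 0 unfolding w0_def d0_def by argo+
  \<comment> \<open>1/3 makes 3c <= 1 and 4c <= 4/3, both within the constant 4/3 of the lower bound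
    for N. The other entries make E >= c w^3 and w'^2 >= (c/2) w^4 true at time 0.\<close>
  define c where "c = min (1 / 3) (min (E0 / w0 ^ 3) (2 * d0\<^sup>2 / w0 ^ 4))"
  have c: "0 < c" "c \<le> 1 / 3" "c * w0 ^ 3 \<le> E0" "c / 2 * w0 ^ 4 \<le> d0\<^sup>2"
  proof -
    show "0 < c" using 0 w0 d0 by (simp add: c_def)
    show "c \<le> 1 / 3" unfolding c_def by (rule min.cobounded1)
    have "c \<le> E0 / w0 ^ 3" "c \<le> 2 * d0\<^sup>2 / w0 ^ 4" by (auto simp: c_def)
    then show "c * w0 ^ 3 \<le> E0" "c / 2 * w0 ^ 4 \<le> d0\<^sup>2" using w0 by (auto simp: field_simps)
  qed
  define k where "k = sqrt (c / 2)"
  have k: "k > 0" "k\<^sup>2 = c / 2" using c by (auto simp: k_def)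
  \<comment> \<open>2 absorbs 6 w^2 w' into 3 K w^2 w'; 6/w0^2 makes 4K - 6 large enough to absorb
    24 w, as w >= w0; the last summand covers the initial value of E.\<close>
  define K where "K = 2 + 6 / w0\<^sup>2 + E0 / w0 ^ 3"
  have K: "24 \<le> (4 * K - 6) * w0\<^sup>2" "2 \<le> K" "E0 \<le> K * w0 ^ 3"
  proof -
    have "0 \<le> 6 / w0\<^sup>2" "0 \<le> E0 / w0 ^ 3" using 0 w0 by auto
    then show "2 \<le> K" unfolding K_def by linarith
    have "24 = (24 / w0\<^sup>2) * w0\<^sup>2" using w0 by simp
    also have "\<dots> \<le> (4 * K - 6) * w0\<^sup>2"
      using \<open>0 \<le> E0 / w0 ^ 3\<close> by (intro mult_right_mono) (auto simp: K_def)
    finally show "24 \<le> (4 * K - 6) * w0\<^sup>2" .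
    have "E0 = (E0 / w0 ^ 3) * w0 ^ 3" using w0 by simp
    also have "\<dots> \<le> K * w0 ^ 3" using \<open>0 \<le> 6 / w0\<^sup>2\<close> w0 by (intro mult_right_mono) (auto simp: K_def)
    finally show "E0 \<le> K * w0 ^ 3" .
  qed
  \<comment> \<open>1 gives M <= M^2; the other summands give 2 w' <= M w w', then K w^3 + 5 w <=
    M^2 w^3, and w' <= M w^2 at time 0.\<close>
  define M where "M = 1 + 2 / w0 + (K + 5 / w0\<^sup>2) + d0 / w0\<^sup>2"
  have M: "2 \<le> M * w0" "(K + 5 / w0\<^sup>2) \<le> M\<^sup>2" "d0 \<le> M * w0\<^sup>2" "0 < M"
  proof -
    have p: "0 < 2 / w0" "0 < K + 5 / w0\<^sup>2" "0 < d0 / w0\<^sup>2" using w0 d0 K(2) by (auto intro!: add_pos_pos)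
    have M1: "1 \<le> M" "K + 5 / w0\<^sup>2 \<le> M" using p unfolding M_def by linarith+
    then show "0 < M" by simp
    have "M * 1 \<le> M * M" using M1 by (intro mult_left_mono) auto
    then show "K + 5 / w0\<^sup>2 \<le> M\<^sup>2" using M1(2) unfolding power2_eq_square by linarith
    have "2 = (2 / w0) * w0" using w0 by simp
    also have "\<dots> \<le> M * w0" using p w0 by (intro mult_right_mono) (auto simp: M_def)
    finally show "2 \<le> M * w0" .
    have "d0 = (d0 / w0\<^sup>2) * w0\<^sup>2" using w0 by simp
    also have "\<dots> \<le> M * w0\<^sup>2" using p w0 by (intro mult_right_mono) (auto simp: M_def)
    finally show "d0 \<le> M * w0\<^sup>2" .
  qed
  define W where "W v = w0 * exp (M * (v - v0))" for v
  define \<Phi> where "\<Phi> v = 2 * W v + M * (W v)\<^sup>2 + K * W v ^ 3" for v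
  have W0: "0 \<le> W v" for v using w0 by (simp add: W_def)
  have "W x \<le> W y" if "x \<le> y" for x y
    unfolding W_def using w0 M(4) that by (intro mult_left_mono) auto
  then have mono: "mono \<Phi>"
    unfolding \<Phi>_def using W0 M(4) K(2) by (intro monoI add_mono mult_left_mono power_mono) auto
  show thesis
  proof (rule that[OF mono, of "1 / (k * w0)"])
    fix b :: real and H J G E :: "real \<Rightarrow> real"
    assume dH: "\<And>t. t \<in> {0..b} \<Longrightarrow> (H has_real_derivative 3 * H t + G t) (at t within {0..})"
      and dJ: "\<And>t. t \<in> {0..b} \<Longrightarrow> (J has_real_derivative J t + G t) (at t within {0..})"
      and dG: "\<And>t. t \<in> {0..b} \<Longrightarrow> (G has_real_derivative - 2 * G t + E t) (at t within {0..})"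
      and dE: "\<And>t. t \<in> {0..b} \<Longrightarrow> (E has_real_derivative - 4 * E t +
        bih_rhs ((H t - J t) / 2) ((3 * H t - J t) / 2) (6 * H t - J t + G t)) (at t within {0..})"
      and init: "H 0 = H0" "J 0 = J0" "G 0 = G0" "E 0 = E0" and b: "0 \<le> b"
    define v where "v t = (H t - J t) / 2" for t
    define w where "w t = (3 * H t - J t) / 2" for t
    define w1 where "w1 t = (9 * H t - J t) / 2 + G t" for t
    \<comment> \<open>This is w'' written with E, w', w, v: in the cone 5w > 6v, so that w'' >= E
      and w'' <= E + 2w' + 5w.\<close>
    define w2 where "w2 t = E t + 2 * w1 t + 5 * w t - 6 * v t" for t
    define N where "N t = bih_rhs (v t) (w t) (w1 t + w t)" for t
    have cone: "J t < H t" "0 < J t" "0 < G t" "0 < E t" if "t \<in> {0..b}" for t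
      using bih_cone_invariant[of b H G J E t, OF dH dJ dG dE _ _ _ _ that] init 0 by auto
    have dv: "(v has_real_derivative w t) (at t within {0..})" if "t \<in> {0..b}" for t
      unfolding v_def w_def
      by (rule DERIV_cong[OF DERIV_cdivide[OF DERIV_diff[OF dH[OF that] dJ[OF that]]]]) (simp add: field_simps)
    have dw: "(w has_real_derivative w1 t) (at t within {0..})" if "t \<in> {0..b}" for t
      unfolding w_def w1_def
      by (rule DERIV_cong[OF DERIV_cdivide[OF DERIV_diff[OF DERIV_cmult[OF dH[OF that]] dJ[OF that]]]]) (simp add: field_simps)
    have dw1: "(w1 has_real_derivative w2 t) (at t within {0..})" if "t \<in> {0..b}" for t
      unfolding w1_def[abs_def] w2_def w_def v_def
      by (rule DERIV_cong[OF DERIV_add[OF DERIV_cdivide[OF DERIV_diff[OF DERIV_cmult[OF dH[OF that]] dJ[OF that]]] dG[OF that]]])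
         (simp add: field_simps)
    have dE': "(E has_real_derivative - 4 * E t + N t) (at t within {0..})" if "t \<in> {0..b}" for t
    proof -
      have "w1 t + w t = 6 * H t - J t + G t" by (simp add: w1_def w_def field_simps)
      then show ?thesis using dE[OF that] by (simp add: N_def v_def w_def)
    qed
    have pos: "0 < v t" "2 * v t < w t" "2 * w t < w1 t" "0 < w t" "0 < w1 t" if "t \<in> {0..b}" for t
      using cone[OF that] unfolding v_def w_def w1_def by argo+
    have init': "v 0 = v0" "w 0 = w0" "w1 0 = d0"
      by (simp_all add: v_def w_def w1_def v0_def w0_def d0_def init)
    have dpow: "((\<lambda>t. w t ^ n) has_real_derivative real n * w t ^ (n - 1) * w1 t) (at t within {0..})"
      if "t \<in> {0..b}" for t n
      using DERIV_power[OF dw[OF that], of n] by (simp add: mult_ac)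
    have one: "((\<lambda>t. a * t) has_real_derivative a) (at t within {0..})" for a t :: real
      by (auto intro!: derivative_eq_intros)
    have wge: "w0 \<le> w t" if "t \<in> {0..b}" for t
      using integrating_factor_mono[of t w w1 "\<lambda>t. 0 * t" "\<lambda>t. 0"] that dw one[of 0] pos(5) init'
      by (fastforce intro: less_imp_le)
    have N_low: "4 / 3 * ((w t)\<^sup>2 * w1 t + w t ^ 3) \<le> N t" if "t \<in> {0..b}" for t
      using bih_rhs_lower[of "v t" "w t" "w1 t + w t"] pos[OF that]
      by (simp add: N_def algebra_simps power2_eq_square power3_eq_cube)
    have N_up: "N t \<le> 6 * ((w t)\<^sup>2 * w1 t) + 6 * w t ^ 3 + 24 * w t" if "t \<in> {0..b}" for t
      using bih_rhs_upper[of "v t" "w t" "w1 t + w t"] pos[OF that]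
      by (simp add: N_def algebra_simps power2_eq_square power3_eq_cube)
    have E_low: "c * w t ^ 3 \<le> E t" if "t \<in> {0..b}" for t
    proof -
      have "(E 0 - c * w 0 ^ 3) * exp (4 * 0) \<le> (E t - c * w t ^ 3) * exp (4 * t)"
      proof (rule integrating_factor_mono[OF _ DERIV_diff[OF dE' DERIV_cmult[OF dpow]] one])
        fix s assume "0 < s" "s < t"
        then have s: "s \<in> {0..b}" using that by auto
        have "c * (w s ^ 3) \<le> 1 / 3 * (w s ^ 3)" "c * ((w s)\<^sup>2 * w1 s) \<le> 1 / 3 * ((w s)\<^sup>2 * w1 s)"
          using c pos[OF s] by (intro mult_right_mono; simp)+
        moreover have "0 \<le> (w s)\<^sup>2 * w1 s" using pos[OF s] by simp
        ultimately have "0 \<le> N s - 3 * (c * ((w s)\<^sup>2 * w1 s)) - 4 * (c * (w s ^ 3))"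
          using N_low[OF s] by argo
        then show "0 \<le> - 4 * E s + N s - c * (real 3 * w s ^ (3 - 1) * w1 s) + 4 * (E s - c * w s ^ 3)"
          by (simp add: algebra_simps)
      qed (use that in auto)
      moreover have "0 \<le> E 0 - c * w 0 ^ 3" using c(3) init init' by simp
      ultimately have "0 \<le> (E t - c * w t ^ 3) * exp (4 * t)" by simp
      then show ?thesis by (simp add: zero_le_mult_iff)
    qed
    have w2_low: "c * w t ^ 3 \<le> w2 t" if "t \<in> {0..b}" for t
      using E_low[OF that] pos[OF that] unfolding w2_def by linarith
    have w1_low: "k * (w t)\<^sup>2 \<le> w1 t" if "t \<in> {0..b}" for t
    proof -
      \<comment> \<open>Energy inequality: w'' >= c w^3 multiplied by 2 w' > 0. With exponent 0 the
        comparison lemma reduces to monotonicity.\<close>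
      have "((w1 0)\<^sup>2 - c / 2 * w 0 ^ 4) * exp (0 * 0) \<le> ((w1 t)\<^sup>2 - c / 2 * w t ^ 4) * exp (0 * t)"
      proof (rule integrating_factor_mono[OF _ DERIV_diff[OF DERIV_power[OF dw1] DERIV_cmult[OF dpow]] one])
        fix s assume "0 < s" "s < t"
        then have s: "s \<in> {0..b}" using that by auto
        have "w1 s * (c * w s ^ 3) \<le> w1 s * w2 s"
          using w2_low[OF s] pos[OF s] by (intro mult_left_mono) auto
        then show "0 \<le> real 2 * (w2 s * w1 s ^ (2 - Suc 0)) - c / 2 * (real 4 * w s ^ (4 - 1) * w1 s) + 0 * ((w1 s)\<^sup>2 - c / 2 * w s ^ 4)"
          by (simp add: algebra_simps)
      qed (use that in auto)
      then have "c / 2 * w t ^ 4 \<le> (w1 t)\<^sup>2" using c(4) unfolding init' by simp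
      moreover have "(k * (w t)\<^sup>2)\<^sup>2 = c / 2 * w t ^ 4"
        by (simp add: power_mult_distrib k(2) flip: power_mult)
      ultimately have "(k * (w t)\<^sup>2)\<^sup>2 \<le> (w1 t)\<^sup>2" by linarith
      then show ?thesis by (rule power2_le_imp_le) (use pos[OF that] in simp)
    qed
    \<comment> \<open>Riccati inequality: w' >= k w^2 makes -1/w - k t nondecreasing, and 1/w stays
      positive, so k b <= 1/w0.\<close>
    have "(- inverse (w 0) - k * 0) * exp (0 * 0) \<le> (- inverse (w b) - k * b) * exp (0 * b)"
    proof (rule integrating_factor_mono[OF b DERIV_diff[OF DERIV_minus[OF DERIV_inverse'[OF dw]] one] one])
      fix s assume "0 < s" "s < b"
      then have s: "s \<in> {0..b}" by auto
      have "k \<le> w1 s / (w s)\<^sup>2" using w1_low[OF s] pos[OF s] by (simp add: field_simps)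
      then show "0 \<le> - (- (inverse (w s) * w1 s * inverse (w s))) - k + 0 * (- inverse (w s) - k * s)"
        by (simp add: field_simps power2_eq_square)
    next
      fix s assume "s \<in> {0..b}"
      then show "w s \<noteq> 0" using pos[of s] by auto
    qed auto
    then have "- inverse w0 \<le> - inverse (w b) - k * b" using init' by simp
    moreover have "0 < inverse (w b)" using pos[of b] b by simp
    ultimately have "k * b \<le> inverse w0" by linarith
    then have bB: "b \<le> 1 / (k * w0)" using k w0 by (simp add: field_simps)
    have K3: "K * w t ^ 3 \<ge> E t" if "t \<in> {0..b}" for t
    proof -
      have "(K * w 0 ^ 3 - E 0) * exp (4 * 0) \<le> (K * w t ^ 3 - E t) * exp (4 * t)"
      proof (rule integrating_factor_mono[OF _ DERIV_diff[OF DERIV_cmult[OF dpow] dE'] one])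
        fix s assume "0 < s" "s < t"
        then have s: "s \<in> {0..b}" using that by auto
        have "(4 * K - 6) * w0\<^sup>2 \<le> (4 * K - 6) * (w s)\<^sup>2"
          using wge[OF s] w0 K(2) by (intro mult_left_mono power_mono) auto
        then have "24 \<le> (4 * K - 6) * (w s)\<^sup>2" using K(1) by linarith
        then have "24 * w s \<le> (4 * K - 6) * (w s)\<^sup>2 * w s"
          using pos[OF s] by (intro mult_right_mono) auto
        then have 1: "24 * w s \<le> 4 * (K * w s ^ 3) - 6 * w s ^ 3"
          by (simp add: algebra_simps power2_eq_square power3_eq_cube)
        have "2 * ((w s)\<^sup>2 * w1 s) \<le> K * ((w s)\<^sup>2 * w1 s)"
          using K(2) pos[OF s] by (intro mult_right_mono) auto
        then have "0 \<le> 3 * (K * ((w s)\<^sup>2 * w1 s)) + 4 * (K * w s ^ 3) - N s"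
          using N_up[OF s] 1 by linarith
        then show "0 \<le> K * (real 3 * w s ^ (3 - 1) * w1 s) - (- 4 * E s + N s) + 4 * (K * w s ^ 3 - E s)"
          by (simp add: algebra_simps)
      qed (use that in auto)
      moreover have "0 \<le> K * w 0 ^ 3 - E 0" using K(3) init init' by simp
      ultimately have "0 \<le> (K * w t ^ 3 - E t) * exp (4 * t)" by simp
      then show ?thesis by (simp add: zero_le_mult_iff)
    qed
    have w1_up: "w1 t \<le> M * (w t)\<^sup>2" if "t \<in> {0..b}" for t
    proof -
      \<comment> \<open>exp (M v) has logarithmic derivative M w; what has to be nonnegative is M w
        w' + M^2 w^3 - w''.\<close>
      have "(M * (w 0)\<^sup>2 - w1 0) * exp (M * v 0) \<le> (M * (w t)\<^sup>2 - w1 t) * exp (M * v t)"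
      proof (rule integrating_factor_mono[OF _ DERIV_diff[OF DERIV_cmult[OF dpow] dw1] DERIV_cmult[OF dv]])
        fix s assume "0 < s" "s < t"
        then have s: "s \<in> {0..b}" using that by auto
        have "w0\<^sup>2 * (5 / w0\<^sup>2 * w s) \<le> (w s)\<^sup>2 * (5 / w0\<^sup>2 * w s)"
          using power_mono[OF wge[OF s], of 2] pos[OF s] w0 by (intro mult_right_mono) auto
        then have 1: "5 * w s \<le> 5 / w0\<^sup>2 * w s ^ 3"
          using w0 by (simp add: power2_eq_square power3_eq_cube mult_ac)
        have "(K + 5 / w0\<^sup>2) * w s ^ 3 \<le> M\<^sup>2 * w s ^ 3"
          using M(2) pos[OF s] by (intro mult_right_mono) auto
        then have 2: "K * w s ^ 3 + 5 / w0\<^sup>2 * w s ^ 3 \<le> M\<^sup>2 * w s ^ 3" by (simp add: distrib_right)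
        have "2 \<le> M * w s" using M(1,4) wge[OF s] mult_left_mono[of w0 "w s" M] by linarith
        then have 3: "2 * w1 s \<le> M * w s * w1 s" using pos[OF s] by (intro mult_right_mono) auto
        have "w2 s \<le> M\<^sup>2 * w s ^ 3 + M * w s * w1 s"
          using 1 2 3 K3[OF s] pos[OF s] unfolding w2_def by linarith
        then show "0 \<le> M * (real 2 * w s ^ (2 - 1) * w1 s) - w2 s + M * w s * (M * (w s)\<^sup>2 - w1 s)"
          by (simp add: algebra_simps power2_eq_square power3_eq_cube)
      qed (use that in auto)
      moreover have "0 \<le> (M * (w 0)\<^sup>2 - w1 0) * exp (M * v 0)" using M(3) init' by simp
      ultimately have "0 \<le> (M * (w t)\<^sup>2 - w1 t) * exp (M * v t)" by linarith
      then show ?thesis by (simp add: zero_le_mult_iff)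
    qed
    \<comment> \<open>w' <= M w v' makes w exp (-M v) nonincreasing; the sign is reversed to fit the
      comparison lemma.\<close>
    have "- w 0 * exp (- M * v 0) \<le> - w b * exp (- M * v b)"
    proof (rule integrating_factor_mono[OF b DERIV_minus[OF dw] DERIV_cmult[OF dv]])
      fix s assume "0 < s" "s < b"
      then show "0 \<le> - w1 s + - M * w s * - w s"
        using w1_up[of s] by (simp add: power2_eq_square mult_ac)
    qed auto
    then have "w b * (exp (- M * v b) * exp (M * v b)) \<le> w0 * exp (- M * v0) * exp (M * v b)"
      using init' mult_right_mono[of "w b * exp (- M * v b)" "w0 * exp (- M * v0)" "exp (M * v b)"] by simp
    then have wW: "w b \<le> W (v b)"
      by (simp add: W_def algebra_simps flip: exp_add)
    have bb: "b \<in> {0..b}" using b by simp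
    have "norm (H b, J b, G b, E b) \<le> \<bar>H b\<bar> + (\<bar>J b\<bar> + (\<bar>G b\<bar> + \<bar>E b\<bar>))"
      using norm_Pair_le[of "H b" "(J b, G b, E b)"] norm_Pair_le[of "J b" "(G b, E b)"] norm_Pair_le[of "G b" "E b"]
      by simp
    also have "\<dots> \<le> 2 * w b + M * (w b)\<^sup>2 + K * w b ^ 3"
    proof -
      have "\<bar>H b\<bar> \<le> w b" "\<bar>J b\<bar> \<le> w b" "\<bar>G b\<bar> \<le> w1 b"
        using cone[OF bb] unfolding w_def w1_def by argo+
      moreover have "\<bar>E b\<bar> = E b" using cone(4)[OF bb] by simp
      ultimately show ?thesis using K3[OF bb] w1_up[OF bb] by linarith
    qed
    also have "\<dots> \<le> \<Phi> (v b)"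
      unfolding \<Phi>_def using wW pos[OF bb] M(4) K(2)
      by (intro add_mono mult_left_mono power_mono) auto
    finally show "b \<le> 1 / (k * w0) \<and> norm (H b, J b, G b, E b) \<le> \<Phi> ((H b - J b) / 2)"
      using bB by (simp add: v_def)
  qed
qed

text \<open>A global solution would outlive the bound B, so the norm is unbounded before some finite
  T. A state of norm above \<open>\<Phi> Z\<close> forces v > Z, and since v increases, one such
  time for each Z yields the limit.\<close>

lemma bih_blowup:
  fixes H0 J0 G0 E0 :: real
  assumes 0: "J0 < H0" "0 < J0" "0 < G0" "0 < E0"
  obtains T H J G E where "0 < T" "H 0 = H0" "J 0 = J0" "G 0 = G0" "E 0 = E0"
    "\<And>t. t \<in> {0..<T} \<Longrightarrow> (H has_real_derivative 3 * H t + G t) (at t within {0..})"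
    "\<And>t. t \<in> {0..<T} \<Longrightarrow> (J has_real_derivative J t + G t) (at t within {0..})"
    "\<And>t. t \<in> {0..<T} \<Longrightarrow> (G has_real_derivative - 2 * G t + E t) (at t within {0..})"
    "\<And>t. t \<in> {0..<T} \<Longrightarrow> (E has_real_derivative - 4 * E t +
        bih_rhs ((H t - J t) / 2) ((3 * H t - J t) / 2) (6 * H t - J t + G t)) (at t within {0..})"
    "filterlim (\<lambda>t. (H t - J t) / 2) at_top (at_left T)"
proof -
  obtain B \<Phi> where \<Phi>: "mono \<Phi>" and est: "\<And>b H J G E.
      (\<And>t. t \<in> {0..b} \<Longrightarrow> (H has_real_derivative 3 * H t + G t) (at t within {0..})) \<Longrightarrow>
      (\<And>t. t \<in> {0..b} \<Longrightarrow> (J has_real_derivative J t + G t) (at t within {0..})) \<Longrightarrow>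
      (\<And>t. t \<in> {0..b} \<Longrightarrow> (G has_real_derivative - 2 * G t + E t) (at t within {0..})) \<Longrightarrow>
      (\<And>t. t \<in> {0..b} \<Longrightarrow> (E has_real_derivative - 4 * E t +
        bih_rhs ((H t - J t) / 2) ((3 * H t - J t) / 2) (6 * H t - J t + G t)) (at t within {0..})) \<Longrightarrow>
      H 0 = H0 \<Longrightarrow> J 0 = J0 \<Longrightarrow> G 0 = G0 \<Longrightarrow> E 0 = E0 \<Longrightarrow> 0 \<le> b \<Longrightarrow>
      b \<le> B \<and> norm (H b, J b, G b, E b) \<le> \<Phi> ((H b - J b) / 2)"
    using bih_estimates[OF 0] by metis
  have comp: "((\<lambda>t. fst (y t)) has_real_derivative 3 * fst (y t) + fst (snd (snd (y t)))) (at t within {0..}) \<and>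
     ((\<lambda>t. fst (snd (y t))) has_real_derivative fst (snd (y t)) + fst (snd (snd (y t)))) (at t within {0..}) \<and>
     ((\<lambda>t. fst (snd (snd (y t)))) has_real_derivative - 2 * fst (snd (snd (y t))) + snd (snd (snd (y t)))) (at t within {0..}) \<and>
     ((\<lambda>t. snd (snd (snd (y t)))) has_real_derivative - 4 * snd (snd (snd (y t))) +
        bih_rhs ((fst (y t) - fst (snd (y t))) / 2) ((3 * fst (y t) - fst (snd (y t))) / 2)
         (6 * fst (y t) - fst (snd (y t)) + fst (snd (snd (y t))))) (at t within {0..})"
    if "(y has_vector_derivative bih_field (y t)) (at t within {0..})" for y t
  proof -
    have c: "((\<lambda>t. f (y t)) has_real_derivative f (bih_field (y t))) (at t within {0..})"
      if "bounded_linear f" for f :: "real \<times> real \<times> real \<times> real \<Rightarrow> real"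
      using bounded_linear.has_vector_derivative[OF that \<open>(y has_vector_derivative _) _\<close>]
      by (simp add: has_real_derivative_iff_has_vector_derivative)
    have "bounded_linear (\<lambda>x::real \<times> real \<times> real \<times> real. fst x)"
      "bounded_linear (\<lambda>x::real \<times> real \<times> real \<times> real. fst (snd x))"
      "bounded_linear (\<lambda>x::real \<times> real \<times> real \<times> real. fst (snd (snd x)))"
      "bounded_linear (\<lambda>x::real \<times> real \<times> real \<times> real. snd (snd (snd x)))"
      by (intro bounded_linear_intros)+
    from this[THEN c] show ?thesis by (simp add: bih_field_def case_prod_unfold)
  qed
  consider (global) y where "y 0 = (H0, J0, G0, E0)"
      "\<And>t. t \<ge> 0 \<Longrightarrow> (y has_vector_derivative bih_field (y t)) (at t within {0..})"
    | (local) y T where "T > 0" "y 0 = (H0, J0, G0, E0)"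
      "\<And>t. t \<in> {0..<T} \<Longrightarrow> (y has_vector_derivative bih_field (y t)) (at t within {0..})"
      "\<And>M. \<exists>t\<in>{0..<T}. norm (y t) > M"
    using ode_maximal_solution[OF bih_field_lipschitz, of "(H0, J0, G0, E0)"] by metis
  then show thesis
  proof cases
    case global
    define b where "b = max 0 B + 1"
    have "b \<le> B"
      by (rule est[THEN conjunct1, of b "\<lambda>t. fst (y t)" "\<lambda>t. fst (snd (snd (y t)))" "\<lambda>t. fst (snd (y t))"
            "\<lambda>t. snd (snd (snd (y t)))"])
         (use global comp[OF global(2)] in \<open>auto simp: b_def\<close>)
    then show ?thesis by (simp add: b_def)
  next
    case local
    define H where "H = (\<lambda>t. fst (y t))"
    define J where "J = (\<lambda>t. fst (snd (y t)))"
    define G where "G = (\<lambda>t. fst (snd (snd (y t))))"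
    define E where "E = (\<lambda>t. snd (snd (snd (y t))))"
    have y: "y t = (H t, J t, G t, E t)" for t by (simp add: H_def J_def G_def E_def)
    have init: "H 0 = H0" "J 0 = J0" "G 0 = G0" "E 0 = E0" using local(2) y[of 0] by auto
    have d: "(H has_real_derivative 3 * H t + G t) (at t within {0..})"
      "(J has_real_derivative J t + G t) (at t within {0..})"
      "(G has_real_derivative - 2 * G t + E t) (at t within {0..})"
      "(E has_real_derivative - 4 * E t +
        bih_rhs ((H t - J t) / 2) ((3 * H t - J t) / 2) (6 * H t - J t + G t)) (at t within {0..})"
      if "t \<in> {0..<T}" for t
      using comp[OF local(3)[OF that]] unfolding H_def J_def G_def E_def by blast+
    define v where "v t = (H t - J t) / 2" for t
    have bound: "norm (y t) \<le> \<Phi> (v t)" if "t \<in> {0..<T}" for t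
      unfolding y v_def by (rule est[THEN conjunct2, of t H G J E]; (rule d)?; use that init in simp)
    have dv: "(v has_real_derivative (3 * H t - J t) / 2) (at t within {0..})" if "t \<in> {0..<T}" for t
      unfolding v_def
      by (rule DERIV_cong[OF DERIV_cdivide[OF DERIV_diff[OF d(1,2)[OF that]]]]) (simp add: field_simps)
    have pos: "0 < (3 * H t - J t) / 2" if "t \<in> {0..<T}" for t
    proof -
      have "J t < H t \<and> 0 < J t \<and> 0 < G t \<and> 0 < E t"
        by (rule bih_cone_invariant[of t H G J E]; (rule d)?; use that 0 init in simp)
      then show ?thesis by auto
    qed
    have vmono: "v s \<le> v t" if "0 \<le> s" "s \<le> t" "t < T" for s t
    proof (rule DERIV_nonneg_imp_increasing_open[OF that(2)])
      show "continuous_on {s..t} v"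
        by (rule DERIV_continuous_on, rule has_field_derivative_subset[OF dv]) (use that in auto)
      fix x assume "s < x" "x < t"
      moreover from this that have "at x within {0..} = at x" by (intro at_within_interior) auto
      ultimately show "\<exists>y. (v has_real_derivative y) (at x) \<and> 0 \<le> y"
        using dv[of x] pos[of x] that by (intro exI[of _ "(3 * H x - J x) / 2"]) auto
    qed
    have "filterlim v at_top (at_left T)"
      unfolding filterlim_at_top
    proof
      fix Z
      obtain t where t: "t \<in> {0..<T}" "norm (y t) > \<Phi> Z" using local(4) by blast
      have "Z < v t" using t(2) bound[OF t(1)] monoD[OF \<Phi>, of "v t" Z] by linarith
      then have "Z \<le> v s" if "t < s" "s < T" for s using vmono[of t s] t that by auto
      then show "\<forall>\<^sub>F s in at_left T. Z \<le> v s"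
        using t by (auto simp: eventually_at_left intro!: exI[of _ t])
    qed
    then show ?thesis
      by (intro that[OF local(1) init d]) (auto simp: v_def[abs_def])
  qed
qed

section \<open>The power series at the origin\<close>

text \<open>Coefficients in \<open>\<sigma> = e\<^sup>6\<^sup>t\<close>. The first argument selects the unknown:
  0, 10, 9, 8 for \<open>H / e\<^sup>3\<^sup>t\<close>, \<open>J / e\<^sup>9\<^sup>t\<close>, \<open>G / e\<^sup>9\<^sup>t\<close>, \<open>E / e\<^sup>9\<^sup>t\<close>; 7 for the right-hand side;
  1, 2 for \<open>w / e\<^sup>3\<^sup>t\<close> and \<open>(w + w') / e\<^sup>3\<^sup>t\<close>, 3 for the square of 1; 4, 5, 6 for
  \<open>sin (2v) / e\<^sup>3\<^sup>t\<close>, \<open>(1 - cos (2v)) / e\<^sup>6\<^sup>t\<close> and \<open>(24v - 12 sin (2v)) / e\<^sup>9\<^sup>t\<close>.\<close>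

function bih_coeff :: "nat \<Rightarrow> nat \<Rightarrow> real" where
  "bih_coeff c k =
    (if c = 0 then (if k = 0 then 1 / 10 else bih_coeff 9 (k - 1) / (6 * real k))
     else if c = 1 then (3 * bih_coeff 0 k - (if k = 0 then 0 else bih_coeff 10 (k - 1))) / 2
     else if c = 2 then 6 * bih_coeff 0 k - (if k = 0 then 0 else bih_coeff 10 (k - 1))
        + (if k = 0 then 0 else bih_coeff 9 (k - 1))
     else if c = 3 then (\<Sum>i=0..k. bih_coeff 1 i * bih_coeff 1 (k - i))
     else if c = 4 then (2 * bih_coeff 1 k
        - 2 * (if k = 0 then 0 else (\<Sum>i=0..k-1. bih_coeff 1 i * bih_coeff 5 (k - 1 - i)))) / (6 * real k + 3)
     else if c = 5 then 2 * (\<Sum>i=0..k. bih_coeff 1 i * bih_coeff 4 (k - i)) / (6 * real k + 6)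
     else if c = 6 then 24 * (\<Sum>i=0..k. bih_coeff 1 i * bih_coeff 5 (k - i)) / (6 * real k + 9)
     else if c = 7 then 6 * (\<Sum>i=0..k. bih_coeff 3 i * bih_coeff 2 (k - i))
        - 4 * (\<Sum>i=0..k. bih_coeff 3 i * bih_coeff 1 (k - i))
        - 4 * (\<Sum>i=0..k. bih_coeff 5 i * bih_coeff 2 (k - i))
        - 4 * (\<Sum>i=0..k. bih_coeff 3 i * bih_coeff 4 (k - i)) + bih_coeff 6 k
     else if c = 8 then bih_coeff 7 k / (6 * real k + 13)
     else if c = 9 then bih_coeff 8 k / (6 * real k + 11)
     else if c = 10 then bih_coeff 9 k / (6 * real k + 8)
     else 0)"
  by pat_completeness auto
termination by (relation "Wellfounded.measure (\<lambda>(c, k). 20 * k + c)") auto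

declare bih_coeff.simps [simp del]

text \<open>The defining equation would loop as a rewrite rule, hence one instance per selector. At
  equal k every selector uses only smaller ones, and feedback from 5, 9 and 10 to earlier selectors
  occurs at lower k, which is what the termination measure counts.\<close>

lemma bih_coeff_rec:
  "bih_coeff 0 k = (if k = 0 then 1 / 10 else bih_coeff 9 (k - 1) / (6 * real k))"
  "bih_coeff 1 k = (3 * bih_coeff 0 k - (if k = 0 then 0 else bih_coeff 10 (k - 1))) / 2"
  "bih_coeff 2 k = 6 * bih_coeff 0 k - (if k = 0 then 0 else bih_coeff 10 (k - 1))
        + (if k = 0 then 0 else bih_coeff 9 (k - 1))"
  "bih_coeff 3 k = (\<Sum>i=0..k. bih_coeff 1 i * bih_coeff 1 (k - i))"
  "bih_coeff 4 k = (2 * bih_coeff 1 k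
        - 2 * (if k = 0 then 0 else (\<Sum>i=0..k-1. bih_coeff 1 i * bih_coeff 5 (k - 1 - i)))) / (6 * real k + 3)"
  "bih_coeff 5 k = 2 * (\<Sum>i=0..k. bih_coeff 1 i * bih_coeff 4 (k - i)) / (6 * real k + 6)"
  "bih_coeff 6 k = 24 * (\<Sum>i=0..k. bih_coeff 1 i * bih_coeff 5 (k - i)) / (6 * real k + 9)"
  "bih_coeff 7 k = 6 * (\<Sum>i=0..k. bih_coeff 3 i * bih_coeff 2 (k - i))
        - 4 * (\<Sum>i=0..k. bih_coeff 3 i * bih_coeff 1 (k - i))
        - 4 * (\<Sum>i=0..k. bih_coeff 5 i * bih_coeff 2 (k - i))
        - 4 * (\<Sum>i=0..k. bih_coeff 3 i * bih_coeff 4 (k - i)) + bih_coeff 6 k"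
  "bih_coeff 8 k = bih_coeff 7 k / (6 * real k + 13)"
  "bih_coeff 9 k = bih_coeff 8 k / (6 * real k + 11)"
  "bih_coeff 10 k = bih_coeff 9 k / (6 * real k + 8)"
  by (subst bih_coeff.simps; simp)+

lemma abs_convolution_le:
  fixes a b :: "nat \<Rightarrow> real"
  assumes "\<And>i. i \<le> k \<Longrightarrow> \<bar>a i\<bar> \<le> A" "\<And>i. i \<le> k \<Longrightarrow> \<bar>b i\<bar> \<le> B"
  shows "\<bar>\<Sum>i=0..k. a i * b (k - i)\<bar> \<le> real (k + 1) * (A * B)"
proof -
  have "\<bar>\<Sum>i=0..k. a i * b (k - i)\<bar> \<le> (\<Sum>i=0..k. A * B)"
    by (rule order_trans[OF sum_abs sum_mono])
       (auto simp: abs_mult intro!: mult_mono assms order_trans[OF abs_ge_zero assms(1)[of 0]])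
  then show ?thesis by simp
qed

text \<open>Every division by \<open>6k + const\<close> pays for one convolution, so bounds without decay in \<open>k\<close> are inductive.\<close>

lemma bih_coeff_bounds:
  "\<bar>bih_coeff 0 k\<bar> \<le> 1 / 10 \<and> \<bar>bih_coeff 1 k\<bar> \<le> 2 / 10 \<and> \<bar>bih_coeff 2 k\<bar> \<le> 7 / 10 \<and>
   \<bar>bih_coeff 4 k\<bar> \<le> 2 / 10 \<and> \<bar>bih_coeff 5 k\<bar> \<le> 14 / 1000 \<and> \<bar>bih_coeff 6 k\<bar> \<le> 12 / 1000 \<and>
   \<bar>bih_coeff 9 k\<bar> \<le> 1 / 100 \<and> \<bar>bih_coeff 10 k\<bar> \<le> 1 / 100"
proof (induction k rule: less_induct)
  case (less k)
  have prev: "\<bar>if k = 0 then 0 else bih_coeff 9 (k - 1)\<bar> \<le> 1 / 100"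
     "\<bar>if k = 0 then 0 else bih_coeff 10 (k - 1)\<bar> \<le> 1 / 100"
    using less[of "k - 1"] by auto
  have b0: "\<bar>bih_coeff 0 k\<bar> \<le> 1 / 10"
  proof (cases "k = 0")
    case False
    then have "\<bar>bih_coeff 9 (k - 1)\<bar> \<le> (1 / 10) * (6 * real k)"
      using prev(1) by auto
    then show ?thesis using False by (simp add: bih_coeff_rec(1)[of k] field_simps)
  qed (simp add: bih_coeff_rec(1)[of 0])
  have b1: "\<bar>bih_coeff 1 k\<bar> \<le> 2 / 10" using b0 prev unfolding bih_coeff_rec(2)[of k] by argo
  have b2: "\<bar>bih_coeff 2 k\<bar> \<le> 7 / 10" using b0 prev unfolding bih_coeff_rec(3)[of k] by argo
  have b1': "\<bar>bih_coeff 1 i\<bar> \<le> 2 / 10" if "i \<le> k" for i using b1 less[of i] that by (cases "i = k") auto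
  have b2': "\<bar>bih_coeff 2 i\<bar> \<le> 7 / 10" if "i \<le> k" for i using b2 less[of i] that by (cases "i = k") auto
  have b4: "\<bar>bih_coeff 4 k\<bar> \<le> 2 / 10"
  proof -
    have "\<bar>if k = 0 then 0 else (\<Sum>i=0..k-1. bih_coeff 1 i * bih_coeff 5 (k - 1 - i))\<bar> \<le> real k * (2 / 10 * (14 / 1000))"
      using abs_convolution_le[of "k - 1" "bih_coeff 1" "2 / 10" "bih_coeff 5" "14 / 1000"] less
      by (cases "k = 0") auto
    then have "\<bar>2 * bih_coeff 1 k - 2 * (if k = 0 then 0 else (\<Sum>i=0..k-1. bih_coeff 1 i * bih_coeff 5 (k - 1 - i)))\<bar>
      \<le> 2 / 10 * (6 * real k + 3)"
      using b1 by argo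
    then show ?thesis unfolding bih_coeff_rec(5)[of k] by (simp add: field_simps)
  qed
  have b4': "\<bar>bih_coeff 4 i\<bar> \<le> 2 / 10" if "i \<le> k" for i using b4 less[of i] that by (cases "i = k") auto
  have b5: "\<bar>bih_coeff 5 k\<bar> \<le> 14 / 1000"
    using abs_convolution_le[of k "bih_coeff 1" "2 / 10" "bih_coeff 4" "2 / 10", OF b1' b4']
    unfolding bih_coeff_rec(6)[of k] by (simp add: abs_mult field_simps)
  have b5': "\<bar>bih_coeff 5 i\<bar> \<le> 14 / 1000" if "i \<le> k" for i using b5 less[of i] that by (cases "i = k") auto
  have b6: "\<bar>bih_coeff 6 k\<bar> \<le> 12 / 1000"
    using abs_convolution_le[of k "bih_coeff 1" "2 / 10" "bih_coeff 5" "14 / 1000", OF b1' b5']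
    unfolding bih_coeff_rec(7)[of k] by (simp add: abs_mult field_simps)
  have b3: "\<bar>bih_coeff 3 i\<bar> \<le> real (k + 1) * (4 / 100)" if "i \<le> k" for i
  proof -
    have "\<bar>bih_coeff 3 i\<bar> \<le> real (i + 1) * (2 / 10 * (2 / 10))"
      unfolding bih_coeff_rec(4)[of i] by (rule abs_convolution_le) (use b1' that in auto)
    then show ?thesis using that by simp
  qed
  define K where "K = real (k + 1)"
  have K: "K \<ge> 1" by (simp add: K_def)
  have "\<bar>\<Sum>i=0..k. bih_coeff 3 i * bih_coeff 2 (k - i)\<bar> \<le> K * (K * (4 / 100) * (7 / 10))"
    "\<bar>\<Sum>i=0..k. bih_coeff 3 i * bih_coeff 1 (k - i)\<bar> \<le> K * (K * (4 / 100) * (2 / 10))"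
    "\<bar>\<Sum>i=0..k. bih_coeff 5 i * bih_coeff 2 (k - i)\<bar> \<le> K * (14 / 1000 * (7 / 10))"
    "\<bar>\<Sum>i=0..k. bih_coeff 3 i * bih_coeff 4 (k - i)\<bar> \<le> K * (K * (4 / 100) * (2 / 10))"
    unfolding K_def
    using abs_convolution_le[where a = "bih_coeff 3" and b = "bih_coeff 2", OF b3 b2']
      abs_convolution_le[where a = "bih_coeff 3" and b = "bih_coeff 1", OF b3 b1']
      abs_convolution_le[where a = "bih_coeff 5" and b = "bih_coeff 2", OF b5' b2']
      abs_convolution_le[where a = "bih_coeff 3" and b = "bih_coeff 4", OF b3 b4'] by blast+
  moreover have "1 \<le> K * K" "K \<le> K * K" using K mult_mono[of 1 K 1 K] mult_mono[of 1 K K K] by auto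
  \<comment> \<open>Selector 7 contains threefold products and is bounded only by a multiple of K^2;
    the divisions by 6k + 13 and 6k + 11 in selectors 8 and 9 bring it back to a constant.\<close>
  ultimately have b7: "\<bar>bih_coeff 7 k\<bar> \<le> 3 / 10 * (K * K)"
    using b6 unfolding bih_coeff_rec(8)[of k] by argo
  have "3 / 10 * (K * K) \<le> K * (6 / 100) * (6 * real k + 13)"
    using K by (simp add: K_def algebra_simps)
  then have b8: "\<bar>bih_coeff 8 k\<bar> \<le> 6 / 100 * K"
    using b7 unfolding bih_coeff_rec(9)[of k] by (simp add: field_simps)
  have "6 / 100 * K \<le> 1 / 100 * (6 * real k + 11)" by (simp add: K_def)
  then have b9: "\<bar>bih_coeff 9 k\<bar> \<le> 1 / 100"
    using b8 unfolding bih_coeff_rec(10)[of k] by (simp add: field_simps)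
  then have b10: "\<bar>bih_coeff 10 k\<bar> \<le> 1 / 100"
    unfolding bih_coeff_rec(11)[of k] by (simp add: field_simps)
  show ?case using b0 b1 b2 b4 b5 b6 b9 b10 by blast
qed

section \<open>Generating functions of the coefficients: convergence and differential
  equations\<close>

definition bih_fps :: "nat \<Rightarrow> real fps" where
  "bih_fps c = Abs_fps (bih_coeff c)"

lemma bih_fps_radius:
  assumes "c \<in> {0, 1, 2, 4, 5, 6, 9, 10}"
  shows "1 \<le> fps_conv_radius (bih_fps c)"
  unfolding fps_conv_radius_def
proof (rule conv_radius_geI_ex')
  fix r :: real assume r: "0 < r" "ereal r < 1"
  have "\<bar>bih_coeff c n\<bar> \<le> 1" for n using bih_coeff_bounds[of n] assms by auto
  then have "norm (bih_coeff c n * r ^ n) \<le> r ^ n" for n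
    using r by (simp add: abs_mult mult_left_le_one_le)
  then show "summable (\<lambda>n. fps_nth (bih_fps c) n * of_real r ^ n)"
    using r by (intro summable_comparison_test'[OF summable_geometric[of r]]) (auto simp: bih_fps_def)
qed

definition bih_series :: "nat \<Rightarrow> real \<Rightarrow> real" where
  "bih_series c = eval_fps (bih_fps c)"

lemma C_diff_on_bih_series:
  assumes "c \<in> {0, 10}"
  shows "C_diff_on k {-1<..<1} (bih_series c)"
  unfolding bih_series_def eval_fps_def[abs_def]
proof (rule C_diff_on_powser)
  fix x :: real assume "\<bar>x\<bar> < 1"
  moreover have "1 \<le> fps_conv_radius (bih_fps c)" using bih_fps_radius[of c] assms by auto
  ultimately have "norm x < fps_conv_radius (bih_fps c)"
    by (metis less_ereal.simps(1) less_le_trans one_ereal_def real_norm_def)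
  then show "summable (\<lambda>n. fps_nth (bih_fps c) n * x ^ n)" by (rule summable_fps)
qed

lemma fps_conv_radius_ge_1:
  fixes f g :: "real fps"
  shows "1 \<le> fps_conv_radius f \<Longrightarrow> 1 \<le> fps_conv_radius g \<Longrightarrow> 1 \<le> fps_conv_radius (f + g)"
    and "1 \<le> fps_conv_radius f \<Longrightarrow> 1 \<le> fps_conv_radius g \<Longrightarrow> 1 \<le> fps_conv_radius (f - g)"
    and "1 \<le> fps_conv_radius f \<Longrightarrow> 1 \<le> fps_conv_radius g \<Longrightarrow> 1 \<le> fps_conv_radius (f * g)"
    and "1 \<le> fps_conv_radius f \<Longrightarrow> 1 \<le> fps_conv_radius (fps_deriv f)"
    and "1 \<le> fps_conv_radius (fps_X :: real fps)"
    and "1 \<le> fps_conv_radius (fps_const c :: real fps)"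
  by (rule order_trans[OF _ fps_conv_radius_add], simp)
     (rule order_trans[OF _ fps_conv_radius_diff], simp,
      rule order_trans[OF _ fps_conv_radius_mult], simp,
      rule order_trans[OF _ fps_conv_radius_deriv], simp_all)

lemma eval_fps_ring:
  fixes f g :: "real fps"
  assumes "1 \<le> fps_conv_radius f" "1 \<le> fps_conv_radius g" "\<bar>x\<bar> < 1"
  shows "eval_fps (f + g) x = eval_fps f x + eval_fps g x"
    and "eval_fps (f - g) x = eval_fps f x - eval_fps g x"
    and "eval_fps (f * g) x = eval_fps f x * eval_fps g x"
proof -
  have "norm x < fps_conv_radius f" "norm x < fps_conv_radius g"
    using assms by (metis less_ereal.simps(1) less_le_trans one_ereal_def real_norm_def)+
  then show "eval_fps (f + g) x = eval_fps f x + eval_fps g x"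
    "eval_fps (f - g) x = eval_fps f x - eval_fps g x"
    "eval_fps (f * g) x = eval_fps f x * eval_fps g x"
    by (simp_all add: eval_fps_add eval_fps_diff eval_fps_mult)
qed

lemma bih_fps_nth: "fps_nth (bih_fps c) k = bih_coeff c k"
  by (simp add: bih_fps_def)

text \<open>\<open>fps_X * fps_deriv\<close> multiplies the k-th coefficient by k, so a denominator
  6k + a becomes the operator 6 x d/dx + a, which is D acting on exp (a t) f (exp (6 t)), up to that
  exponential factor.\<close>

lemma bih_fps_eqs:
  "fps_const 6 * fps_deriv (bih_fps 0) = bih_fps 9"
  "bih_fps 1 = fps_const (3 / 2) * bih_fps 0 - fps_const (1 / 2) * (fps_X * bih_fps 10)"
  "bih_fps 2 = fps_const 6 * bih_fps 0 - fps_X * bih_fps 10 + fps_X * bih_fps 9"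
  "bih_fps 3 = bih_fps 1 * bih_fps 1"
  "fps_const 6 * (fps_X * fps_deriv (bih_fps 4)) + fps_const 3 * bih_fps 4 =
     fps_const 2 * bih_fps 1 - fps_const 2 * (fps_X * (bih_fps 1 * bih_fps 5))"
  "fps_const 6 * (fps_X * fps_deriv (bih_fps 5)) + fps_const 6 * bih_fps 5 = fps_const 2 * (bih_fps 1 * bih_fps 4)"
  "fps_const 6 * (fps_X * fps_deriv (bih_fps 6)) + fps_const 9 * bih_fps 6 = fps_const 24 * (bih_fps 1 * bih_fps 5)"
  "bih_fps 7 = fps_const 6 * (bih_fps 3 * bih_fps 2) - fps_const 4 * (bih_fps 3 * bih_fps 1)
     - fps_const 4 * (bih_fps 5 * bih_fps 2) - fps_const 4 * (bih_fps 3 * bih_fps 4) + bih_fps 6"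
  "bih_fps 7 = fps_const 6 * (fps_X * fps_deriv (bih_fps 8)) + fps_const 13 * bih_fps 8"
  "bih_fps 8 = fps_const 6 * (fps_X * fps_deriv (bih_fps 9)) + fps_const 11 * bih_fps 9"
  "fps_const 6 * (fps_X * fps_deriv (bih_fps 10)) + fps_const 8 * bih_fps 10 = bih_fps 9"
proof -
  have X: "fps_nth (fps_X * fps_deriv (bih_fps c)) k = real k * bih_coeff c k" for c k
    by (cases k) (auto simp: bih_fps_nth)
  have cancel: "6 * (real k * (s / (6 * real k + numeral a))) + numeral a * (s / (6 * real k + numeral a)) = s" for k a s
  proof -
    have "6 * real k + numeral a \<noteq> 0"
      using of_nat_0_le_iff[of k, where 'a = real] zero_less_numeral[of a, where 'a = real] by linarith
    moreover have "6 * (real k * (s / (6 * real k + numeral a))) + numeral a * (s / (6 * real k + numeral a))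
       = (6 * real k + numeral a) * (s / (6 * real k + numeral a))" by (simp only: distrib_right mult.assoc)
    ultimately show ?thesis by simp
  qed
  show "fps_const 6 * fps_deriv (bih_fps 0) = bih_fps 9"
    by (rule fps_ext) (simp add: bih_fps_nth bih_coeff_rec(1) field_simps del: One_nat_def)
  show "bih_fps 1 = fps_const (3 / 2) * bih_fps 0 - fps_const (1 / 2) * (fps_X * bih_fps 10)"
    by (rule fps_ext) (simp add: bih_fps_nth bih_coeff_rec(2) field_simps del: One_nat_def)
  show "bih_fps 2 = fps_const 6 * bih_fps 0 - fps_X * bih_fps 10 + fps_X * bih_fps 9"
    by (rule fps_ext) (simp add: bih_fps_nth bih_coeff_rec(3) del: One_nat_def)
  show "bih_fps 3 = bih_fps 1 * bih_fps 1"
    by (rule fps_ext) (simp add: bih_fps_nth bih_coeff_rec(4) fps_mult_nth del: One_nat_def)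
  show "fps_const 6 * (fps_X * fps_deriv (bih_fps 4)) + fps_const 3 * bih_fps 4 =
     fps_const 2 * bih_fps 1 - fps_const 2 * (fps_X * (bih_fps 1 * bih_fps 5))"
  proof (rule fps_ext)
    fix k
    have "fps_nth (fps_X * (bih_fps 1 * bih_fps 5)) k =
       (if k = 0 then 0 else (\<Sum>i=0..k-1. bih_coeff 1 i * bih_coeff 5 (k - 1 - i)))"
      by (simp add: fps_mult_nth[of "bih_fps 1" "bih_fps 5"] bih_fps_nth del: One_nat_def)
    then show "fps_nth (fps_const 6 * (fps_X * fps_deriv (bih_fps 4)) + fps_const 3 * bih_fps 4) k =
     fps_nth (fps_const 2 * bih_fps 1 - fps_const 2 * (fps_X * (bih_fps 1 * bih_fps 5))) k"
      by (simp only: fps_add_nth fps_sub_nth fps_mult_left_const_nth X) (simp only: bih_fps_nth bih_coeff_rec(5) cancel)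
  qed
  show "fps_const 6 * (fps_X * fps_deriv (bih_fps 5)) + fps_const 6 * bih_fps 5 = fps_const 2 * (bih_fps 1 * bih_fps 4)"
    by (rule fps_ext, simp only: fps_add_nth fps_sub_nth fps_mult_left_const_nth X fps_mult_nth[of "bih_fps 1"])
       (simp only: bih_fps_nth bih_coeff_rec(6) cancel)
  show "fps_const 6 * (fps_X * fps_deriv (bih_fps 6)) + fps_const 9 * bih_fps 6 = fps_const 24 * (bih_fps 1 * bih_fps 5)"
    by (rule fps_ext, simp only: fps_add_nth fps_sub_nth fps_mult_left_const_nth X fps_mult_nth[of "bih_fps 1"])
       (simp only: bih_fps_nth bih_coeff_rec(7) cancel)
  show "bih_fps 7 = fps_const 6 * (bih_fps 3 * bih_fps 2) - fps_const 4 * (bih_fps 3 * bih_fps 1)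
     - fps_const 4 * (bih_fps 5 * bih_fps 2) - fps_const 4 * (bih_fps 3 * bih_fps 4) + bih_fps 6"
    by (rule fps_ext, simp only: fps_add_nth fps_sub_nth fps_mult_left_const_nth fps_mult_nth[of "bih_fps 3"]
        fps_mult_nth[of "bih_fps 5"])
       (simp add: bih_fps_nth bih_coeff_rec(8) del: One_nat_def)
  show "bih_fps 7 = fps_const 6 * (fps_X * fps_deriv (bih_fps 8)) + fps_const 13 * bih_fps 8"
    by (rule fps_ext, simp only: fps_add_nth fps_mult_left_const_nth X)
       (simp only: bih_fps_nth bih_coeff_rec(9) cancel)
  show "bih_fps 8 = fps_const 6 * (fps_X * fps_deriv (bih_fps 9)) + fps_const 11 * bih_fps 9"
    by (rule fps_ext, simp only: fps_add_nth fps_mult_left_const_nth X)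
       (simp only: bih_fps_nth bih_coeff_rec(10) cancel)
  show "fps_const 6 * (fps_X * fps_deriv (bih_fps 10)) + fps_const 8 * bih_fps 10 = bih_fps 9"
    by (rule fps_ext, simp only: fps_add_nth fps_mult_left_const_nth X)
       (simp only: bih_fps_nth bih_coeff_rec(11) cancel)
qed

text \<open>The bounds for selectors 3, 7 and 8 grow with k; their radius follows from the
  identities that express them through series already known to converge.\<close>

lemma bih_fps_radius':
  assumes "c \<le> 10"
  shows "1 \<le> fps_conv_radius (bih_fps c)"
proof -
  have 8: "1 \<le> fps_conv_radius (bih_fps 8)"
    unfolding bih_fps_eqs(10) by (intro fps_conv_radius_ge_1 bih_fps_radius) auto
  have 7: "1 \<le> fps_conv_radius (bih_fps 7)"
    unfolding bih_fps_eqs(9) by (intro fps_conv_radius_ge_1 8)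
  have 3: "1 \<le> fps_conv_radius (bih_fps 3)"
    unfolding bih_fps_eqs(4) by (intro fps_conv_radius_ge_1 bih_fps_radius) auto
  have "c \<in> {0, 1, 2, 4, 5, 6, 9, 10} \<or> c = 8 \<or> c = 7 \<or> c = 3"
    unfolding insert_iff empty_iff using assms by presburger
  then show ?thesis using 8 7 3 bih_fps_radius by blast
qed

lemma has_real_derivative_bih_series:
  assumes "c \<le> 10" "\<bar>x\<bar> < 1"
  shows "(bih_series c has_real_derivative eval_fps (fps_deriv (bih_fps c)) x) (at x)"
  unfolding bih_series_def
proof (rule has_field_derivative_eval_fps)
  show "ereal (norm x) < fps_conv_radius (bih_fps c)"
    using bih_fps_radius'[OF assms(1)] assms(2)
    by (metis less_ereal.simps(1) less_le_trans one_ereal_def real_norm_def)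
qed

lemma bih_series_eqs:
  assumes x: "\<bar>x\<bar> < 1"
  shows
  "6 * eval_fps (fps_deriv (bih_fps 0)) x = bih_series 9 x"
  "bih_series 1 x = 3 / 2 * bih_series 0 x - 1 / 2 * (x * bih_series 10 x)"
  "bih_series 2 x = 6 * bih_series 0 x - x * bih_series 10 x + x * bih_series 9 x"
  "6 * (x * eval_fps (fps_deriv (bih_fps 4)) x) + 3 * bih_series 4 x =
     2 * bih_series 1 x - 2 * (x * (bih_series 1 x * bih_series 5 x))"
  "6 * (x * eval_fps (fps_deriv (bih_fps 5)) x) + 6 * bih_series 5 x = 2 * (bih_series 1 x * bih_series 4 x)"
  "6 * (x * eval_fps (fps_deriv (bih_fps 6)) x) + 9 * bih_series 6 x = 24 * (bih_series 1 x * bih_series 5 x)"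
  "bih_series 7 x = 6 * ((bih_series 1 x)\<^sup>2 * bih_series 2 x) - 4 * bih_series 1 x ^ 3
     - 4 * (bih_series 5 x * bih_series 2 x) - 4 * ((bih_series 1 x)\<^sup>2 * bih_series 4 x) + bih_series 6 x"
  "6 * (x * eval_fps (fps_deriv (bih_fps 8)) x) + 13 * bih_series 8 x = bih_series 7 x"
  "6 * (x * eval_fps (fps_deriv (bih_fps 9)) x) + 11 * bih_series 9 x = bih_series 8 x"
  "6 * (x * eval_fps (fps_deriv (bih_fps 10)) x) + 8 * bih_series 10 x = bih_series 9 x"
proof -
  note r = bih_fps_radius' fps_conv_radius_ge_1
  note e = eval_fps_ring[OF _ _ x] r
  have 3: "bih_series 3 x = (bih_series 1 x)\<^sup>2"
    unfolding bih_series_def bih_fps_eqs(4) by (simp add: e power2_eq_square)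
  show "6 * eval_fps (fps_deriv (bih_fps 0)) x = bih_series 9 x"
    using arg_cong[OF bih_fps_eqs(1), of "\<lambda>f. eval_fps f x"] by (simp add: e bih_series_def)
  show "bih_series 1 x = 3 / 2 * bih_series 0 x - 1 / 2 * (x * bih_series 10 x)"
    using arg_cong[OF bih_fps_eqs(2), of "\<lambda>f. eval_fps f x"] by (simp add: e bih_series_def)
  show "bih_series 2 x = 6 * bih_series 0 x - x * bih_series 10 x + x * bih_series 9 x"
    using arg_cong[OF bih_fps_eqs(3), of "\<lambda>f. eval_fps f x"] by (simp add: e bih_series_def)
  show "6 * (x * eval_fps (fps_deriv (bih_fps 4)) x) + 3 * bih_series 4 x =
     2 * bih_series 1 x - 2 * (x * (bih_series 1 x * bih_series 5 x))"
    using arg_cong[OF bih_fps_eqs(5), of "\<lambda>f. eval_fps f x"] by (simp add: e bih_series_def)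
  show "6 * (x * eval_fps (fps_deriv (bih_fps 5)) x) + 6 * bih_series 5 x = 2 * (bih_series 1 x * bih_series 4 x)"
    using arg_cong[OF bih_fps_eqs(6), of "\<lambda>f. eval_fps f x"] by (simp add: e bih_series_def)
  show "6 * (x * eval_fps (fps_deriv (bih_fps 6)) x) + 9 * bih_series 6 x = 24 * (bih_series 1 x * bih_series 5 x)"
    using arg_cong[OF bih_fps_eqs(7), of "\<lambda>f. eval_fps f x"] by (simp add: e bih_series_def)
  have "bih_series 7 x = 6 * (bih_series 3 x * bih_series 2 x) - 4 * (bih_series 3 x * bih_series 1 x)
     - 4 * (bih_series 5 x * bih_series 2 x) - 4 * (bih_series 3 x * bih_series 4 x) + bih_series 6 x"
    using arg_cong[OF bih_fps_eqs(8), of "\<lambda>f. eval_fps f x"] by (simp add: e bih_series_def)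
  then show "bih_series 7 x = 6 * ((bih_series 1 x)\<^sup>2 * bih_series 2 x) - 4 * bih_series 1 x ^ 3
     - 4 * (bih_series 5 x * bih_series 2 x) - 4 * ((bih_series 1 x)\<^sup>2 * bih_series 4 x) + bih_series 6 x"
    by (simp add: 3 power2_eq_square power3_eq_cube)
  show "6 * (x * eval_fps (fps_deriv (bih_fps 8)) x) + 13 * bih_series 8 x = bih_series 7 x"
    using arg_cong[OF bih_fps_eqs(9), of "\<lambda>f. eval_fps f x"] by (simp add: e bih_series_def)
  show "6 * (x * eval_fps (fps_deriv (bih_fps 9)) x) + 11 * bih_series 9 x = bih_series 8 x"
    using arg_cong[OF bih_fps_eqs(10), of "\<lambda>f. eval_fps f x"] by (simp add: e bih_series_def)
  show "6 * (x * eval_fps (fps_deriv (bih_fps 10)) x) + 8 * bih_series 10 x = bih_series 9 x"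
    using arg_cong[OF bih_fps_eqs(11), of "\<lambda>f. eval_fps f x"] by (simp add: e bih_series_def)
qed

text \<open>Positivity of the leading coefficient of N, computed from the value 1/10 of the free
  coefficient, passes to E, G and J; this places the solution in the cone near minus
  infinity.\<close>

lemma bih_series_0:
  "bih_series 0 0 = 1 / 10" "0 < bih_series 8 0" "0 < bih_series 9 0" "0 < bih_series 10 0"
proof -
  have c: "bih_coeff 0 0 = 1 / 10" "bih_coeff 1 0 = 3 / 20" "bih_coeff 2 0 = 6 / 10"
    by (simp_all add: bih_coeff_rec(1-3)[of 0] del: One_nat_def)
  have c4: "bih_coeff 4 0 = 1 / 10" "bih_coeff 3 0 = 9 / 400" by (simp_all add: bih_coeff_rec(4,5)[of 0] c del: One_nat_def)
  have c5: "bih_coeff 5 0 = 1 / 200" by (simp add: bih_coeff_rec(6)[of 0] c c4 del: One_nat_def)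
  have c6: "bih_coeff 6 0 = 1 / 500" by (simp add: bih_coeff_rec(7)[of 0] c c5 del: One_nat_def)
  have c7: "0 < bih_coeff 7 0" by (simp add: bih_coeff_rec(8)[of 0] c c4 c5 c6 del: One_nat_def)
  have "0 < bih_coeff 8 0" using c7 by (simp add: bih_coeff_rec(9)[of 0] del: One_nat_def)
  moreover from this have "0 < bih_coeff 9 0" by (simp add: bih_coeff_rec(10)[of 0] del: One_nat_def)
  moreover from this have "0 < bih_coeff 10 0" by (simp add: bih_coeff_rec(11)[of 0] del: One_nat_def)
  ultimately show "bih_series 0 0 = 1 / 10" "0 < bih_series 8 0" "0 < bih_series 9 0" "0 < bih_series 10 0"
    using c by (simp_all add: bih_series_def eval_fps_at_0 bih_fps_def del: One_nat_def)
qed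

section \<open>The solution on its maximal interval\<close>

lemma bih_series_exp_derivative:
  assumes "c \<le> 10" "t < 0"
  shows "((\<lambda>t. exp (a * t) * bih_series c (exp (6 * t))) has_real_derivative
    exp (a * t) * (a * bih_series c (exp (6 * t)) + 6 * (exp (6 * t) * eval_fps (fps_deriv (bih_fps c)) (exp (6 * t))))) (at t)"
proof -
  have x: "\<bar>exp (6 * t)\<bar> < 1" using assms(2) by simp
  have e: "((\<lambda>t. exp (b * t)) has_real_derivative b * exp (b * t)) (at t)" for b
    by (auto intro!: derivative_eq_intros)
  show ?thesis
    by (rule DERIV_cong[OF DERIV_mult[OF e DERIV_chain2[OF has_real_derivative_bih_series[OF assms(1) x] e]]])
       (simp add: algebra_simps)
qed

lemma bih_series_tendsto_0:
  assumes "c \<le> 10" "a > 0"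
  shows "((\<lambda>t. exp (a * t) * bih_series c (exp (6 * t))) \<longlongrightarrow> 0) at_bot"
proof -
  have e: "((\<lambda>t. exp (b * t)) \<longlongrightarrow> 0) at_bot" if "b > 0" for b :: real
    using that by (intro filterlim_compose[OF exp_at_bot] filterlim_tendsto_pos_mult_at_bot[OF tendsto_const])
       (auto intro: filterlim_ident)
  have "isCont (bih_series c) 0"
    by (rule DERIV_isCont[OF has_real_derivative_bih_series[OF assms(1)]]) simp
  then have "((\<lambda>t. bih_series c (exp (6 * t))) \<longlongrightarrow> bih_series c 0) at_bot"
    by (rule isCont_tendsto_compose) (rule e, simp)
  from tendsto_mult[OF e[OF assms(2)] this] show ?thesis by simp
qed

text \<open>Uniqueness with data at minus infinity: identities between solutions follow by applying
  it to a difference or a squared distance.\<close>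

lemma const_on_lessThan_0:
  fixes f :: "real \<Rightarrow> real"
  assumes "\<And>t. t < 0 \<Longrightarrow> (f has_real_derivative 0) (at t)" "(f \<longlongrightarrow> 0) at_bot" "t < 0"
  shows "f t = 0"
proof -
  have "f t = f s" if "s < t" for s
  proof (rule DERIV_isconst_end[OF that])
    show "continuous_on {s..t} f"
      by (rule DERIV_continuous_on[where D = "\<lambda>_. 0"], rule has_field_derivative_at_within, rule assms(1))
         (use assms(3) in simp)
  qed (use assms(1,3) in simp)
  then have "f s = f t" if "s < t" for s using that by metis
  then have "\<forall>\<^sub>F s in at_bot. f s = f t" unfolding eventually_at_bot_dense by blast
  from tendsto_cong[OF this] have "((\<lambda>s::real. f t) \<longlongrightarrow> 0) at_bot" using assms(2) by blast
  then show ?thesis using tendsto_const_iff[of "at_bot :: real filter" "f t" 0] by simp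
qed

definition bih_H :: "real \<Rightarrow> real" where "bih_H t = exp (3 * t) * bih_series 0 (exp (6 * t))"
definition bih_J :: "real \<Rightarrow> real" where "bih_J t = exp (9 * t) * bih_series 10 (exp (6 * t))"
definition bih_G :: "real \<Rightarrow> real" where "bih_G t = exp (9 * t) * bih_series 9 (exp (6 * t))"
definition bih_E :: "real \<Rightarrow> real" where "bih_E t = exp (9 * t) * bih_series 8 (exp (6 * t))"

text \<open>Selectors 4, 5 and 6 encode only differential equations. That their sums are the
  trigonometric functions of v follows from these equations and the limits at minus infinity, and
  the polynomial identity for selector 7 then becomes \<open>bih_rhs\<close>.\<close>

lemma bih_series_solution:
  assumes t: "t < 0"
  shows "(bih_H has_real_derivative 3 * bih_H t + bih_G t) (at t)"
    "(bih_J has_real_derivative bih_J t + bih_G t) (at t)"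
    "(bih_G has_real_derivative - 2 * bih_G t + bih_E t) (at t)"
    "(bih_E has_real_derivative - 4 * bih_E t +
      bih_rhs ((bih_H t - bih_J t) / 2) ((3 * bih_H t - bih_J t) / 2) (6 * bih_H t - bih_J t + bih_G t)) (at t)"
proof -
  define X where "X = (\<lambda>t::real. exp (6 * t))"
  have Xs: "exp (6 * t) = X t" for t by (simp add: X_def)
  have Xlt: "\<bar>X t\<bar> < 1" if "t < 0" for t using that by (simp add: X_def)
  have e3: "exp (9 * t) = exp (3 * t) ^ 3" "X t = exp (3 * t) ^ 2" "exp (9 * t) = exp (3 * t) * X t" for t :: real
    by (simp_all add: X_def flip: exp_of_nat_mult exp_add)
  note d = bih_series_exp_derivative[unfolded Xs]
  note eq = bih_series_eqs[OF Xlt]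
  have dH: "(bih_H has_real_derivative 3 * bih_H t + bih_G t) (at t)" if "t < 0" for t
    unfolding bih_H_def[abs_def] bih_G_def Xs
    by (rule DERIV_cong[OF d[OF _ that]]) (simp, simp only: e3(3) eq(1)[OF that, symmetric], simp add: algebra_simps)
  have dJ: "(bih_J has_real_derivative bih_J t + bih_G t) (at t)" if "t < 0" for t
    unfolding bih_J_def[abs_def] bih_G_def Xs
    by (rule DERIV_cong[OF d[OF _ that]]) (use eq(10)[OF that, symmetric] in \<open>auto simp: algebra_simps\<close>)
  have dG: "(bih_G has_real_derivative - 2 * bih_G t + bih_E t) (at t)" if "t < 0" for t
    unfolding bih_E_def bih_G_def[abs_def] Xs
    by (rule DERIV_cong[OF d[OF _ that]]) (use eq(9)[OF that, symmetric] in \<open>auto simp: algebra_simps\<close>)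
  show "(bih_H has_real_derivative 3 * bih_H t + bih_G t) (at t)"
    "(bih_J has_real_derivative bih_J t + bih_G t) (at t)"
    "(bih_G has_real_derivative - 2 * bih_G t + bih_E t) (at t)"
    by (fact dH[OF t] dJ[OF t] dG[OF t])+
  define v where "v t = (bih_H t - bih_J t) / 2" for t
  define w where "w t = exp (3 * t) * bih_series 1 (X t)" for t
  define S where "S t = exp (3 * t) * bih_series 4 (X t)" for t
  define C where "C t = 1 - exp (6 * t) * bih_series 5 (X t)" for t
  define m where "m t = exp (9 * t) * bih_series 6 (X t)" for t
  have weq: "(3 * bih_H t - bih_J t) / 2 = w t" if "t < 0" for t
    unfolding w_def bih_H_def bih_J_def Xs eq(2)[OF that] e3(3) by (simp add: field_simps)
  have dv: "(v has_real_derivative w t) (at t)" if "t < 0" for t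
    unfolding v_def[abs_def] weq[OF that, symmetric]
    by (rule DERIV_cong[OF DERIV_cdivide[OF DERIV_diff[OF dH[OF that] dJ[OF that]]]]) simp
  have dS: "(S has_real_derivative 2 * w t * C t) (at t)" if "t < 0" for t
  proof -
    have "(S has_real_derivative exp (3 * t) * (3 * bih_series 4 (X t) + 6 * (X t * eval_fps (fps_deriv (bih_fps 4)) (X t)))) (at t)"
      unfolding S_def[abs_def] by (rule d[OF _ that]) simp
    moreover have "3 * bih_series 4 (X t) + 6 * (X t * eval_fps (fps_deriv (bih_fps 4)) (X t))
        = 2 * bih_series 1 (X t) - 2 * (X t * (bih_series 1 (X t) * bih_series 5 (X t)))"
      using eq(4)[OF that] by simp
    ultimately have "(S has_real_derivative exp (3 * t) * (2 * bih_series 1 (X t) - 2 * (X t * (bih_series 1 (X t) * bih_series 5 (X t))))) (at t)"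
      by (simp only:)
    then show ?thesis by (rule DERIV_cong) (unfold w_def C_def Xs, simp add: algebra_simps)
  qed
  have dC: "(C has_real_derivative - 2 * w t * S t) (at t)" if "t < 0" for t
  proof -
    have "(C has_real_derivative 0 - exp (6 * t) * (6 * bih_series 5 (X t) + 6 * (X t * eval_fps (fps_deriv (bih_fps 5)) (X t)))) (at t)"
      unfolding C_def[abs_def] by (intro DERIV_diff DERIV_const d[OF _ that]) simp
    moreover have "6 * bih_series 5 (X t) + 6 * (X t * eval_fps (fps_deriv (bih_fps 5)) (X t))
        = 2 * (bih_series 1 (X t) * bih_series 4 (X t))"
      using eq(5)[OF that] by simp
    ultimately have "(C has_real_derivative 0 - exp (6 * t) * (2 * (bih_series 1 (X t) * bih_series 4 (X t)))) (at t)"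
      by (simp only:)
    moreover have "exp (6 * t) = exp (3 * t) * exp (3 * t)" by (simp flip: exp_add)
    ultimately have "(C has_real_derivative 0 - exp (3 * t) * exp (3 * t) * (2 * (bih_series 1 (X t) * bih_series 4 (X t)))) (at t)"
      by (simp only:)
    then show ?thesis by (rule DERIV_cong) (unfold w_def S_def, simp add: algebra_simps)
  qed
  have dm: "(m has_real_derivative 24 * w t * (1 - C t)) (at t)" if "t < 0" for t
  proof -
    have "(m has_real_derivative exp (9 * t) * (9 * bih_series 6 (X t) + 6 * (X t * eval_fps (fps_deriv (bih_fps 6)) (X t)))) (at t)"
      unfolding m_def[abs_def] by (rule d[OF _ that]) simp
    moreover have "9 * bih_series 6 (X t) + 6 * (X t * eval_fps (fps_deriv (bih_fps 6)) (X t))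
        = 24 * (bih_series 1 (X t) * bih_series 5 (X t))"
      using eq(6)[OF that] by simp
    ultimately have "(m has_real_derivative exp (9 * t) * (24 * (bih_series 1 (X t) * bih_series 5 (X t)))) (at t)"
      by (simp only:)
    then show ?thesis by (rule DERIV_cong) (unfold w_def C_def e3(3) Xs, simp add: algebra_simps)
  qed
  have lim: "(v \<longlongrightarrow> 0) at_bot" "(S \<longlongrightarrow> 0) at_bot" "(C \<longlongrightarrow> 1) at_bot" "(m \<longlongrightarrow> 0) at_bot"
  proof -
    note l = bih_series_tendsto_0[unfolded Xs]
    have "(v \<longlongrightarrow> (0 - 0) / 2) at_bot"
      unfolding v_def[abs_def] bih_H_def bih_J_def Xs
      by (intro tendsto_intros l) simp_all
    then show "(v \<longlongrightarrow> 0) at_bot" by simp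
    show "(S \<longlongrightarrow> 0) at_bot" "(m \<longlongrightarrow> 0) at_bot" unfolding S_def[abs_def] m_def[abs_def] by (intro l; simp)+
    have "(C \<longlongrightarrow> 1 - 0) at_bot" unfolding C_def[abs_def] by (intro tendsto_intros l) simp_all
    then show "(C \<longlongrightarrow> 1) at_bot" by simp
  qed
  \<comment> \<open>\<open>(S, C)\<close> and \<open>(sin 2v, cos 2v)\<close> rotate with the same angular velocity and agree at \<open>-\<infinity>\<close>.\<close>
  have SC: "(S t - sin (2 * v t))\<^sup>2 + (C t - cos (2 * v t))\<^sup>2 = 0" if "t < 0" for t
  proof (rule const_on_lessThan_0[of "\<lambda>t. (S t - sin (2 * v t))\<^sup>2 + (C t - cos (2 * v t))\<^sup>2", OF _ _ that])
    fix t :: real assume t: "t < 0"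
    show "((\<lambda>t. (S t - sin (2 * v t))\<^sup>2 + (C t - cos (2 * v t))\<^sup>2) has_real_derivative 0) (at t)"
      by (rule derivative_eq_intros dS[OF t] dC[OF t] dv[OF t] refl)+ (simp add: algebra_simps power2_eq_square)
  next
    have "((\<lambda>t. (S t - sin (2 * v t))\<^sup>2 + (C t - cos (2 * v t))\<^sup>2) \<longlongrightarrow> (0 - sin (2 * 0))\<^sup>2 + (1 - cos (2 * 0))\<^sup>2) at_bot"
      by (intro tendsto_intros lim)
    then show "((\<lambda>t. (S t - sin (2 * v t))\<^sup>2 + (C t - cos (2 * v t))\<^sup>2) \<longlongrightarrow> 0) at_bot" by simp
  qed
  have S: "S t = sin (2 * v t)" and C: "C t = cos (2 * v t)" if "t < 0" for t
    using SC[OF that] by (simp_all add: sum_power2_eq_zero_iff)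
  have m: "m t = 24 * v t - 12 * sin (2 * v t)" if "t < 0" for t
  proof -
    have "m t - (24 * v t - 12 * S t) = 0"
    proof (rule const_on_lessThan_0[of "\<lambda>t. m t - (24 * v t - 12 * S t)", OF _ _ that])
      fix t :: real assume t: "t < 0"
      show "((\<lambda>t. m t - (24 * v t - 12 * S t)) has_real_derivative 0) (at t)"
        by (rule derivative_eq_intros dS[OF t] dm[OF t] dv[OF t] refl)+ (simp add: algebra_simps)
    next
      have "((\<lambda>t. m t - (24 * v t - 12 * S t)) \<longlongrightarrow> 0 - (24 * 0 - 12 * 0)) at_bot"
        by (intro tendsto_intros lim)
      then show "((\<lambda>t. m t - (24 * v t - 12 * S t)) \<longlongrightarrow> 0) at_bot" by simp
    qed
    then show ?thesis using S[OF that] by simp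
  qed
  define z where "z = exp (3 * t) * bih_series 2 (X t)"
  have z: "6 * bih_H t - bih_J t + bih_G t = z"
    unfolding z_def bih_H_def bih_J_def bih_G_def Xs eq(3)[OF t] e3(3) by (simp add: algebra_simps)
  \<comment> \<open>Half-angle formula: 8 (sin v)^2 = 4 (1 - cos (2v)), hence the factor 4 before
    selector 5 in the recursion for selector 7.\<close>
  have sin2: "(sin (v t))\<^sup>2 = (X t * bih_series 5 (X t)) / 2"
    using C[OF t] cos_double_sin[of "v t"] by (simp add: C_def Xs)
  have rhs: "bih_rhs (v t) (w t) z = exp (9 * t) * bih_series 7 (X t)"
    unfolding bih_rhs_expand sin2 eq(7)[OF t] S[OF t, symmetric]
    using m[OF t] unfolding S[OF t, symmetric] w_def z_def S_def m_def e3(2) e3(1)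
    by (simp add: algebra_simps power2_eq_square power3_eq_cube)
  have "(bih_E has_real_derivative exp (9 * t) * (9 * bih_series 8 (X t) + 6 * (X t * eval_fps (fps_deriv (bih_fps 8)) (X t)))) (at t)"
    unfolding bih_E_def[abs_def] Xs by (rule d[OF _ t]) simp
  moreover have "9 * bih_series 8 (X t) + 6 * (X t * eval_fps (fps_deriv (bih_fps 8)) (X t))
        = - 4 * bih_series 8 (X t) + bih_series 7 (X t)"
    using eq(8)[OF t] by simp
  ultimately have "(bih_E has_real_derivative exp (9 * t) * (- 4 * bih_series 8 (X t) + bih_series 7 (X t))) (at t)"
    by (simp only:)
  then show "(bih_E has_real_derivative - 4 * bih_E t +
      bih_rhs ((bih_H t - bih_J t) / 2) ((3 * bih_H t - bih_J t) / 2) (6 * bih_H t - bih_J t + bih_G t)) (at t)"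
    unfolding weq[OF t] z v_def[symmetric] rhs
    by (rule DERIV_cong) (unfold bih_E_def Xs, simp add: algebra_simps)
qed

text \<open>At the junction of series and continued solution both satisfy the same equation in the
  same state, so the one-sided derivatives agree.\<close>

lemma has_real_derivative_glue:
  fixes f g :: "real \<Rightarrow> real"
  assumes f: "(f has_real_derivative d) (at a)" and g: "(g has_real_derivative d) (at 0 within {0..})" and "f a = g 0"
  shows "((\<lambda>t. if t \<le> a then f t else g (t - a)) has_real_derivative d) (at a)"
proof -
  define h where "h t = (if t \<le> a then f t else g (t - a))" for t
  have "(h has_real_derivative d) (at a within {..a})"
    by (rule has_field_derivative_transform_within[OF has_field_derivative_at_within[OF f], of 1])
       (auto simp: h_def)
  moreover have "(h has_real_derivative d) (at a within {a..})"
  proof (rule has_field_derivative_transform_within[of _ _ _ _ 1])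
    have "(\<lambda>t. t - a) ` {a..} = {0..}"
      by (auto simp: image_def intro!: bexI[of _ "_ + a"])
    then have "((g \<circ> (\<lambda>t. t - a)) has_real_derivative d * 1) (at a within {a..})"
      using g by (intro DERIV_image_chain) (auto intro!: derivative_eq_intros)
    then show "((\<lambda>t. g (t - a)) has_real_derivative d) (at a within {a..})" by (simp add: o_def)
  qed (use assms(3) in \<open>auto simp: h_def\<close>)
  ultimately have "(h has_real_derivative d) (at a within {..a} \<union> {a..})"
    unfolding has_field_derivative_iff by (rule Lim_Un)
  moreover have "{..a} \<union> {a..} = UNIV" by auto
  ultimately show ?thesis by (simp add: h_def[abs_def])
qed

text \<open>The series provides the past up to a time t0 at which it lies in the cone; the blow-up
  solution starting from that state provides the future, shifted by t0 since the equation is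
  autonomous.\<close>

lemma bih_solution_exists:
  obtains T t0 H J G E where "t0 < 0" "t0 < T"
    "\<And>t. t < T \<Longrightarrow> (H has_real_derivative 3 * H t + G t) (at t)"
    "\<And>t. t < T \<Longrightarrow> (J has_real_derivative J t + G t) (at t)"
    "\<And>t. t < T \<Longrightarrow> (G has_real_derivative - 2 * G t + E t) (at t)"
    "\<And>t. t < T \<Longrightarrow> (E has_real_derivative - 4 * E t +
        bih_rhs ((H t - J t) / 2) ((3 * H t - J t) / 2) (6 * H t - J t + G t)) (at t)"
    "\<And>t. t \<le> t0 \<Longrightarrow> (H t - J t) / 2 = exp (3 * t) * ((bih_series 0 (exp (6 * t)) - exp (6 * t) * bih_series 10 (exp (6 * t))) / 2)"
    "filterlim (\<lambda>t. (H t - J t) / 2) at_top (at_left T)"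
proof -
  have cont: "isCont (bih_series c) 0" if "c \<le> 10" for c
    by (rule DERIV_isCont[OF has_real_derivative_bih_series[OF that]]) simp
  have "((\<lambda>x. bih_series 0 x - x * bih_series 10 x) \<longlongrightarrow> bih_series 0 0 - 0 * bih_series 10 0) (at 0)"
    using cont[of 0] cont[of 10] by (intro tendsto_intros) (auto simp: isCont_def)
  then have ev0: "\<forall>\<^sub>F x in at 0. 0 < bih_series 0 x - x * bih_series 10 x"
    by (rule order_tendstoD) (simp add: bih_series_0)
  have ev: "\<forall>\<^sub>F x in at 0. 0 < bih_series c x" if "c \<le> 10" "0 < bih_series c 0" for c
    by (rule order_tendstoD(1)[OF _ that(2)]) (use cont[OF that(1)] in \<open>simp add: isCont_def\<close>)
  have "\<forall>\<^sub>F x in at 0. 0 < bih_series 0 x - x * bih_series 10 x \<and> 0 < bih_series 10 x \<and> 0 < bih_series 9 x \<and> 0 < bih_series 8 x"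
    using ev0 ev[of 10] ev[of 9] ev[of 8] bih_series_0 by (simp add: eventually_conj)
  then obtain d where d: "d > 0" "\<And>x. x \<noteq> 0 \<Longrightarrow> dist x 0 < d \<Longrightarrow>
     0 < bih_series 0 x - x * bih_series 10 x \<and> 0 < bih_series 10 x \<and> 0 < bih_series 9 x \<and> 0 < bih_series 8 x"
    unfolding eventually_at by blast
  \<comment> \<open>After division by powers of exp t the cone conditions are strict inequalities
    between series at x = exp (6 t), true at x = 0 and hence for small x; x0 < 1 keeps t0
    negative.\<close>
  define x0 where "x0 = min (d / 2) (1 / 2)"
  have x0: "0 < x0" "x0 < d" "x0 < 1" using d(1) by (auto simp: x0_def min_def)
  have pos: "0 < bih_series 0 x0 - x0 * bih_series 10 x0" "0 < bih_series 10 x0" "0 < bih_series 9 x0" "0 < bih_series 8 x0"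
    using d(2)[of x0] x0 by auto
  define t0 where "t0 = ln x0 / 6"
  have e0: "exp (6 * t0) = x0" and t0: "t0 < 0" using x0 by (auto simp: t0_def)
  have e9: "exp (9 * t) = exp (3 * t) * exp (6 * t)" for t :: real by (simp flip: exp_add)
  have "bih_H t0 - bih_J t0 = exp (3 * t0) * (bih_series 0 x0 - x0 * bih_series 10 x0)"
    unfolding bih_H_def bih_J_def e9 e0 by (simp add: algebra_simps)
  then have cJ: "bih_J t0 < bih_H t0" using pos(1) by (metis diff_gt_0_iff_gt exp_gt_zero mult_pos_pos)
  have cG: "0 < bih_J t0" "0 < bih_G t0" "0 < bih_E t0"
    using pos by (simp_all add: bih_J_def bih_G_def bih_E_def e0)
  obtain T H J G E where T: "0 < T" and init: "H 0 = bih_H t0" "J 0 = bih_J t0" "G 0 = bih_G t0" "E 0 = bih_E t0"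
    and dd: "\<And>t. t \<in> {0..<T} \<Longrightarrow> (H has_real_derivative 3 * H t + G t) (at t within {0..})"
    "\<And>t. t \<in> {0..<T} \<Longrightarrow> (J has_real_derivative J t + G t) (at t within {0..})"
    "\<And>t. t \<in> {0..<T} \<Longrightarrow> (G has_real_derivative - 2 * G t + E t) (at t within {0..})"
    "\<And>t. t \<in> {0..<T} \<Longrightarrow> (E has_real_derivative - 4 * E t +
        bih_rhs ((H t - J t) / 2) ((3 * H t - J t) / 2) (6 * H t - J t + G t)) (at t within {0..})"
    and lim: "filterlim (\<lambda>t. (H t - J t) / 2) at_top (at_left T)"
    by (rule bih_blowup[OF cJ cG]) (rule that)
  define gl where "gl f g t = (if t \<le> t0 then f t else g (t - t0))" for f g :: "real \<Rightarrow> real" and t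
  have glue: "(gl f g has_real_derivative D) (at t)"
    if "t < t0 + T" "f t0 = g 0"
      and "\<And>t. t \<le> t0 \<Longrightarrow> (f has_real_derivative f' t) (at t)"
      and "\<And>t. t \<in> {0..<T} \<Longrightarrow> (g has_real_derivative g' t) (at t within {0..})"
      and "f' t0 = g' 0" and D: "D = (if t \<le> t0 then f' t else g' (t - t0))" for f g f' g' t D
  proof (cases t t0 rule: linorder_cases)
    case less
    then show ?thesis using D that(3)[of t]
      by (auto simp: gl_def[abs_def] intro: has_field_derivative_transform_within_open[of f _ t "{..<t0}"])
  next
    case equal
    then show ?thesis using D that(2,5) that(3)[of t0] that(4)[of 0] T
      by (auto simp: gl_def[abs_def] intro!: has_real_derivative_glue)
  next
    case greater
    have "at (t - t0) within {0..} = at (t - t0)" using greater by (intro at_within_interior) auto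
    then have "(g has_real_derivative g' (t - t0)) (at (t - t0))"
      using that(4)[of "t - t0"] that(1) greater by auto
    then have "((\<lambda>t. g (t - t0)) has_real_derivative g' (t - t0) * 1) (at t)"
      by (rule DERIV_chain2) (auto intro!: derivative_eq_intros)
    then show ?thesis using D greater
      by (auto simp: gl_def[abs_def] intro: has_field_derivative_transform_within_open[of "\<lambda>t. g (t - t0)" _ t "{t0<..}"])
  qed
  note ser = bih_series_solution[OF order_le_less_trans[OF _ t0]]
  show thesis
  proof (rule that[OF t0, of "t0 + T" "gl bih_H H" "gl bih_G G" "gl bih_J J" "gl bih_E E"])
    fix t assume t: "t < t0 + T"
    show "(gl bih_H H has_real_derivative 3 * gl bih_H H t + gl bih_G G t) (at t)"
      by (rule glue[OF t init(1)[symmetric] ser(1) dd(1)]) (auto simp: gl_def init)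
    show "(gl bih_J J has_real_derivative gl bih_J J t + gl bih_G G t) (at t)"
      by (rule glue[OF t init(2)[symmetric] ser(2) dd(2)]) (auto simp: gl_def init)
    show "(gl bih_G G has_real_derivative - 2 * gl bih_G G t + gl bih_E E t) (at t)"
      by (rule glue[OF t init(3)[symmetric] ser(3) dd(3)]) (auto simp: gl_def init)
    show "(gl bih_E E has_real_derivative - 4 * gl bih_E E t +
        bih_rhs ((gl bih_H H t - gl bih_J J t) / 2) ((3 * gl bih_H H t - gl bih_J J t) / 2)
          (6 * gl bih_H H t - gl bih_J J t + gl bih_G G t)) (at t)"
      by (rule glue[OF t init(4)[symmetric] ser(4) dd(4)]) (auto simp: gl_def init)
  next
    fix t assume "t \<le> t0"
    then show "(gl bih_H H t - gl bih_J J t) / 2 =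
       exp (3 * t) * ((bih_series 0 (exp (6 * t)) - exp (6 * t) * bih_series 10 (exp (6 * t))) / 2)"
      unfolding gl_def bih_H_def bih_J_def e9 by (simp add: algebra_simps)
  next
    have ev: "\<forall>\<^sub>F t in at_left (t0 + T). t \<in> {t0<..<t0 + T}"
      using T by (intro eventually_at_left_real) simp
    have "((\<lambda>t. t - t0) \<longlongrightarrow> (t0 + T) - t0) (at_left (t0 + T))" by (intro tendsto_intros)
    then have "filterlim (\<lambda>t. t - t0) (at_left T) (at_left (t0 + T))"
      unfolding filterlim_at using ev by (auto elim!: eventually_mono)
    from filterlim_compose[OF lim this]
    show "filterlim (\<lambda>t. (gl bih_H H t - gl bih_J J t) / 2) at_top (at_left (t0 + T))"
      by (rule filterlim_cong[THEN iffD1, OF refl refl, rotated])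
         (use ev in eventually_elim, simp add: gl_def)
  qed (use T in simp)
qed

section \<open>Regularity and the radial equation\<close>

text \<open>The entire function equal to sin (sqrt y) / sqrt y for y > 0. Together with
  \<open>cos_sqrt\<close> it expresses the profiles through v^2, which is smooth in |x|^2 although v
  is an odd function of r.\<close>

definition sinc_sqrt :: "real \<Rightarrow> real" where
  "sinc_sqrt y = (\<Sum>n. (- 1) ^ n / fact (2 * n + 1) * y ^ n)"

definition cos_sqrt :: "real \<Rightarrow> real" where
  "cos_sqrt y = (\<Sum>n. (- 1) ^ n / fact (2 * n) * y ^ n)"

lemma cos_sqrt_sums: "(\<lambda>n. (- 1) ^ n / fact (2 * n) * (x\<^sup>2) ^ n) sums cos x" for x :: real
  using cos_paired[of x] by (simp add: power_mult)

lemma sinc_sqrt_sums: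
  fixes x :: real
  assumes "x \<noteq> 0"
  shows "(\<lambda>n. (- 1) ^ n / fact (2 * n + 1) * (x\<^sup>2) ^ n) sums (sin x / x)"
proof -
  have "(\<lambda>n. x * ((- 1) ^ n / fact (2 * n + 1) * (x\<^sup>2) ^ n)) sums sin x"
    unfolding power_mult[symmetric] using sin_paired[of x] by (simp add: mult_ac)
  from sums_mult_D[OF this assms] show ?thesis .
qed

lemma cos_sqrt_power2: "cos_sqrt (x\<^sup>2) = cos x"
  unfolding cos_sqrt_def using cos_sqrt_sums by (rule sums_unique[symmetric])

lemma sinc_sqrt_power2: "x * sinc_sqrt (x\<^sup>2) = sin x"
proof (cases "x = 0")
  case False
  have "sinc_sqrt (x\<^sup>2) = sin x / x"
    unfolding sinc_sqrt_def by (rule sums_unique[OF sinc_sqrt_sums[OF False], symmetric])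
  with False show ?thesis by simp
qed simp

text \<open>Convergence at squares is enough: every R > 0 is a square, and convergence at R gives it
  for all smaller moduli, negative arguments included.\<close>

lemma C_diff_on_entire_powser:
  fixes c :: "nat \<Rightarrow> real"
  assumes "\<And>x. x \<noteq> 0 \<Longrightarrow> summable (\<lambda>n. c n * (x\<^sup>2) ^ n)"
  shows "C_diff_on k UNIV (\<lambda>y. \<Sum>n. c n * y ^ n)"
proof (rule C_diff_on_local)
  fix y :: real
  define R where "R = \<bar>y\<bar> + 1"
  have s: "summable (\<lambda>n. c n * z ^ n)" if "\<bar>z\<bar> < R" for z
  proof (rule powser_inside)
    have "sqrt R \<noteq> 0" by (simp add: R_def)
    from assms[OF this] show "summable (\<lambda>n. c n * R ^ n)" by (simp add: R_def)
  qed (use that in simp)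
  then have "C_diff_on k {-R<..<R} (\<lambda>y. \<Sum>n. c n * y ^ n)" by (rule C_diff_on_powser)
  moreover have "y \<in> {-R<..<R}" by (auto simp: R_def)
  ultimately show "\<exists>U. open U \<and> y \<in> U \<and> C_diff_on k U (\<lambda>y. \<Sum>n. c n * y ^ n)"
    by (intro exI[of _ "{-R<..<R}"]) simp
qed

lemma C_diff_on_cos_sqrt: "C_diff_on k UNIV cos_sqrt"
  unfolding cos_sqrt_def[abs_def]
  by (rule C_diff_on_entire_powser) (rule sums_summable[OF cos_sqrt_sums])

lemma C_diff_on_sinc_sqrt: "C_diff_on k UNIV sinc_sqrt"
  unfolding sinc_sqrt_def[abs_def]
  by (rule C_diff_on_entire_powser) (rule sums_summable[OF sinc_sqrt_sums])

lemma C_diff_on_bih_rhs: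
  fixes S :: "'a::euclidean_space set"
  assumes S: "open S" "C_diff_on k S v" "C_diff_on k S w" "C_diff_on k S z"
  shows "C_diff_on k S (\<lambda>x. bih_rhs (v x) (w x) (z x))"
proof -
  have sin: "C_diff_on k S (\<lambda>x. sin (f x))" if "C_diff_on k S f" for f :: "'a \<Rightarrow> real"
    by (rule C_diff_on_compose_real[OF S(1) _ conjunct1[OF C_diff_on_sin_cos] that]) simp
  show ?thesis
    unfolding bih_rhs_def
    by (intro C_diff_on_add C_diff_on_diff C_diff_on_mult C_diff_on_power C_diff_on_const sin S)
qed

text \<open>Bootstrapping: the right-hand sides are smooth expressions in the unknowns, so each
  order of differentiability yields the next.\<close>

lemma smooth_bih_solution:
  assumes "open S"
    "\<And>t. t \<in> S \<Longrightarrow> (H has_real_derivative 3 * H t + G t) (at t)"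
    "\<And>t. t \<in> S \<Longrightarrow> (J has_real_derivative J t + G t) (at t)"
    "\<And>t. t \<in> S \<Longrightarrow> (G has_real_derivative - 2 * G t + E t) (at t)"
    "\<And>t. t \<in> S \<Longrightarrow> (E has_real_derivative - 4 * E t +
        bih_rhs ((H t - J t) / 2) ((3 * H t - J t) / 2) (6 * H t - J t + G t)) (at t)"
  shows "C_diff_on k S H \<and> C_diff_on k S J \<and> C_diff_on k S G \<and> C_diff_on k S E"
proof (induction k)
  case 0
  note c = DERIV_continuous_on[OF has_field_derivative_at_within]
  show ?case
    using c[of S, OF assms(2)] c[of S, OF assms(3)] c[of S, OF assms(4)] c[of S, OF assms(5)] by simp
next
  case (Suc k)
  note I = C_diff_on_add[OF assms(1)] C_diff_on_diff[OF assms(1)] C_diff_on_mult[OF assms(1)]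
    C_diff_on_const[OF assms(1)] C_diff_on_bih_rhs[OF assms(1)]
  note vd = assms(2-5)[unfolded has_real_derivative_iff_has_vector_derivative]
  have "C_diff_on (Suc k) S H" by (rule C_diff_on_real_SucI[OF assms(1) vd(1)], assumption, intro I, insert Suc, simp_all)
  moreover have "C_diff_on (Suc k) S J" by (rule C_diff_on_real_SucI[OF assms(1) vd(2)], assumption, intro I, insert Suc, simp_all)
  moreover have "C_diff_on (Suc k) S G" by (rule C_diff_on_real_SucI[OF assms(1) vd(3)], assumption, intro I, insert Suc, simp_all)
  moreover have "C_diff_on (Suc k) S E"
    by (rule C_diff_on_real_SucI[OF assms(1) vd(4)], assumption, unfold divide_inverse, intro I, insert Suc, simp_all)
  ultimately show ?case by blast
qed

text \<open>The weight exp (a (T - t)) is r^(-a), and each application raises a by 2. With c = 14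
  and a = 1, 3 the operators on f are (D - 1)(D + 4) and (D - 3)(D + 2); with c = 10 and a = 0, 2
  they are D (D + 3) and (D - 2)(D + 1).\<close>

lemma radial_lap_exp:
  fixes T :: real
  assumes P: "\<And>s. s \<in> {0<..<1} \<Longrightarrow> P s = exp (a * (T - (ln s / 2 + T))) * f (ln s / 2 + T)"
    and f: "\<And>t. t < T \<Longrightarrow> (f has_real_derivative f1 t) (at t)" "\<And>t. t < T \<Longrightarrow> (f1 has_real_derivative f2 t) (at t)"
    and s: "s \<in> {0<..<1}"
  shows "radial_lap c P s = exp ((a + 2) * (T - (ln s / 2 + T))) *
    (f2 (ln s / 2 + T) - 2 * a * f1 (ln s / 2 + T) + a\<^sup>2 * f (ln s / 2 + T)
      + (c / 2 - 2) * (f1 (ln s / 2 + T) - a * f (ln s / 2 + T)))"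
proof -
  have e: "((\<lambda>t. exp (a * (T - t)) * g t) has_real_derivative exp (a * (T - t)) * (g' - a * g t)) (at t)"
    if "(g has_real_derivative g') (at t)" for g g' t
    by (rule derivative_eq_intros that refl)+ (simp add: algebra_simps)
  have lt: "ln s / 2 + T < T" if "s \<in> {0<..<1}" for s using that by simp
  have "radial_lap c P s = (exp (a * (T - (ln s / 2 + T))) * (f2 (ln s / 2 + T) - a * f1 (ln s / 2 + T)
         - a * (f1 (ln s / 2 + T) - a * f (ln s / 2 + T)))
      + (c / 2 - 2) * (exp (a * (T - (ln s / 2 + T))) * (f1 (ln s / 2 + T) - a * f (ln s / 2 + T)))) / s"
  proof (rule radial_lap_ln[where J = "{0<..<1}" and p = "\<lambda>t. exp (a * (T - t)) * f t" and
        ?p1.0 = "\<lambda>t. exp (a * (T - t)) * (f1 t - a * f t)" and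
        ?p2.0 = "\<lambda>t. exp (a * (T - t)) * (f2 t - a * f1 t - a * (f1 t - a * f t))"])
    fix s :: real assume s: "s \<in> {0<..<1}"
    show "((\<lambda>t. exp (a * (T - t)) * f t) has_real_derivative
      exp (a * (T - (ln s / 2 + T))) * (f1 (ln s / 2 + T) - a * f (ln s / 2 + T))) (at (ln s / 2 + T))"
      by (rule e[OF f(1)[OF lt[OF s]]])
    show "((\<lambda>t. exp (a * (T - t)) * (f1 t - a * f t)) has_real_derivative
      exp (a * (T - (ln s / 2 + T))) * (f2 (ln s / 2 + T) - a * f1 (ln s / 2 + T) - a * (f1 (ln s / 2 + T) - a * f (ln s / 2 + T))))
       (at (ln s / 2 + T))"
      by (rule e[OF DERIV_diff[OF f(2)[OF lt[OF s]] DERIV_cmult[OF f(1)[OF lt[OF s]]]]])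
  qed (use s P in auto)
  moreover have "exp ((a + 2) * (T - (ln s / 2 + T))) = exp (a * (T - (ln s / 2 + T))) / s"
  proof -
    have "(a + 2) * (T - (ln s / 2 + T)) = a * (T - (ln s / 2 + T)) - ln s" by (simp add: algebra_simps)
    then show ?thesis using s by (simp add: exp_diff)
  qed
  ultimately show ?thesis by (simp add: algebra_simps power2_eq_square add_divide_distrib diff_divide_distrib)
qed

text \<open>\<open>F\<close> and \<open>C\<close> with indices are the derivatives of sin v and cos
  v. In the combination the terms v1 v3, v2^2 and v1^4 cancel, v4 appears with factor S^2 + C^2, and
  the unequal coefficients 13, 5 and 14, 6 leave the terms with factor 8.\<close>

lemma bih_tangential:
  fixes v0 v1 v2 v3 v4 S C :: real
  assumes ode: "v4 = - 2 * v3 + 13 * v2 + 14 * v1 - 24 * v0 + 6 * v1\<^sup>2 * (v1 + v2) - 4 * v1 ^ 3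
      - 8 * S\<^sup>2 * (v1 + v2) - 8 * S * C * v1\<^sup>2 + 24 * v0 - 24 * S * C"
    and SC: "S\<^sup>2 + C\<^sup>2 = 1"
    and F: "F1 = C * v1" "F2 = C * v2 - S * v1\<^sup>2" "F3 = C * v3 - 3 * S * v1 * v2 - C * v1 ^ 3"
      "F4 = C * v4 - 4 * S * v1 * v3 - 3 * S * v2\<^sup>2 - 6 * C * v1\<^sup>2 * v2 + S * v1 ^ 4"
    and K: "C1 = - S * v1" "C2 = - S * v2 - C * v1\<^sup>2" "C3 = - S * v3 - 3 * C * v1 * v2 + S * v1 ^ 3"
      "C4 = - S * v4 - 4 * C * v1 * v3 - 3 * C * v2\<^sup>2 + 6 * S * v1\<^sup>2 * v2 + C * v1 ^ 4"
  shows "C * (F4 + 2 * F3 - 13 * F2 - 14 * F1 + 24 * S) = S * (C4 + 2 * C3 - 5 * C2 - 6 * C1)"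
proof -
  have "C * (F4 + 2 * F3 - 13 * F2 - 14 * F1 + 24 * S) - S * (C4 + 2 * C3 - 5 * C2 - 6 * C1)
    = (S\<^sup>2 + C\<^sup>2) * (v4 + 2 * v3 - 6 * v1\<^sup>2 * v2 - 2 * v1 ^ 3 - 13 * v2 - 14 * v1) + 8 * S * C * v1\<^sup>2 + 8 * S\<^sup>2 * (v1 + v2) + 24 * S * C"
    unfolding F K by algebra
  then show ?thesis unfolding SC ode by (simp add: algebra_simps power2_eq_square power3_eq_cube)
qed

text \<open>The equality says that the bi-Laplacian of (P x, Q) is parallel to (P x, Q), which is
  the biharmonic equation away from the origin.\<close>

lemma bih_equation:
  fixes T :: real
  assumes H: "\<And>t. t < T \<Longrightarrow> (H has_real_derivative 3 * H t + G t) (at t)"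
    and J: "\<And>t. t < T \<Longrightarrow> (J has_real_derivative J t + G t) (at t)"
    and G: "\<And>t. t < T \<Longrightarrow> (G has_real_derivative - 2 * G t + E t) (at t)"
    and E: "\<And>t. t < T \<Longrightarrow> (E has_real_derivative - 4 * E t +
        bih_rhs ((H t - J t) / 2) ((3 * H t - J t) / 2) (6 * H t - J t + G t)) (at t)"
    and v: "\<And>t. v t = (H t - J t) / 2"
    and P: "\<And>s. s \<in> {0<..<1} \<Longrightarrow> P s = exp (- (ln s / 2)) * sin (v (ln s / 2 + T))"
    and Q: "\<And>s. s \<in> {0<..<1} \<Longrightarrow> Q s = cos (v (ln s / 2 + T))"
    and s: "s \<in> {0<..<1}"
  shows "Q s * radial_lap 14 (radial_lap 14 P) s = P s * radial_lap 10 (radial_lap 10 Q) s"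
proof -
  define v1 where "v1 t = (3 * H t - J t) / 2" for t
  define v2 where "v2 t = (9 * H t - J t) / 2 + G t" for t
  define v3 where "v3 t = (27 * H t - J t) / 2 + 2 * G t + E t" for t
  define v4 where "v4 t = - 2 * v3 t + 13 * v2 t + 14 * v1 t - 24 * v t + bih_rhs (v t) (v1 t) (v1 t + v2 t)" for t
  have d0: "(v has_real_derivative v1 t) (at t)" if "t < T" for t
  proof -
    have "((\<lambda>t. (H t - J t) / 2) has_real_derivative v1 t) (at t)"
      by (rule DERIV_cong[OF DERIV_cdivide[OF DERIV_diff[OF H[OF that] J[OF that]]]]) (simp add: v1_def)
    then show ?thesis by (simp add: v[abs_def])
  qed
  have d1: "(v1 has_real_derivative v2 t) (at t)" if "t < T" for t
    unfolding v1_def[abs_def]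
    by (rule DERIV_cong[OF DERIV_cdivide[OF DERIV_diff[OF DERIV_cmult[OF H[OF that]] J[OF that]]]])
       (simp add: v2_def field_simps)
  have d2: "(v2 has_real_derivative v3 t) (at t)" if "t < T" for t
    unfolding v2_def[abs_def]
    by (rule DERIV_cong[OF DERIV_add[OF DERIV_cdivide[OF DERIV_diff[OF DERIV_cmult[OF H[OF that]] J[OF that]]] G[OF that]]])
       (simp add: v3_def field_simps)
  have d3: "(v3 has_real_derivative v4 t) (at t)" if "t < T" for t
  proof -
    have z: "6 * H t - J t + G t = v1 t + v2 t" by (simp add: v1_def v2_def field_simps)
    show ?thesis
      unfolding v3_def[abs_def]
      by (rule DERIV_cong[OF DERIV_add[OF DERIV_add[OF DERIV_cdivide[OF DERIV_diff[OF DERIV_cmult[OF H[OF that]] J[OF that]]]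
          DERIV_cmult[OF G[OF that]]] E[OF that]]])
         (simp add: v4_def v z v3_def[abs_def], simp add: v1_def v2_def field_simps)
  qed
  define F where "F t = sin (v t)" for t
  define F1 where "F1 t = cos (v t) * v1 t" for t
  define F2 where "F2 t = cos (v t) * v2 t - sin (v t) * (v1 t)\<^sup>2" for t
  define F3 where "F3 t = cos (v t) * v3 t - 3 * sin (v t) * v1 t * v2 t - cos (v t) * v1 t ^ 3" for t
  define F4 where "F4 t = cos (v t) * v4 t - 4 * sin (v t) * v1 t * v3 t - 3 * sin (v t) * (v2 t)\<^sup>2
    - 6 * cos (v t) * (v1 t)\<^sup>2 * v2 t + sin (v t) * v1 t ^ 4" for t
  define C where "C t = cos (v t)" for t
  define C1 where "C1 t = - sin (v t) * v1 t" for t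
  define C2 where "C2 t = - sin (v t) * v2 t - cos (v t) * (v1 t)\<^sup>2" for t
  define C3 where "C3 t = - sin (v t) * v3 t - 3 * cos (v t) * v1 t * v2 t + sin (v t) * v1 t ^ 3" for t
  define C4 where "C4 t = - sin (v t) * v4 t - 4 * cos (v t) * v1 t * v3 t - 3 * cos (v t) * (v2 t)\<^sup>2
    + 6 * sin (v t) * (v1 t)\<^sup>2 * v2 t + cos (v t) * v1 t ^ 4" for t
  have dF: "(F has_real_derivative F1 t) (at t)" "(F1 has_real_derivative F2 t) (at t)"
    "(F2 has_real_derivative F3 t) (at t)" "(F3 has_real_derivative F4 t) (at t)" if t: "t < T" for t
    unfolding F_def[abs_def] F1_def[abs_def] F2_def[abs_def] F3_def[abs_def] F4_def
    by ((rule derivative_eq_intros d0[OF t] d1[OF t] d2[OF t] d3[OF t] refl)+,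
        simp add: algebra_simps power2_eq_square power3_eq_cube power4_eq_xxxx)+
  have dC: "(C has_real_derivative C1 t) (at t)" "(C1 has_real_derivative C2 t) (at t)"
    "(C2 has_real_derivative C3 t) (at t)" "(C3 has_real_derivative C4 t) (at t)" if t: "t < T" for t
    unfolding C_def[abs_def] C1_def[abs_def] C2_def[abs_def] C3_def[abs_def] C4_def
    by ((rule derivative_eq_intros d0[OF t] d1[OF t] d2[OF t] d3[OF t] refl)+,
        simp add: algebra_simps power2_eq_square power3_eq_cube power4_eq_xxxx)+
  define \<tau> where "\<tau> = ln s / 2 + T"
  define \<Phi> where "\<Phi> t = F2 t + 3 * F1 t - 4 * F t" for t
  have d\<Phi>: "(\<Phi> has_real_derivative F3 t + 3 * F2 t - 4 * F1 t) (at t)"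
    "((\<lambda>t. F3 t + 3 * F2 t - 4 * F1 t) has_real_derivative F4 t + 3 * F3 t - 4 * F2 t) (at t)" if "t < T" for t
    unfolding \<Phi>_def[abs_def] by (intro DERIV_add DERIV_diff DERIV_cmult dF that)+
  have "radial_lap 14 P s = exp (3 * (T - (ln s / 2 + T))) * \<Phi> (ln s / 2 + T)" if "s \<in> {0<..<1}" for s
    using radial_lap_exp[of P 1 T F F1 F2 s 14, OF _ dF(1,2) that] P
    by (simp add: F_def \<Phi>_def algebra_simps)
  then have PP: "radial_lap 14 (radial_lap 14 P) s = exp (5 * (T - \<tau>)) *
      (F4 \<tau> + 2 * F3 \<tau> - 13 * F2 \<tau> - 14 * F1 \<tau> + 24 * F \<tau>)"
    using radial_lap_exp[of "radial_lap 14 P" 3 T \<Phi> "\<lambda>t. F3 t + 3 * F2 t - 4 * F1 t" "\<lambda>t. F4 t + 3 * F3 t - 4 * F2 t" s 14, OF _ d\<Phi> s]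
    by (simp add: \<Phi>_def \<tau>_def algebra_simps)
  define \<Psi> where "\<Psi> t = C2 t + 3 * C1 t" for t
  have d\<Psi>: "(\<Psi> has_real_derivative C3 t + 3 * C2 t) (at t)"
    "((\<lambda>t. C3 t + 3 * C2 t) has_real_derivative C4 t + 3 * C3 t) (at t)" if "t < T" for t
    unfolding \<Psi>_def[abs_def] by (intro DERIV_add DERIV_diff DERIV_cmult dC that)+
  have "radial_lap 10 Q s = exp (2 * (T - (ln s / 2 + T))) * \<Psi> (ln s / 2 + T)" if "s \<in> {0<..<1}" for s
    using radial_lap_exp[of Q 0 T C C1 C2 s 10, OF _ dC(1,2) that] Q
    by (simp add: C_def \<Psi>_def algebra_simps)
  then have QQ: "radial_lap 10 (radial_lap 10 Q) s = exp (4 * (T - \<tau>)) *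
      (C4 \<tau> + 2 * C3 \<tau> - 5 * C2 \<tau> - 6 * C1 \<tau>)"
    using radial_lap_exp[of "radial_lap 10 Q" 2 T \<Psi> "\<lambda>t. C3 t + 3 * C2 t" "\<lambda>t. C4 t + 3 * C3 t" s 10, OF _ d\<Psi> s]
    by (simp add: \<Psi>_def \<tau>_def algebra_simps)
  have key: "cos (v \<tau>) * (F4 \<tau> + 2 * F3 \<tau> - 13 * F2 \<tau> - 14 * F1 \<tau> + 24 * sin (v \<tau>))
      = sin (v \<tau>) * (C4 \<tau> + 2 * C3 \<tau> - 5 * C2 \<tau> - 6 * C1 \<tau>)"
    by (rule bih_tangential[where ?v0.0 = "v \<tau>" and ?v1.0 = "v1 \<tau>" and ?v2.0 = "v2 \<tau>" and ?v3.0 = "v3 \<tau>" and ?v4.0 = "v4 \<tau>"])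
       (simp_all only: F1_def F2_def F3_def F4_def C1_def C2_def C3_def C4_def sin_cos_squared_add,
        simp only: v4_def bih_rhs_def sin_double, simp add: algebra_simps)
  \<comment> \<open>After two applications the weights are r^(-5) for P and r^(-4) for Q; the
    missing factor 1/r is the one contained in P.\<close>
  have e5: "exp (5 * (T - \<tau>)) = exp (- (ln s / 2)) * exp (4 * (T - \<tau>))"
    by (simp add: \<tau>_def flip: exp_add)
  have "c * ((x * y) * A) = (x * S) * (y * B)" if "c * A = S * B" for c A S B x y :: real
    using that by algebra
  from this[OF key] show ?thesis
    unfolding PP QQ P[OF s] Q[OF s] \<tau>_def[symmetric] F_def e5 .
qed

theorem theorem3:
  shows "\<exists>(\<psi> :: real \<Rightarrow> real) (u :: real^5 \<Rightarrow> (real^5) \<times> real).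
           continuous_on {0..<1} \<psi> \<and> \<psi> 0 = 0 \<and>
           u = Upsilon \<psi> \<and>
           smooth_on (ball 0 1) u \<and> u ` ball 0 1 \<subseteq> sphere 0 1 \<and>
           biharmonic_sphere_map_on (ball 0 1) u \<and>
           filterlim \<psi> at_top (at_left 1)"
proof -
  obtain T t0 H J G E where t0: "t0 < 0" "t0 < T" and
    d: "\<And>t. t < T \<Longrightarrow> (H has_real_derivative 3 * H t + G t) (at t)"
    "\<And>t. t < T \<Longrightarrow> (J has_real_derivative J t + G t) (at t)"
    "\<And>t. t < T \<Longrightarrow> (G has_real_derivative - 2 * G t + E t) (at t)"
    "\<And>t. t < T \<Longrightarrow> (E has_real_derivative - 4 * E t +
        bih_rhs ((H t - J t) / 2) ((3 * H t - J t) / 2) (6 * H t - J t + G t)) (at t)" and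
    ser: "\<And>t. t \<le> t0 \<Longrightarrow> (H t - J t) / 2 = exp (3 * t) * ((bih_series 0 (exp (6 * t)) - exp (6 * t) * bih_series 10 (exp (6 * t))) / 2)" and
    lim: "filterlim (\<lambda>t. (H t - J t) / 2) at_top (at_left T)"
    by (rule bih_solution_exists) (rule that)
  define v where "v t = (H t - J t) / 2" for t
  define \<nu> where "\<nu> x = (bih_series 0 x - x * bih_series 10 x) * (1 / 2)" for x
  \<comment> \<open>With s = r^2 and t = ln r + T one has exp (2 t) = L s; the shift by T moves the
    blow-up to r = 1.\<close>
  define L where "L = exp (2 * T)"
  define s1 where "s1 = exp (2 * (t0 - T))"
  have L: "L > 0" by (simp add: L_def)
  have s1: "0 < s1" "s1 < 1" using t0 by (simp_all add: s1_def)
  have v_ser: "v t = exp (3 * t) * \<nu> (exp (6 * t))" if "t \<le> t0" for t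
    using ser[OF that] by (simp add: v_def \<nu>_def)
  \<comment> \<open>At r = 0 the second branch would use the default value of \<open>ln\<close>; the
    value 0 set here is the limit of v at minus infinity.\<close>
  define \<psi> where "\<psi> r = (if r \<le> 0 then 0 else v (ln r + T))" for r
  \<comment> \<open>From v = exp (3 t) \<open>\<nu>\<close>(exp (6 t)) one gets v^2 = (L s)^3
    \<open>\<nu>\<close>((L s)^3)^2 and v / r = exp T * L s * \<open>\<nu>\<close>((L s)^3), both
    smooth in s at 0.\<close>
  define P0 where "P0 s = exp T * L * s * \<nu> ((L * s) ^ 3) * sinc_sqrt ((L * s) ^ 3 * (\<nu> ((L * s) ^ 3))\<^sup>2)" for s
  define Q0 where "Q0 s = cos_sqrt ((L * s) ^ 3 * (\<nu> ((L * s) ^ 3))\<^sup>2)" for s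
  define Pf where "Pf s = exp (- (ln s * (1 / 2))) * sin (v (ln s * (1 / 2) + T))" for s
  define Qf where "Qf s = cos (v (ln s * (1 / 2) + T))" for s
  define P where "P s = (if s < s1 then P0 s else Pf s)" for s
  define Q where "Q s = (if s < s1 then Q0 s else Qf s)" for s
  have eq0: "P0 s = Pf s" "Q0 s = Qf s" if "0 < s" "s < s1" for s
  proof -
    define \<tau> where "\<tau> = ln s * (1 / 2) + T"
    have "ln s < 2 * (t0 - T)"
      using ln_less_cancel_iff[OF that(1) s1(1)] that(2) by (simp add: s1_def)
    then have \<tau>: "\<tau> \<le> t0" by (simp add: \<tau>_def)
    have "2 * \<tau> = ln s + 2 * T" by (simp add: \<tau>_def)
    then have e2: "exp (2 * \<tau>) = L * s" using that by (simp add: L_def exp_add mult.commute)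
    have "exp (6 * \<tau>) = exp (2 * \<tau>) ^ 3" by (simp flip: exp_of_nat_mult)
    then have e6: "exp (6 * \<tau>) = (L * s) ^ 3" by (simp add: e2)
    have vs: "v \<tau> = exp (3 * \<tau>) * \<nu> ((L * s) ^ 3)" using v_ser[OF \<tau>] by (simp add: e6)
    have "(exp (3 * \<tau>))\<^sup>2 = exp (6 * \<tau>)" by (simp flip: exp_of_nat_mult)
    then have v2: "(v \<tau>)\<^sup>2 = (L * s) ^ 3 * (\<nu> ((L * s) ^ 3))\<^sup>2" by (simp add: vs power_mult_distrib e6)
    have "- (ln s * (1 / 2)) + 3 * \<tau> = T + 2 * \<tau>" by (simp add: \<tau>_def)
    then have "exp (- (ln s * (1 / 2))) * exp (3 * \<tau>) = exp T * (L * s)"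
      unfolding exp_add[symmetric] e2[symmetric] by (simp only:)
    moreover have "Pf s = exp (- (ln s * (1 / 2))) * (v \<tau> * sinc_sqrt ((v \<tau>)\<^sup>2))"
      unfolding sinc_sqrt_power2 by (simp add: Pf_def \<tau>_def)
    ultimately show "P0 s = Pf s"
      unfolding v2 unfolding vs P0_def by (simp add: mult.assoc[symmetric])
    have "Qf s = cos_sqrt ((v \<tau>)\<^sup>2)" unfolding cos_sqrt_power2 by (simp add: Qf_def \<tau>_def)
    then show "Q0 s = Qf s" unfolding v2 Q0_def by simp
  qed
  have Pf: "P s = Pf s" and Qf: "Q s = Qf s" if "0 < s" for s
    using eq0[of s] that by (auto simp: P_def Q_def)
  have Lsmall: "(L * s) ^ 3 \<in> {-1<..<1}" if "s \<in> {-s1<..<s1}" for s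
  proof -
    have "L * s1 = exp (2 * t0)" by (simp add: L_def s1_def right_diff_distrib flip: exp_add)
    then have "L * s1 < 1" using t0 by simp
    moreover have "\<bar>L * s\<bar> < L * s1" using that L by (simp add: abs_mult abs_less_iff)
    ultimately have "\<bar>L * s\<bar> < 1" by linarith
    then have "\<bar>L * s\<bar> ^ 3 < 1" by (intro power_less_one_iff[THEN iffD2]) auto
    then show ?thesis by (simp add: power_abs[symmetric] abs_less_iff)
  qed
  \<comment> \<open>Smoothness at the origin needs an open interval around s = 0; the series
    formulas supply the values for s <= 0.\<close>
  define I where "I = {-s1<..<1::real}"
  have smooth0: "C_diff_on k {-s1<..<s1} P0 \<and> C_diff_on k {-s1<..<s1} Q0" for k
  proof -
    note I0 = C_diff_on_mult[OF open_greaterThanLessThan] C_diff_on_power[OF open_greaterThanLessThan]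
      C_diff_on_const[OF open_greaterThanLessThan] C_diff_on_diff[OF open_greaterThanLessThan]
      C_diff_on_bounded_linear[OF open_greaterThanLessThan bounded_linear_ident]
    have "C_diff_on k {-1<..<1} \<nu>"
      unfolding \<nu>_def[abs_def] by (intro I0 C_diff_on_bih_series) auto
    then have nu: "C_diff_on k {-s1<..<s1} (\<lambda>s. \<nu> ((L * s) ^ 3))"
      by (rule C_diff_on_compose_real[OF _ Lsmall, rotated 2]) (auto intro!: I0)
    have arg: "C_diff_on k {-s1<..<s1} (\<lambda>s. (L * s) ^ 3 * (\<nu> ((L * s) ^ 3))\<^sup>2)"
      by (intro I0 nu)
    have "C_diff_on k {-s1<..<s1} (\<lambda>s. sinc_sqrt ((L * s) ^ 3 * (\<nu> ((L * s) ^ 3))\<^sup>2))"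
      by (rule C_diff_on_compose_real[OF _ _ C_diff_on_sinc_sqrt arg]) auto
    moreover have "C_diff_on k {-s1<..<s1} (\<lambda>s. cos_sqrt ((L * s) ^ 3 * (\<nu> ((L * s) ^ 3))\<^sup>2))"
      by (rule C_diff_on_compose_real[OF _ _ C_diff_on_cos_sqrt arg]) auto
    ultimately show ?thesis unfolding P0_def[abs_def] Q0_def[abs_def] by (intro conjI I0 nu) auto
  qed
  have smoothf: "C_diff_on k {0<..<1} Pf \<and> C_diff_on k {0<..<1} Qf" for k
  proof -
    note I0 = C_diff_on_mult[OF open_greaterThanLessThan] C_diff_on_add[OF open_greaterThanLessThan]
      C_diff_on_const[OF open_greaterThanLessThan] C_diff_on_minus[OF open_greaterThanLessThan]
    have ln: "C_diff_on k {0<..<1::real} ln" by (rule C_diff_on_subset[OF C_diff_on_ln]) auto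
    have "C_diff_on k {..<T} H" "C_diff_on k {..<T} J"
      using smooth_bih_solution[of "{..<T}" H G J E k] d by auto
    then have vT: "C_diff_on k {..<T} v"
      unfolding v_def[abs_def] divide_inverse by (intro C_diff_on_mult C_diff_on_diff C_diff_on_const) auto
    have half: "C_diff_on k {0<..<1} (\<lambda>s. ln s * (1 / 2) + T)" "C_diff_on k {0<..<1::real} (\<lambda>s. - (ln s * (1 / 2)) :: real)"
      by (intro I0 ln)+
    have v: "C_diff_on k {0<..<1} (\<lambda>s. v (ln s * (1 / 2) + T))"
      by (rule C_diff_on_compose_real[OF _ _ vT half(1)]) auto
    have "C_diff_on k {0<..<1::real} (\<lambda>s. exp (- (ln s * (1 / 2))) :: real)"
      by (rule C_diff_on_compose_real[OF _ _ C_diff_on_exp half(2)]) auto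
    moreover have "C_diff_on k {0<..<1} (\<lambda>s. sin (v (ln s * (1 / 2) + T)))" "C_diff_on k {0<..<1} (\<lambda>s. cos (v (ln s * (1 / 2) + T)))"
      using C_diff_on_compose_real[OF _ _ _ v, of UNIV sin] C_diff_on_compose_real[OF _ _ _ v, of UNIV cos] C_diff_on_sin_cos by auto
    ultimately show ?thesis unfolding Pf_def[abs_def] Qf_def[abs_def] by (intro conjI I0)
  qed
  have sm: "smooth_on I f" if "\<And>s. s < s1 \<Longrightarrow> f s = f0 s" "\<And>s. 0 < s \<Longrightarrow> f s = f1 s"
     "\<And>k. C_diff_on k {-s1<..<s1} f0" "\<And>k. C_diff_on k {0<..<1} f1" for f f0 f1 :: "real \<Rightarrow> real"
    unfolding smooth_on_def
  proof (intro allI C_diff_on_local)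
    fix k s assume s: "s \<in> I"
    show "\<exists>U. open U \<and> s \<in> U \<and> C_diff_on k U f"
    proof (cases "s < s1")
      case True
      have "C_diff_on k {-s1<..<s1} f" by (rule C_diff_on_cong_imp[OF _ that(3)]) (auto simp: that(1))
      then show ?thesis using True s by (intro exI[of _ "{-s1<..<s1}"]) (auto simp: I_def)
    next
      case False
      have "C_diff_on k {0<..<1} f" by (rule C_diff_on_cong_imp[OF _ that(4)]) (auto simp: that(2))
      then show ?thesis using False s s1 by (intro exI[of _ "{0<..<1}"]) (auto simp: I_def)
    qed
  qed
  have P: "smooth_on I P" using smooth0 smoothf Pf by (intro sm[of P P0 Pf]) (auto simp: P_def)
  have Q: "smooth_on I Q" using smooth0 smoothf Qf by (intro sm[of Q Q0 Qf]) (auto simp: Q_def)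
  have I: "x \<bullet> x \<in> I" if "x \<in> ball 0 1" for x :: "real^5"
  proof -
    have "x \<bullet> x < 1" using that by (simp add: dot_square_norm power_less_one_iff abs_square_less_1)
    then show ?thesis using s1 inner_ge_zero[of x] unfolding I_def greaterThanLessThan_iff by linarith
  qed
  have s01: "x \<bullet> x \<in> {0<..<1}" if "x \<in> ball 0 1" "x \<noteq> 0" for x :: "real^5"
    using I[OF that(1)] that(2) by (simp add: I_def)
  define u :: "real^5 \<Rightarrow> (real^5) \<times> real" where "u = Upsilon \<psi>"
  have Q00: "Q 0 = 1" using s1 cos_sqrt_power2[of 0] by (simp add: Q_def Q0_def)
  have u_eq: "radial_map P Q x = u x" if x: "x \<in> ball 0 1" for x
  proof (cases "x = 0")
    case True
    then show ?thesis by (simp add: u_def Upsilon_def radial_map_def Q00)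
  next
    case False
    then have n: "norm x > 0" by simp
    have ln: "ln (x \<bullet> x) * (1 / 2) = ln (norm x)"
      using n by (simp add: dot_square_norm ln_realpow)
    have e: "exp (- ln (norm x)) = inverse (norm x)" using n by (simp add: exp_minus)
    have xx: "0 < x \<bullet> x" using False by simp
    have "P (x \<bullet> x) = inverse (norm x) * sin (\<psi> (norm x))"
      unfolding Pf[OF xx] Pf_def ln e using n by (simp add: \<psi>_def)
    moreover have "Q (x \<bullet> x) = cos (\<psi> (norm x))"
      unfolding Qf[OF xx] Qf_def ln using n by (simp add: \<psi>_def)
    ultimately show ?thesis
      using False by (simp add: u_def Upsilon_def radial_map_def mult.commute)
  qed
  have rm_smooth: "smooth_on (ball 0 1) (radial_map P Q :: real^5 \<Rightarrow> _)"
    by (rule smooth_on_radial_map[OF open_ball I P Q])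
  have u_smooth: "smooth_on (ball 0 1) u"
    unfolding smooth_on_def
  proof
    fix k
    show "C_diff_on k (ball 0 1) u"
      by (rule C_diff_on_cong_imp[where f = "radial_map P Q"])
         (use rm_smooth u_eq in \<open>auto simp: smooth_on_def\<close>)
  qed
  have u_sphere: "u x \<in> sphere 0 1" for x
  proof -
    have "norm (u x) = 1"
    proof (cases "x = 0")
      case False
      then have "(inverse (norm x))\<^sup>2 * (norm x)\<^sup>2 = 1" by (simp flip: power_mult_distrib)
      then show ?thesis using False
        by (simp add: u_def Upsilon_def norm_Pair power_mult_distrib mult.assoc)
    qed (simp add: u_def Upsilon_def norm_Pair)
    then show ?thesis by simp
  qed
  have biharm: "orthogonal (laplacian (laplacian u) x) w"
    if x: "x \<in> ball 0 1" and w: "w \<in> tangent_space (sphere 0 1) (u x)" for x w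
  proof -
    define PP where "PP = radial_lap 14 (radial_lap 14 P) (x \<bullet> x)"
    define QQ where "QQ = radial_lap 10 (radial_lap 10 Q) (x \<bullet> x)"
    have lap1: "laplacian u y = laplacian (radial_map P Q) y" if "y \<in> ball 0 1" for y
      by (rule laplacian_cong_open[OF open_ball _ that rm_smooth]) (simp add: u_eq)
    have "open I" by (simp add: I_def)
    then have RP: "smooth_on I (radial_lap 14 P)" and RQ: "smooth_on I (radial_lap 10 Q)"
      by (rule smooth_on_radial_lap[OF _ P] smooth_on_radial_lap[OF _ Q])+
    have rl: "smooth_on (ball 0 1) (radial_map (radial_lap 14 P) (radial_lap 10 Q) :: real^5 \<Rightarrow> _)"
      by (rule smooth_on_radial_map[OF open_ball I RP RQ])
    have lap2: "laplacian u y = radial_map (radial_lap 14 P) (radial_lap 10 Q) y" if "y \<in> ball 0 1" for y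
      using laplacian_radial_map[OF open_ball I P Q that] lap1[OF that] by simp
    have "laplacian (laplacian u) x = laplacian (radial_map (radial_lap 14 P) (radial_lap 10 Q)) x"
      by (rule laplacian_cong_open[OF open_ball lap2 x rl])
    also have "\<dots> = radial_map (radial_lap 14 (radial_lap 14 P)) (radial_lap 10 (radial_lap 10 Q)) x"
      using laplacian_radial_map[OF open_ball I RP RQ x] by simp
    finally have lap: "laplacian (laplacian u) x = (PP *\<^sub>R x, QQ)"
      by (simp add: radial_map_def PP_def QQ_def)
    obtain a c where w_eq: "w = (a, c)" by (cases w)
    have nu: "norm (u x) = 1" using u_sphere[of x] by simp
    have "w \<bullet> u x = 0" using w tangent_space_sphere[OF nu] by simp
    then have tang: "P (x \<bullet> x) * (x \<bullet> a) + Q (x \<bullet> x) * c = 0"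
      by (simp add: u_eq[OF x, symmetric] radial_map_def w_eq inner_commute mult.commute)
    \<comment> \<open>Away from the origin the bi-Laplacian is parallel to u and hence orthogonal to
      the tangent vector (a, c). At the origin u is the pole, so tangency means c = 0.\<close>
    have "PP * (x \<bullet> a) + QQ * c = 0"
    proof (cases "x = 0")
      case True
      then show ?thesis using tang Q00 by simp
    next
      case False
      note s = s01[OF x False]
      define p where "p = P (x \<bullet> x)"
      define q where "q = Q (x \<bullet> x)"
      have eq: "q * PP = p * QQ"
        unfolding PP_def QQ_def p_def q_def
        by (rule bih_equation[OF d v_def _ _ s]) (auto simp: Pf Qf Pf_def Qf_def)
      have "(u x) \<bullet> (u x) = 1" using nu by (simp add: dot_square_norm)
      then have one: "(x \<bullet> x) * p\<^sup>2 + q\<^sup>2 = 1"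
        by (simp add: u_eq[OF x, symmetric] radial_map_def p_def q_def power2_eq_square mult_ac)
      have t: "p * (x \<bullet> a) + q * c = 0" using tang by (simp add: p_def q_def)
      \<comment> \<open>p or q may vanish, so the orthogonality is proved after multiplication by
        each of them and recovered from |x|^2 p^2 + q^2 = 1.\<close>
      have q0: "q * (PP * (x \<bullet> a) + QQ * c) = 0" using eq t by algebra
      have p0: "p * (PP * (x \<bullet> a) + QQ * c) = 0" using eq t by algebra
      have "(PP * (x \<bullet> a) + QQ * c) * ((x \<bullet> x) * p\<^sup>2 + q\<^sup>2) = 0" using q0 p0 by algebra
      then show ?thesis by (simp add: one)
    qed
    then show ?thesis by (simp add: orthogonal_def lap w_eq)
  qed
  have cont: "continuous_on {0..<1} \<psi>"
  proof -
    have "continuous (at r within {0..<1}) \<psi>" if r: "r \<in> {0..<1}" for r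
    proof (cases "r = 0")
      case False
      then have "r > 0" "ln r + T < T" using r by auto
      moreover have "isCont v (ln r + T)"
        unfolding v_def using DERIV_isCont[OF d(1)] DERIV_isCont[OF d(2)] \<open>ln r + T < T\<close>
        by (intro continuous_intros) auto
      ultimately have "isCont (\<lambda>r. v (ln r + T)) r"
        by (intro continuous_at_compose[unfolded o_def, of r "\<lambda>r. ln r + T" v] continuous_intros) auto
      moreover have "\<forall>\<^sub>F x in nhds r. x \<in> {0<..}"
        using \<open>r > 0\<close> by (intro eventually_nhds_in_open) auto
      then have "\<forall>\<^sub>F x in nhds r. \<psi> x = v (ln x + T)"
        by eventually_elim (simp add: \<psi>_def)
      ultimately have "isCont \<psi> r" by (simp add: isCont_cong)
      then show ?thesis by (rule continuous_at_imp_continuous_at_within)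
    next
      case True
      define K where "K = exp T"
      \<comment> \<open>The series in the variable r shows continuity at r = 0, where ln r is of no
        use.\<close>
      have small: "\<psi> r = (K * r) ^ 3 * \<nu> ((K * r) ^ 6)" if "0 \<le> r" "r < exp (t0 - T)" for r
      proof (cases "r = 0")
        case False
        then have "r > 0" using that by simp
        then have "ln r < t0 - T" using that ln_less_cancel_iff[of r "exp (t0 - T)"] by simp
        moreover have "exp (ln r + T) = K * r" using \<open>r > 0\<close> by (simp add: exp_add K_def)
        then have "exp (3 * (ln r + T)) = (K * r) ^ 3" "exp (6 * (ln r + T)) = (K * r) ^ 6"
          using exp_of_nat_mult[of 3 "ln r + T"] exp_of_nat_mult[of 6 "ln r + T"] by simp_all
        ultimately show ?thesis using v_ser[of "ln r + T"] \<open>r > 0\<close> by (simp add: \<psi>_def)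
      qed (simp add: \<psi>_def)
      have "isCont (bih_series c) 0" if "c \<le> 10" for c
        by (rule DERIV_isCont[OF has_real_derivative_bih_series[OF that]]) simp
      then have "isCont \<nu> 0" unfolding \<nu>_def[abs_def] by (intro continuous_intros) auto
      then have "isCont (\<lambda>r. (K * r) ^ 3 * \<nu> ((K * r) ^ 6)) 0"
        by (intro continuous_intros continuous_at_compose[unfolded o_def, of 0 "\<lambda>r. (K * r) ^ 6" \<nu>]) auto
      then have "continuous (at 0 within {0..<1}) (\<lambda>r. (K * r) ^ 3 * \<nu> ((K * r) ^ 6))"
        by (rule continuous_at_imp_continuous_at_within)
      then have "continuous (at 0 within {0..<1}) \<psi>"
        by (rule continuous_transform_within[of _ _ _ "exp (t0 - T)"])
           (auto simp: small dist_real_def)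
      then show ?thesis using True by simp
    qed
    then show ?thesis by (simp add: continuous_on_eq_continuous_within)
  qed
  have "filterlim \<psi> at_top (at_left 1)"
  proof -
    have ev: "\<forall>\<^sub>F r in at_left (1::real). r \<in> {0<..<1}" by (rule eventually_at_left_real) simp
    have "((\<lambda>r. ln r + T) \<longlongrightarrow> ln 1 + T) (at_left (1::real))" by (intro tendsto_intros) auto
    then have "filterlim (\<lambda>r. ln r + T) (at_left T) (at_left (1::real))"
      unfolding filterlim_at using ev by (auto elim!: eventually_mono)
    from filterlim_compose[OF lim this]
    show ?thesis
      by (rule filterlim_cong[THEN iffD1, OF refl refl, rotated])
         (use ev in eventually_elim, simp add: \<psi>_def v_def)
  qed
  then show ?thesis
    using cont u_smooth u_sphere biharm
    by (intro exI[of _ \<psi>] exI[of _ u]) (auto simp: u_def[symmetric] \<psi>_def[of 0] biharmonic_sphere_map_on_def)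
qed

end
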